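(* Let $\gamma>0$ and let $(y_\gamma,w_\gamma)\in H^2_N(\Omega)\times H^2_N(\Omega)$ be a solution to $$\begin{cases}-\Delta w_\gamma+H_\gamma(-y_\gamma w_\gamma)w_\gamma+y_\gamma=z,\\-\Delta y_\gamma+H_\gamma(-y_\gamma w_\gamma)y_\gamma=f.\end{cases}$$ Assume that at least one of the following holds: (a) $\|w_\gamma\|_{L^\infty(\Omega)}<\sqrt\gamma$; (b) $-1\notin\sigma(K)$ and $|\partial\omega_\gamma|=0$, where $K$ and $\partial\omega_\gamma$ are defined in the context. If $(y^0,w^0)\in H^2_N(\Omega)\times H^2_N(\Omega)$ is sufficiently close in $H^2(\Omega)\times H^2(\Omega)$ to $(y_\gamma,w_\gamma)$, then the semismooth Newton iteration $y^{k+1}=y^k+\delta y$, $w^{k+1}=w^k+\delta w$, where $(\delta y,\delta w)\in H^2_N(\Omega)\times H^2_N(\Omega)$ solves $$\begin{pmatrix}1-\tfrac1\gamma\chi^k(w^k)^2&B(y^k,w^k)\\ B(y^k,w^k)&-\tfrac1\gamma\chi^k(y^k)^2\end{pmatrix}\begin{pmatrix}\delta y\\ \delta w\end{pmatrix}=-\begin{pmatrix}-\Delta w^k+H_\gamma(-y^kw^k)w^k+y^k-z\\ -\Delta y^k+H_\gamma(-y^kw^k)y^k-f\end{pmatrix},\qquad \chi^k=\chi(-y^kw^k),$$ converges superlinearly in $H^2(\Omega)\times H^2(\Omega)$ to $(y_\gamma,w_\gamma)$.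
   Context: $\Omega\subset\mathbb{R}^N$, $N\le3$, is a bounded domain with outer unit normal $\nu$; $H^2_N(\Omega)=\{v\in H^2(\Omega):\partial_\nu v=0\text{ on }\partial\Omega\}$ with the $H^2(\Omega)$ norm. $f,z\in L^2(\Omega)$ are given. Let $\alpha>0$, $d\ge2$, and $u_1<\dots<u_d$ be given real numbers. For $M\geq u_1$ put $U_M=\{u\in L^2(\Omega):u_1\le u\le M\text{ a.e.}\}$. Standing assumption: $\Omega$ is sufficiently regular (and the $u_i$ are such) that for every $M$ there is $C_M$ such that for any $g\in L^2(\Omega)$ and $u\in U_M$ the problem $-\Delta y+uy=g$ in $\Omega$, $\partial_\nu y=0$ on $\partial\Omega$ has a unique solution, which satisfies $y\in H^2(\Omega)$ and $\|y\|_{H^2(\Omega)}\le C_M\|g\|_{L^2(\Omega)}$ (this forces $u_1>0$). Also $H^2(\Omega)$ embeds continuously into $C(\overline\Omega)$ (Sobolev embedding). For $\gamma>0$ define, for a function $p$ on $\Omega$, pointwise a.e. $$[H_\gamma(p)](x)=\begin{cases}u_i & p(x)\in Q_i^\gamma,\ 1\le i\le d,\\ \tfrac1\gamma\left(p(x)-\tfrac\alpha2(u_i+u_{i+1})\right)& p(x)\in Q_{i,i+1}^\gamma,\ 1\le i<d,\end{cases}$$ where $Q_1^\gamma=\{q\in\mathbb{R}: q<\tfrac\alpha2((1+\tfrac{2\gamma}\alpha)u_1+u_2)\}$, $Q_i^\gamma=\{q: \tfrac\alpha2(u_{i-1}+(1+\tfrac{2\gamma}\alpha)u_i)<q<\tfrac\alpha2((1+\tfrac{2\gamma}\alpha)u_i+u_{i+1})\}$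 for $1<i<d$, $Q_d^\gamma=\{q:\tfrac\alpha2(u_{d-1}+(1+\tfrac{2\gamma}\alpha)u_d)<q\}$, $Q_{i,i+1}^\gamma=\{q:\tfrac\alpha2((1+\tfrac{2\gamma}\alpha)u_i+u_{i+1})\le q\le\tfrac\alpha2(u_i+(1+\tfrac{2\gamma}\alpha)u_{i+1})\}$ for $1\le i<d$; $\partial Q_{i,i+1}^\gamma$ is its boundary in $\mathbb{R}$ (the two endpoints). For $p=-yw$, $\chi(-yw)$ is the characteristic function of $\bigcup_{i=1}^{d-1}\{x\in\Omega:-y(x)w(x)\in Q_{i,i+1}^\gamma\}$. All coefficient functions act as multiplication operators. For $y,w\in H^2(\Omega)$, $$B(y,w)=-\Delta+H_\gamma(-yw)-\tfrac1\gamma\chi(-yw)yw:H^2_N(\Omega)\to L^2(\Omega),$$ which is continuously invertible. For condition (b): $\omega_\gamma=\bigcup_{i=1}^{d-1}\{x\in\Omega:-y_\gamma(x)w_\gamma(x)\in Q^\gamma_{i,i+1}\}$; $\partial\omega_\gamma=\bigcup_{i=1}^{d-1}\{x\in\Omega:-y_\gamma(x)w_\gamma(x)\in\partial Q^\gamma_{i,i+1}\}$ and $|\cdot|$ is Lebesgue measure; $E_{\omega_\gamma}:L^2(\omega_\gamma)\to L^2(\Omega)$ is extension by zero; $h_\gamma=1-\tfrac1\gamma\chi(-y_\gamma w_\gamma)w_\gamma^2$; $Tv=B(y_\gamma,w_\gamma)^{-1}(\tfrac1{\sqrt\gamma}y_\gamma E_{\omega_\gamma}v)$ for $v\in L^2(\omega_\gamma)$,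 as an operator $L^2(\omega_\gamma)\to L^2(\Omega)$; $K=T^*(h_\gamma\,\mathrm{Id})T$ on $L^2(\omega_\gamma)$; $\sigma$ denotes the spectrum. Superlinear convergence in a normed space means that the iterates are well defined, $x^k\to x^*$, and $\|x^{k+1}-x^*\|=o(\|x^k-x^*\|)$ as $k\to\infty$. *)

theory Defs
  imports "HOL-Analysis.Analysis" "HOL-Probability.Essential_Supremum" "HOL-Library.Landau_Symbols"
begin

section \<open>Square-integrable functions\<close>

text \<open>Elements of \<open>L\<^sup>2\<close> are represented by functions; equality in \<open>L\<^sup>2\<close> is equality almost
  everywhere, and the norms below are the norms of the quotient spaces, evaluated on
  representatives.\<close>

definition L2 :: "'a measure \<Rightarrow> ('a \<Rightarrow> real) set" where
  "L2 M = {f \<in> borel_measurable M. integrable M (\<lambda>x. (f x)\<^sup>2)}"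

definition L2_inner :: "'a measure \<Rightarrow> ('a \<Rightarrow> real) \<Rightarrow> ('a \<Rightarrow> real) \<Rightarrow> real" where
  "L2_inner M f g = (LINT x|M. f x * g x)"

definition L2_norm :: "'a measure \<Rightarrow> ('a \<Rightarrow> real) \<Rightarrow> real" where
  "L2_norm M f = sqrt (L2_inner M f f)"

definition ae_eq :: "'a measure \<Rightarrow> ('a \<Rightarrow> real) \<Rightarrow> ('a \<Rightarrow> real) \<Rightarrow> bool" where
  "ae_eq M f g \<longleftrightarrow> (AE x in M. f x = g x)"

text \<open>\<open>Linf_norm\<close> takes values in the extended reals; it is infinite for functions that are not
  essentially bounded.\<close>

definition Linf_norm :: "'a measure \<Rightarrow> ('a \<Rightarrow> real) \<Rightarrow> ereal" where
  "Linf_norm M f = esssup M (\<lambda>x. ereal \<bar>f x\<bar>)"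

text \<open>Hilbert space adjoint of \<open>T : L\<^sup>2(M) \<rightarrow> L\<^sup>2(N)\<close>, determined up to equality a.e. when \<open>T\<close> is
  bounded.\<close>

definition L2_adjoint ::
  "'a measure \<Rightarrow> 'b measure \<Rightarrow> (('a \<Rightarrow> real) \<Rightarrow> ('b \<Rightarrow> real)) \<Rightarrow> ('b \<Rightarrow> real) \<Rightarrow> ('a \<Rightarrow> real)" where
  "L2_adjoint M N T g = (SOME v. v \<in> L2 M \<and> (\<forall>v'\<in>L2 M. L2_inner M v' v = L2_inner N (T v') g))"

text \<open>The real points of the spectrum of an operator on \<open>L\<^sup>2(M)\<close>: those \<open>l\<close> for which
  \<open>A - l Id\<close> is not a bijection of \<open>L\<^sup>2(M)\<close> (modulo equality a.e.) with bounded inverse.  For real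
  \<open>l\<close> it makes no difference whether \<open>A\<close> is considered on the real space or on its
  complexification.\<close>

definition L2_spectrum :: "'a measure \<Rightarrow> (('a \<Rightarrow> real) \<Rightarrow> ('a \<Rightarrow> real)) \<Rightarrow> real set" where
  "L2_spectrum M A = {l. \<not> (\<exists>C. \<forall>g\<in>L2 M. \<exists>v\<in>L2 M.
      ae_eq M (\<lambda>x. A v x - l * v x) g \<and>
      (\<forall>v'\<in>L2 M. ae_eq M (\<lambda>x. A v' x - l * v' x) g \<longrightarrow> ae_eq M v' v) \<and>
      L2_norm M v \<le> C * L2_norm M g)}"

section \<open>Classical and weak derivatives\<close>

fun Ck :: "nat \<Rightarrow> ('a::real_normed_vector \<Rightarrow> 'b::real_normed_vector) \<Rightarrow> bool" where
  "Ck 0 f \<longleftrightarrow> continuous_on UNIV f"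
| "Ck (Suc k) f \<longleftrightarrow> (\<forall>x. f differentiable (at x)) \<and>
     (\<forall>v. Ck k (\<lambda>x. frechet_derivative f (at x) v))"

definition smooth :: "('a::real_normed_vector \<Rightarrow> 'b::real_normed_vector) \<Rightarrow> bool" where
  "smooth f \<longleftrightarrow> (\<forall>k. Ck k f)"

definition partial :: "'a::real_normed_vector \<Rightarrow> ('a \<Rightarrow> real) \<Rightarrow> 'a \<Rightarrow> real" where
  "partial b f x = frechet_derivative f (at x) b"

definition grad :: "('a::euclidean_space \<Rightarrow> real) \<Rightarrow> 'a \<Rightarrow> 'a" where
  "grad f x = (\<Sum>b\<in>Basis. partial b f x *\<^sub>R b)"

definition divergence :: "('a::euclidean_space \<Rightarrow> 'a) \<Rightarrow> 'a \<Rightarrow> real" where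
  "divergence F x = (\<Sum>b\<in>Basis. frechet_derivative F (at x) b \<bullet> b)"

definition test_functions :: "'a::euclidean_space set \<Rightarrow> ('a \<Rightarrow> real) set" where
  "test_functions D = {\<phi>. smooth \<phi> \<and> (\<exists>C. compact C \<and> C \<subseteq> D \<and> (\<forall>x. x \<notin> C \<longrightarrow> \<phi> x = 0))}"

definition has_weak_partial ::
  "'a::euclidean_space set \<Rightarrow> 'a \<Rightarrow> ('a \<Rightarrow> real) \<Rightarrow> ('a \<Rightarrow> real) \<Rightarrow> bool" where
  "has_weak_partial D b f g \<longleftrightarrow> (\<forall>\<phi>\<in>test_functions D.
     L2_inner (lebesgue_on D) f (partial b \<phi>) = - L2_inner (lebesgue_on D) g \<phi>)"

definition wpartial ::
  "'a::euclidean_space set \<Rightarrow> 'a \<Rightarrow> ('a \<Rightarrow> real) \<Rightarrow> ('a \<Rightarrow> real)" where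
  "wpartial D b f = (SOME g. g \<in> L2 (lebesgue_on D) \<and> has_weak_partial D b f g)"

definition H1 :: "'a::euclidean_space set \<Rightarrow> ('a \<Rightarrow> real) set" where
  "H1 D = {f \<in> L2 (lebesgue_on D). \<forall>b\<in>Basis. \<exists>g\<in>L2 (lebesgue_on D). has_weak_partial D b f g}"

definition H2 :: "'a::euclidean_space set \<Rightarrow> ('a \<Rightarrow> real) set" where
  "H2 D = {f \<in> H1 D. \<forall>b\<in>Basis. wpartial D b f \<in> H1 D}"

definition H2_norm :: "'a::euclidean_space set \<Rightarrow> ('a \<Rightarrow> real) \<Rightarrow> real" where
  "H2_norm D f = sqrt ((L2_norm (lebesgue_on D) f)\<^sup>2
     + (\<Sum>b\<in>Basis. (L2_norm (lebesgue_on D) (wpartial D b f))\<^sup>2)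
     + (\<Sum>b\<in>Basis. \<Sum>c\<in>Basis. (L2_norm (lebesgue_on D) (wpartial D c (wpartial D b f)))\<^sup>2))"

definition H2_pair_dist :: "'a::euclidean_space set \<Rightarrow>
    ('a \<Rightarrow> real) \<times> ('a \<Rightarrow> real) \<Rightarrow> ('a \<Rightarrow> real) \<times> ('a \<Rightarrow> real) \<Rightarrow> real" where
  "H2_pair_dist D p q = sqrt ((H2_norm D (\<lambda>x. fst p x - fst q x))\<^sup>2
                            + (H2_norm D (\<lambda>x. snd p x - snd q x))\<^sup>2)"

definition laplacian :: "'a::euclidean_space set \<Rightarrow> ('a \<Rightarrow> real) \<Rightarrow> 'a \<Rightarrow> real" where
  "laplacian D f x = (\<Sum>b\<in>Basis. wpartial D b (wpartial D b f) x)"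

section \<open>The Neumann boundary condition\<close>

text \<open>\<open>\<nu>\<close> is the outer unit normal of \<open>D\<close> and \<open>S\<close> the surface measure on its boundary, in the
  measure-theoretic sense of De Giorgi: a unit vector field and a finite Borel measure on the
  boundary for which the divergence theorem holds.  By uniqueness of the polar decomposition of a
  vector measure, this determines \<open>S\<close>, and \<open>\<nu>\<close> up to \<open>S\<close>-null sets.  For a bounded Lipschitz
  domain they are the Hausdorff surface measure and the classical outer unit normal; in dimension
  one, \<open>S\<close> counts the two end points.\<close>

definition outer_unit_normal ::
  "'a::euclidean_space set \<Rightarrow> ('a \<Rightarrow> 'a) \<Rightarrow> 'a measure \<Rightarrow> bool" where
  "outer_unit_normal D \<nu> S \<longleftrightarrow>
     sets S = sets borel \<and> finite_measure S \<and> emeasure S (- frontier D) = 0 \<and>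
     \<nu> \<in> borel_measurable S \<and> (AE x in S. norm (\<nu> x) = 1) \<and>
     (\<forall>F. Ck 1 F \<longrightarrow> (LINT x|lebesgue_on D. divergence F x) = (LINT x|S. F x \<bullet> \<nu> x))"

text \<open>The normal derivative on \<open>H\<^sup>2\<close> in the sense of traces: the extension by continuity of
  \<open>\<phi> \<mapsto> \<nu> \<bullet> \<nabla>\<phi>\<close> on the boundary, from functions smooth up to the boundary to \<open>H\<^sup>2\<close>.\<close>

definition has_normal_derivative ::
  "'a::euclidean_space set \<Rightarrow> ('a \<Rightarrow> 'a) \<Rightarrow> 'a measure \<Rightarrow> ('a \<Rightarrow> real) \<Rightarrow> ('a \<Rightarrow> real) \<Rightarrow> bool" where
  "has_normal_derivative D \<nu> S v g \<longleftrightarrow> g \<in> L2 S \<and> (\<exists>\<phi>. (\<forall>n::nat. smooth (\<phi> n)) \<and>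
     (\<lambda>n. H2_norm D (\<lambda>x. \<phi> n x - v x)) \<longlonglongrightarrow> 0 \<and>
     (\<lambda>n. L2_norm S (\<lambda>x. \<nu> x \<bullet> grad (\<phi> n) x - g x)) \<longlonglongrightarrow> 0)"

definition H2_Neumann ::
  "'a::euclidean_space set \<Rightarrow> ('a \<Rightarrow> 'a) \<Rightarrow> 'a measure \<Rightarrow> ('a \<Rightarrow> real) set" where
  "H2_Neumann D \<nu> S = {v \<in> H2 D. has_normal_derivative D \<nu> S v (\<lambda>x. 0)}"

section \<open>Regularity of the domain\<close>

definition U_set :: "'a::euclidean_space set \<Rightarrow> real \<Rightarrow> real \<Rightarrow> ('a \<Rightarrow> real) set" where
  "U_set D u1 M = {u \<in> L2 (lebesgue_on D). AE x in lebesgue_on D. u1 \<le> u x \<and> u x \<le> M}"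

definition neumann_solution :: "'a::euclidean_space set \<Rightarrow> ('a \<Rightarrow> 'a) \<Rightarrow> 'a measure \<Rightarrow>
    ('a \<Rightarrow> real) \<Rightarrow> ('a \<Rightarrow> real) \<Rightarrow> ('a \<Rightarrow> real) \<Rightarrow> bool" where
  "neumann_solution D \<nu> S u g y \<longleftrightarrow> y \<in> H2_Neumann D \<nu> S \<and>
     ae_eq (lebesgue_on D) (\<lambda>x. - laplacian D y x + u x * y x) g"

definition elliptic_regularity ::
  "'a::euclidean_space set \<Rightarrow> ('a \<Rightarrow> 'a) \<Rightarrow> 'a measure \<Rightarrow> real \<Rightarrow> bool" where
  "elliptic_regularity D \<nu> S u1 \<longleftrightarrow> (\<forall>M\<ge>u1. \<exists>C. \<forall>g\<in>L2 (lebesgue_on D). \<forall>u\<in>U_set D u1 M.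
     \<exists>y. neumann_solution D \<nu> S u g y \<and>
         (\<forall>y'. neumann_solution D \<nu> S u g y' \<longrightarrow> ae_eq (lebesgue_on D) y' y) \<and>
         H2_norm D y \<le> C * L2_norm (lebesgue_on D) g)"

definition H2_embeds_continuous :: "'a::euclidean_space set \<Rightarrow> bool" where
  "H2_embeds_continuous D \<longleftrightarrow> (\<exists>C. \<forall>v\<in>H2 D. \<exists>v'. continuous_on (closure D) v' \<and>
     ae_eq (lebesgue_on D) v' v \<and> (\<forall>x\<in>closure D. \<bar>v' x\<bar> \<le> C * H2_norm D v))"

section \<open>The regularised multi-bang nonlinearity\<close>

definition Q_pure :: "real \<Rightarrow> nat \<Rightarrow> (nat \<Rightarrow> real) \<Rightarrow> real \<Rightarrow> nat \<Rightarrow> real set" where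
  "Q_pure \<alpha> d u \<gamma> i =
     {q. (1 < i \<longrightarrow> \<alpha>/2 * (u (i - 1) + (1 + 2*\<gamma>/\<alpha>) * u i) < q) \<and>
         (i < d \<longrightarrow> q < \<alpha>/2 * ((1 + 2*\<gamma>/\<alpha>) * u i + u (i + 1)))}"

definition Q_mixed :: "real \<Rightarrow> (nat \<Rightarrow> real) \<Rightarrow> real \<Rightarrow> nat \<Rightarrow> real set" where
  "Q_mixed \<alpha> u \<gamma> i =
     {q. \<alpha>/2 * ((1 + 2*\<gamma>/\<alpha>) * u i + u (i + 1)) \<le> q \<and>
         q \<le> \<alpha>/2 * (u i + (1 + 2*\<gamma>/\<alpha>) * u (i + 1))}"

text \<open>For \<open>\<alpha>, \<gamma> > 0\<close> and \<open>u 1 < \<dots> < u d\<close>, the sets \<open>Q_pure\<close> (\<open>1 \<le> i \<le> d\<close>) and \<open>Q_mixed\<close>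
  (\<open>1 \<le> i < d\<close>) partition the real line, so that exactly one term of the sums below is
  selected.\<close>

definition H_reg :: "real \<Rightarrow> nat \<Rightarrow> (nat \<Rightarrow> real) \<Rightarrow> real \<Rightarrow> real \<Rightarrow> real" where
  "H_reg \<alpha> d u \<gamma> q =
     (\<Sum>i\<in>{1..d}. if q \<in> Q_pure \<alpha> d u \<gamma> i then u i else 0) +
     (\<Sum>i\<in>{1..<d}. if q \<in> Q_mixed \<alpha> u \<gamma> i then 1/\<gamma> * (q - \<alpha>/2 * (u i + u (i + 1))) else 0)"

definition chi :: "real \<Rightarrow> nat \<Rightarrow> (nat \<Rightarrow> real) \<Rightarrow> real \<Rightarrow> real \<Rightarrow> real" where
  "chi \<alpha> d u \<gamma> = indicator (\<Union>i\<in>{1..<d}. Q_mixed \<alpha> u \<gamma> i)"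

definition B_op :: "'a::euclidean_space set \<Rightarrow> real \<Rightarrow> nat \<Rightarrow> (nat \<Rightarrow> real) \<Rightarrow> real \<Rightarrow>
    ('a \<Rightarrow> real) \<Rightarrow> ('a \<Rightarrow> real) \<Rightarrow> ('a \<Rightarrow> real) \<Rightarrow> ('a \<Rightarrow> real)" where
  "B_op D \<alpha> d u \<gamma> y w v = (\<lambda>x. - laplacian D v x + H_reg \<alpha> d u \<gamma> (- y x * w x) * v x
     - 1/\<gamma> * chi \<alpha> d u \<gamma> (- y x * w x) * y x * w x * v x)"

text \<open>Inverse of \<open>B(y, w) : H\<^sup>2\<^sub>N \<rightarrow> L\<^sup>2\<close>, determined up to equality a.e.\<close>

definition B_inv :: "'a::euclidean_space set \<Rightarrow> ('a \<Rightarrow> 'a) \<Rightarrow> 'a measure \<Rightarrow>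
    real \<Rightarrow> nat \<Rightarrow> (nat \<Rightarrow> real) \<Rightarrow> real \<Rightarrow>
    ('a \<Rightarrow> real) \<Rightarrow> ('a \<Rightarrow> real) \<Rightarrow> ('a \<Rightarrow> real) \<Rightarrow> ('a \<Rightarrow> real)" where
  "B_inv D \<nu> S \<alpha> d u \<gamma> y w g =
     (SOME v. v \<in> H2_Neumann D \<nu> S \<and> ae_eq (lebesgue_on D) (B_op D \<alpha> d u \<gamma> y w v) g)"

definition omega_mixed :: "'a::euclidean_space set \<Rightarrow> real \<Rightarrow> nat \<Rightarrow> (nat \<Rightarrow> real) \<Rightarrow> real \<Rightarrow>
    ('a \<Rightarrow> real) \<Rightarrow> ('a \<Rightarrow> real) \<Rightarrow> 'a set" where
  "omega_mixed D \<alpha> d u \<gamma> y w = (\<Union>i\<in>{1..<d}. {x \<in> D. - y x * w x \<in> Q_mixed \<alpha> u \<gamma> i})"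

text \<open>This is not the topological boundary of \<open>omega_mixed\<close>, but the set where \<open>- y w\<close> takes
  values in the boundary of one of the intervals \<open>Q_mixed\<close>.\<close>

definition omega_boundary :: "'a::euclidean_space set \<Rightarrow> real \<Rightarrow> nat \<Rightarrow> (nat \<Rightarrow> real) \<Rightarrow> real \<Rightarrow>
    ('a \<Rightarrow> real) \<Rightarrow> ('a \<Rightarrow> real) \<Rightarrow> 'a set" where
  "omega_boundary D \<alpha> d u \<gamma> y w =
     (\<Union>i\<in>{1..<d}. {x \<in> D. - y x * w x \<in> frontier (Q_mixed \<alpha> u \<gamma> i)})"

definition ext_zero :: "'a set \<Rightarrow> ('a \<Rightarrow> real) \<Rightarrow> ('a \<Rightarrow> real)" where
  "ext_zero A v = (\<lambda>x. if x \<in> A then v x else 0)"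

definition h_weight :: "real \<Rightarrow> nat \<Rightarrow> (nat \<Rightarrow> real) \<Rightarrow> real \<Rightarrow>
    ('a \<Rightarrow> real) \<Rightarrow> ('a \<Rightarrow> real) \<Rightarrow> ('a \<Rightarrow> real)" where
  "h_weight \<alpha> d u \<gamma> y w = (\<lambda>x. 1 - 1/\<gamma> * chi \<alpha> d u \<gamma> (- y x * w x) * (w x)\<^sup>2)"

definition T_op :: "'a::euclidean_space set \<Rightarrow> ('a \<Rightarrow> 'a) \<Rightarrow> 'a measure \<Rightarrow>
    real \<Rightarrow> nat \<Rightarrow> (nat \<Rightarrow> real) \<Rightarrow> real \<Rightarrow>
    ('a \<Rightarrow> real) \<Rightarrow> ('a \<Rightarrow> real) \<Rightarrow> ('a \<Rightarrow> real) \<Rightarrow> ('a \<Rightarrow> real)" where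
  "T_op D \<nu> S \<alpha> d u \<gamma> y w v =
     B_inv D \<nu> S \<alpha> d u \<gamma> y w
       (\<lambda>x. 1 / sqrt \<gamma> * y x * ext_zero (omega_mixed D \<alpha> d u \<gamma> y w) v x)"

definition K_op :: "'a::euclidean_space set \<Rightarrow> ('a \<Rightarrow> 'a) \<Rightarrow> 'a measure \<Rightarrow>
    real \<Rightarrow> nat \<Rightarrow> (nat \<Rightarrow> real) \<Rightarrow> real \<Rightarrow>
    ('a \<Rightarrow> real) \<Rightarrow> ('a \<Rightarrow> real) \<Rightarrow> ('a \<Rightarrow> real) \<Rightarrow> ('a \<Rightarrow> real)" where
  "K_op D \<nu> S \<alpha> d u \<gamma> y w v =
     L2_adjoint (lebesgue_on (omega_mixed D \<alpha> d u \<gamma> y w)) (lebesgue_on D)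
       (T_op D \<nu> S \<alpha> d u \<gamma> y w)
       (\<lambda>x. h_weight \<alpha> d u \<gamma> y w x * T_op D \<nu> S \<alpha> d u \<gamma> y w v x)"

section \<open>The optimality system and the semismooth Newton iteration\<close>

definition residual1 :: "'a::euclidean_space set \<Rightarrow> real \<Rightarrow> nat \<Rightarrow> (nat \<Rightarrow> real) \<Rightarrow> real \<Rightarrow>
    ('a \<Rightarrow> real) \<Rightarrow> ('a \<Rightarrow> real) \<Rightarrow> ('a \<Rightarrow> real) \<Rightarrow> ('a \<Rightarrow> real)" where
  "residual1 D \<alpha> d u \<gamma> z y w =
     (\<lambda>x. - laplacian D w x + H_reg \<alpha> d u \<gamma> (- y x * w x) * w x + y x - z x)"

definition residual2 :: "'a::euclidean_space set \<Rightarrow> real \<Rightarrow> nat \<Rightarrow> (nat \<Rightarrow> real) \<Rightarrow> real \<Rightarrow>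
    ('a \<Rightarrow> real) \<Rightarrow> ('a \<Rightarrow> real) \<Rightarrow> ('a \<Rightarrow> real) \<Rightarrow> ('a \<Rightarrow> real)" where
  "residual2 D \<alpha> d u \<gamma> f y w =
     (\<lambda>x. - laplacian D y x + H_reg \<alpha> d u \<gamma> (- y x * w x) * y x - f x)"

definition newton_update :: "'a::euclidean_space set \<Rightarrow> ('a \<Rightarrow> 'a) \<Rightarrow> 'a measure \<Rightarrow>
    real \<Rightarrow> nat \<Rightarrow> (nat \<Rightarrow> real) \<Rightarrow> real \<Rightarrow> ('a \<Rightarrow> real) \<Rightarrow> ('a \<Rightarrow> real) \<Rightarrow>
    ('a \<Rightarrow> real) \<Rightarrow> ('a \<Rightarrow> real) \<Rightarrow> ('a \<Rightarrow> real) \<Rightarrow> ('a \<Rightarrow> real) \<Rightarrow> bool" where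
  "newton_update D \<nu> S \<alpha> d u \<gamma> f z y w \<delta>y \<delta>w \<longleftrightarrow>
     \<delta>y \<in> H2_Neumann D \<nu> S \<and> \<delta>w \<in> H2_Neumann D \<nu> S \<and>
     ae_eq (lebesgue_on D)
       (\<lambda>x. (1 - 1/\<gamma> * chi \<alpha> d u \<gamma> (- y x * w x) * (w x)\<^sup>2) * \<delta>y x + B_op D \<alpha> d u \<gamma> y w \<delta>w x)
       (\<lambda>x. - residual1 D \<alpha> d u \<gamma> z y w x) \<and>
     ae_eq (lebesgue_on D)
       (\<lambda>x. B_op D \<alpha> d u \<gamma> y w \<delta>y x - 1/\<gamma> * chi \<alpha> d u \<gamma> (- y x * w x) * (y x)\<^sup>2 * \<delta>w x)
       (\<lambda>x. - residual2 D \<alpha> d u \<gamma> f y w x)"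

definition newton_uniquely_solvable :: "'a::euclidean_space set \<Rightarrow> ('a \<Rightarrow> 'a) \<Rightarrow> 'a measure \<Rightarrow>
    real \<Rightarrow> nat \<Rightarrow> (nat \<Rightarrow> real) \<Rightarrow> real \<Rightarrow> ('a \<Rightarrow> real) \<Rightarrow> ('a \<Rightarrow> real) \<Rightarrow>
    ('a \<Rightarrow> real) \<Rightarrow> ('a \<Rightarrow> real) \<Rightarrow> bool" where
  "newton_uniquely_solvable D \<nu> S \<alpha> d u \<gamma> f z y w \<longleftrightarrow>
     (\<exists>\<delta>y \<delta>w. newton_update D \<nu> S \<alpha> d u \<gamma> f z y w \<delta>y \<delta>w \<and>
       (\<forall>\<delta>y' \<delta>w'. newton_update D \<nu> S \<alpha> d u \<gamma> f z y w \<delta>y' \<delta>w' \<longrightarrow>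
          ae_eq (lebesgue_on D) \<delta>y' \<delta>y \<and> ae_eq (lebesgue_on D) \<delta>w' \<delta>w))"

definition newton_iterates :: "'a::euclidean_space set \<Rightarrow> ('a \<Rightarrow> 'a) \<Rightarrow> 'a measure \<Rightarrow>
    real \<Rightarrow> nat \<Rightarrow> (nat \<Rightarrow> real) \<Rightarrow> real \<Rightarrow> ('a \<Rightarrow> real) \<Rightarrow> ('a \<Rightarrow> real) \<Rightarrow>
    ('a \<Rightarrow> real) \<Rightarrow> ('a \<Rightarrow> real) \<Rightarrow> (nat \<Rightarrow> 'a \<Rightarrow> real) \<Rightarrow> (nat \<Rightarrow> 'a \<Rightarrow> real) \<Rightarrow> bool" where
  "newton_iterates D \<nu> S \<alpha> d u \<gamma> f z y0 w0 Y W \<longleftrightarrow> Y 0 = y0 \<and> W 0 = w0 \<and>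
     (\<forall>k. \<exists>\<delta>y \<delta>w. newton_update D \<nu> S \<alpha> d u \<gamma> f z (Y k) (W k) \<delta>y \<delta>w \<and>
        Y (Suc k) = (\<lambda>x. Y k x + \<delta>y x) \<and> W (Suc k) = (\<lambda>x. W k x + \<delta>w x))"

definition superlinear :: "(nat \<Rightarrow> real) \<Rightarrow> bool" where
  "superlinear e \<longleftrightarrow> e \<longlonglongrightarrow> 0 \<and> (\<lambda>k. e (Suc k)) \<in> o(e)"

end

theory Submission
  imports Defs
begin

text \<open>
  Write \<open>q = - y w\<close> and let \<open>G(y, w)\<close> be the matrix of the Newton system.  At an iterate \<open>(y, w)\<close> with
  error \<open>e = (y - y\<^sub>\<gamma>, w - w\<^sub>\<gamma>)\<close> the new error \<open>e'\<close> solves \<open>G(y, w) e' = R\<close>, where \<open>R\<close> is the linearisation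
  error of the optimality system (\<open>newton_error_equation\<close>).  Hence superlinear convergence follows
  from two facts.

  First, \<open>R = o(\<parallel>e\<parallel>)\<close> in \<open>L\<^sup>2\<close> as \<open>e \<rightarrow> 0\<close> in \<open>H\<^sup>2\<close> (\<open>newton_superlinear_step\<close>).  The nonlinearity \<open>H\<^sub>\<gamma>\<close> is
  a constant plus a sum of finitely many ramps (\<open>H_reg_eq_sum_ramps\<close>), and its linearisation with
  the slope at the perturbed point is exact unless a break point different from the unperturbed
  argument lies within the size of the perturbation (\<open>remainder_eq_0\<close>).  By the Sobolev embedding the
  perturbation is uniformly small, so this happens only on a set whose measure tends to zero, and
  passing from the supremum norm to \<open>L\<^sup>2\<close> turns a remainder \<open>O(\<parallel>e\<parallel>)\<close> into \<open>o(\<parallel>e\<parallel>)\<close>.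

  Second, \<open>G(y, w)\<close> has an inverse from \<open>L\<^sup>2\<close> to \<open>H\<^sup>2\<close> that is bounded uniformly near the solution.  The
  operator \<open>B(y, w)\<close> is \<open>- \<Delta>\<close> plus a potential between \<open>u\<^sub>1\<close> and a constant (\<open>pot_admissible\<close>), so
  elliptic regularity bounds its inverse; it is symmetric by Green's identity.  Under (a), testing
  the two equations with the two unknowns makes the off-diagonal terms cancel and controls \<open>\<delta>y\<close> in
  \<open>L\<^sup>2\<close>, because \<open>1 - \<chi> w\<^sup>2 / \<gamma>\<close> is bounded below by a positive constant; the resulting a priori estimate
  gives solvability by the method of continuity (\<open>energy_solvable\<close>).  Under (b), eliminating the
  unknowns reduces the system at the solution to \<open>(I + K) v = g\<close> on the mixed region
  (\<open>spectral_solvable\<close>).  Since the break points are attained on a null set only, \<open>G\<close> is continuous at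
  the solution as a map into the operators from \<open>H\<^sup>2\<close> to \<open>L\<^sup>2\<close>, so invertibility persists nearby
  (\<open>small_perturbation\<close>).

  Weak derivatives are given by chosen representatives, so that even the linearity of the Laplacian
  depends on their uniqueness almost everywhere, which is derived from a supply of bump functions
  (\<open>fundamental_lemma\<close>).  Green's identity comes from the divergence theorem that defines the outer
  unit normal, applied to the smooth approximations in the definition of the normal derivative.
\<close>

section \<open>Square-integrable functions\<close>

lemma L2_measurable: "f \<in> L2 M \<Longrightarrow> f \<in> borel_measurable M"
  by (simp add: L2_def)

lemma L2_integrable_square: "f \<in> L2 M \<Longrightarrow> integrable M (\<lambda>x. (f x)\<^sup>2)"
  by (simp add: L2_def)

lemma L2_integrable_mult:
  assumes "f \<in> L2 M" "g \<in> L2 M" shows "integrable M (\<lambda>x. f x * g x)"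
proof (rule Bochner_Integration.integrable_bound)
  show "integrable M (\<lambda>x. (f x)\<^sup>2 + (g x)\<^sup>2)"
    using assms by (simp add: L2_def)
  show "(\<lambda>x. f x * g x) \<in> borel_measurable M"
    using assms[THEN L2_measurable] by measurable
  have "\<bar>a * b\<bar> \<le> a\<^sup>2 + b\<^sup>2" for a b :: real
    using sum_squares_bound[of a b] sum_squares_bound[of a "-b"] zero_le_power2[of a] zero_le_power2[of b]
    unfolding abs_le_iff power2_minus by linarith
  then show "AE x in M. norm (f x * g x) \<le> norm ((f x)\<^sup>2 + (g x)\<^sup>2)"
    by (simp add: abs_mult)
qed

lemma L2_add: assumes "f \<in> L2 M" "g \<in> L2 M" shows "(\<lambda>x. f x + g x) \<in> L2 M"
proof -
  have "integrable M (\<lambda>x. (f x)\<^sup>2 + (g x)\<^sup>2 + 2 * (f x * g x))"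
    using assms L2_integrable_mult[OF assms] by (simp add: L2_def)
  then show ?thesis
    using assms by (auto simp: L2_def power2_sum mult.assoc)
qed

lemma L2_scale: "f \<in> L2 M \<Longrightarrow> (\<lambda>x. c * f x) \<in> L2 M" for c :: real
  by (auto simp: L2_def power_mult_distrib)

lemma L2_minus: "f \<in> L2 M \<Longrightarrow> (\<lambda>x. - f x) \<in> L2 M"
  by (simp add: L2_def)

lemma L2_diff: "f \<in> L2 M \<Longrightarrow> g \<in> L2 M \<Longrightarrow> (\<lambda>x. f x - g x) \<in> L2 M"
  using L2_add[of f M "\<lambda>x. - g x"] L2_minus[of g M] by simp

lemma L2_zero: "(\<lambda>x. 0) \<in> L2 M"
  by (simp add: L2_def)

lemma L2_sum: "(\<And>i. i \<in> I \<Longrightarrow> f i \<in> L2 M) \<Longrightarrow> (\<lambda>x. \<Sum>i\<in>I. f i x) \<in> L2 M"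
  by (induction I rule: infinite_finite_induct) (auto intro: L2_zero L2_add)

lemma L2_mult_bounded:
  assumes f: "f \<in> L2 M" and b: "b \<in> borel_measurable M" and C: "AE x in M. \<bar>b x\<bar> \<le> C"
  shows "(\<lambda>x. b x * f x) \<in> L2 M"
proof -
  have "integrable M (\<lambda>x. (b x * f x)\<^sup>2)"
  proof (rule Bochner_Integration.integrable_bound)
    show "integrable M (\<lambda>x. C\<^sup>2 * (f x)\<^sup>2)" using f by (simp add: L2_def)
    show "(\<lambda>x. (b x * f x)\<^sup>2) \<in> borel_measurable M"
      using b L2_measurable[OF f] by measurable
    show "AE x in M. norm ((b x * f x)\<^sup>2) \<le> norm (C\<^sup>2 * (f x)\<^sup>2)"
      using C
    proof eventually_elim
      case (elim x)
      then have "(b x)\<^sup>2 \<le> C\<^sup>2" by (simp add: abs_le_square_iff[symmetric])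
      then show ?case by (auto simp: power_mult_distrib intro: mult_right_mono)
    qed
  qed
  then show ?thesis
    using b L2_measurable[OF f] by (simp add: L2_def)
qed

lemma L2_bounded:
  assumes "finite_measure M" and f: "f \<in> borel_measurable M" and C: "AE x in M. \<bar>f x\<bar> \<le> C"
  shows "f \<in> L2 M"
proof -
  interpret finite_measure M by fact
  have "(\<lambda>x. f x * 1) \<in> L2 M"
    by (rule L2_mult_bounded[OF _ f C]) (simp add: L2_def)
  then show ?thesis by simp
qed

lemma L2_cong_AE:
  assumes "f \<in> L2 M" "g \<in> borel_measurable M" "AE x in M. f x = g x" shows "g \<in> L2 M"
proof -
  have "integrable M (\<lambda>x. (g x)\<^sup>2)"
    by (rule Bochner_Integration.integrable_cong_AE[THEN iffD1, OF _ _ _ L2_integrable_square[OF assms(1)]])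
      (use assms L2_measurable[OF assms(1)] in auto)
  then show ?thesis using assms by (simp add: L2_def)
qed

lemma L2_inner_commute: "L2_inner M f g = L2_inner M g f"
  by (simp add: L2_inner_def mult.commute)

lemma L2_inner_add_left:
  "f \<in> L2 M \<Longrightarrow> g \<in> L2 M \<Longrightarrow> h \<in> L2 M \<Longrightarrow>
    L2_inner M (\<lambda>x. f x + g x) h = L2_inner M f h + L2_inner M g h"
  by (simp add: L2_inner_def distrib_right L2_integrable_mult)

lemma L2_inner_diff_left:
  "f \<in> L2 M \<Longrightarrow> g \<in> L2 M \<Longrightarrow> h \<in> L2 M \<Longrightarrow>
    L2_inner M (\<lambda>x. f x - g x) h = L2_inner M f h - L2_inner M g h"
  by (simp add: L2_inner_def left_diff_distrib L2_integrable_mult)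

lemma L2_inner_scale_left: "L2_inner M (\<lambda>x. c * f x) h = c * L2_inner M f h"
  by (simp add: L2_inner_def mult.assoc)

lemma L2_inner_add_right:
  "f \<in> L2 M \<Longrightarrow> g \<in> L2 M \<Longrightarrow> h \<in> L2 M \<Longrightarrow>
    L2_inner M h (\<lambda>x. f x + g x) = L2_inner M h f + L2_inner M h g"
  by (simp add: L2_inner_add_left L2_inner_commute[of M h])

lemma L2_inner_diff_right:
  "f \<in> L2 M \<Longrightarrow> g \<in> L2 M \<Longrightarrow> h \<in> L2 M \<Longrightarrow>
    L2_inner M h (\<lambda>x. f x - g x) = L2_inner M h f - L2_inner M h g"
  by (simp add: L2_inner_diff_left L2_inner_commute[of M h])

lemma L2_inner_scale_right: "L2_inner M h (\<lambda>x. c * f x) = c * L2_inner M h f"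
  by (simp add: L2_inner_scale_left L2_inner_commute[of M h])

lemma L2_inner_minus_right: "L2_inner M h (\<lambda>x. - f x) = - L2_inner M h f"
  by (simp add: L2_inner_def)

lemma L2_inner_sum_left:
  "(\<And>i. i \<in> I \<Longrightarrow> f i \<in> L2 M) \<Longrightarrow> h \<in> L2 M \<Longrightarrow>
    L2_inner M (\<lambda>x. \<Sum>i\<in>I. f i x) h = (\<Sum>i\<in>I. L2_inner M (f i) h)"
  by (simp add: L2_inner_def sum_distrib_right L2_integrable_mult Bochner_Integration.integral_sum)

lemma L2_inner_cong_AE:
  assumes "f \<in> borel_measurable M" "f' \<in> borel_measurable M" "g \<in> borel_measurable M"
    "AE x in M. f x = f' x"
  shows "L2_inner M f g = L2_inner M f' g"
  unfolding L2_inner_def by (rule integral_cong_AE) (use assms in auto)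

lemma L2_inner_self_nonneg: "L2_inner M f f \<ge> 0"
  by (simp add: L2_inner_def)

lemma L2_norm_nonneg [simp]: "L2_norm M f \<ge> 0"
  by (simp add: L2_norm_def L2_inner_self_nonneg)

lemma L2_norm_power2: "(L2_norm M f)\<^sup>2 = L2_inner M f f"
  by (simp add: L2_norm_def L2_inner_self_nonneg)

lemma L2_norm_power2_integral: "(L2_norm M f)\<^sup>2 = (LINT x|M. (f x)\<^sup>2)"
  unfolding L2_norm_power2 L2_inner_def by (simp add: power2_eq_square)

lemma L2_norm_zero [simp]: "L2_norm M (\<lambda>x. 0) = 0"
  by (simp add: L2_norm_def L2_inner_def)

lemma L2_norm_scale: "L2_norm M (\<lambda>x. c * f x) = \<bar>c\<bar> * L2_norm M f"
  by (simp add: L2_norm_def L2_inner_scale_left L2_inner_scale_right real_sqrt_mult flip: mult.assoc)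

lemma L2_norm_minus: "L2_norm M (\<lambda>x. - f x) = L2_norm M f"
  using L2_norm_scale[of M "-1" f] by simp

lemma L2_norm_diff_commute: "L2_norm M (\<lambda>x. f x - g x) = L2_norm M (\<lambda>x. g x - f x)"
  using L2_norm_minus[of M "\<lambda>x. f x - g x"] by simp

lemma L2_norm_cong_AE:
  assumes "f \<in> borel_measurable M" "g \<in> borel_measurable M" "AE x in M. f x = g x"
  shows "L2_norm M f = L2_norm M g"
  unfolding L2_norm_def L2_inner_def
  by (rule arg_cong[where f = sqrt], rule integral_cong_AE) (use assms in auto)

lemma L2_norm_eq_0_iff:
  assumes "f \<in> L2 M" shows "L2_norm M f = 0 \<longleftrightarrow> (AE x in M. f x = 0)"
proof -
  have "L2_norm M f = 0 \<longleftrightarrow> (LINT x|M. (f x)\<^sup>2) = 0"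
    unfolding L2_norm_power2_integral[symmetric] by simp
  also have "\<dots> \<longleftrightarrow> (AE x in M. (f x)\<^sup>2 = 0)"
    by (rule integral_nonneg_eq_0_iff_AE[OF L2_integrable_square[OF assms]]) simp
  finally show ?thesis by simp
qed

lemma L2_Cauchy_Schwarz:
  assumes f: "f \<in> L2 M" and g: "g \<in> L2 M"
  shows "\<bar>L2_inner M f g\<bar> \<le> L2_norm M f * L2_norm M g"
proof (cases "L2_norm M g = 0")
  case True
  then have "AE x in M. g x = 0" using L2_norm_eq_0_iff[OF g] by simp
  then have "L2_inner M g f = L2_inner M (\<lambda>x. 0) f"
    using f g by (intro L2_inner_cong_AE) (auto dest: L2_measurable)
  moreover have "L2_inner M (\<lambda>x. 0) f = 0" by (simp add: L2_inner_def)
  ultimately show ?thesis by (simp add: L2_inner_commute[of M f g] True)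
next
  case False
  define t where "t = L2_inner M f g / L2_inner M g g"
  have pos: "L2_inner M g g > 0"
    using False L2_inner_self_nonneg[of M g] by (simp add: L2_norm_def)
  have "0 \<le> L2_inner M (\<lambda>x. f x - t * g x) (\<lambda>x. f x - t * g x)"
    by (rule L2_inner_self_nonneg)
  also have "\<dots> = L2_inner M f f - t * L2_inner M f g - t * (L2_inner M f g - t * L2_inner M g g)"
    using f g by (simp add: L2_inner_diff_left L2_inner_diff_right L2_diff L2_scale L2_inner_scale_left
        L2_inner_scale_right L2_inner_commute[of M g f])
  also have "\<dots> = L2_inner M f f - (L2_inner M f g)\<^sup>2 / L2_inner M g g"
    using pos by (simp add: t_def power2_eq_square)
  finally have "(L2_inner M f g)\<^sup>2 \<le> L2_inner M f f * L2_inner M g g"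
    using pos by (simp add: pos_divide_le_eq)
  then have "(L2_inner M f g)\<^sup>2 \<le> (L2_norm M f * L2_norm M g)\<^sup>2"
    by (simp add: power_mult_distrib L2_norm_power2)
  then show ?thesis
    by (simp add: abs_le_square_iff[symmetric] abs_mult)
qed

lemma L2_norm_triangle:
  assumes "f \<in> L2 M" "g \<in> L2 M"
  shows "L2_norm M (\<lambda>x. f x + g x) \<le> L2_norm M f + L2_norm M g"
proof (rule power2_le_imp_le)
  have "(L2_norm M (\<lambda>x. f x + g x))\<^sup>2 = (L2_norm M f)\<^sup>2 + 2 * L2_inner M f g + (L2_norm M g)\<^sup>2"
    using assms by (simp add: L2_norm_power2 L2_inner_add_left L2_inner_add_right L2_add
        L2_inner_commute[of M g f])
  also have "\<dots> \<le> (L2_norm M f + L2_norm M g)\<^sup>2"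
    using L2_Cauchy_Schwarz[OF assms] by (simp add: power2_sum algebra_simps)
  finally show "(L2_norm M (\<lambda>x. f x + g x))\<^sup>2 \<le> (L2_norm M f + L2_norm M g)\<^sup>2" .
qed simp

lemma L2_norm_triangle_diff:
  assumes "f \<in> L2 M" "g \<in> L2 M"
  shows "L2_norm M (\<lambda>x. f x - g x) \<le> L2_norm M f + L2_norm M g"
  using L2_norm_triangle[OF assms(1) L2_minus[OF assms(2)]] by (simp add: L2_norm_minus)

lemma L2_norm_triangle_middle:
  assumes "f \<in> L2 M" "g \<in> L2 M" "h \<in> L2 M"
  shows "L2_norm M (\<lambda>x. f x - h x) \<le> L2_norm M (\<lambda>x. f x - g x) + L2_norm M (\<lambda>x. g x - h x)"
  using L2_norm_triangle[OF L2_diff[OF assms(1,2)] L2_diff[OF assms(2,3)]] by simp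

lemma L2_norm_sum_le:
  assumes "\<And>i. i \<in> I \<Longrightarrow> f i \<in> L2 M"
  shows "L2_norm M (\<lambda>x. \<Sum>i\<in>I. f i x) \<le> (\<Sum>i\<in>I. L2_norm M (f i))"
  using assms
proof (induction I rule: infinite_finite_induct)
  case (insert i I)
  have "L2_norm M (\<lambda>x. f i x + (\<Sum>j\<in>I. f j x)) \<le> L2_norm M (f i) + L2_norm M (\<lambda>x. \<Sum>j\<in>I. f j x)"
    using insert by (intro L2_norm_triangle L2_sum) auto
  then show ?case using insert by auto
qed auto

lemma L2_norm_mono:
  assumes g: "g \<in> L2 M" and f: "f \<in> borel_measurable M" and le: "AE x in M. \<bar>f x\<bar> \<le> \<bar>g x\<bar>"
  shows "f \<in> L2 M" "L2_norm M f \<le> L2_norm M g"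
proof -
  have le2: "AE x in M. (f x)\<^sup>2 \<le> (g x)\<^sup>2"
    using le by eventually_elim (simp add: abs_le_square_iff)
  have "integrable M (\<lambda>x. (f x)\<^sup>2)"
    by (rule Bochner_Integration.integrable_bound[OF L2_integrable_square[OF g]]) (use f le2 in auto)
  then show *: "f \<in> L2 M" using f by (simp add: L2_def)
  have "(LINT x|M. (f x)\<^sup>2) \<le> (LINT x|M. (g x)\<^sup>2)"
    by (rule integral_mono_AE[OF L2_integrable_square[OF *] L2_integrable_square[OF g] le2])
  then show "L2_norm M f \<le> L2_norm M g"
    by (simp add: L2_norm_def L2_inner_def power2_eq_square)
qed

lemma L2_norm_mult_bounded:
  assumes f: "f \<in> L2 M" and b: "b \<in> borel_measurable M" and C: "AE x in M. \<bar>b x\<bar> \<le> C" "C \<ge> 0"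
  shows "L2_norm M (\<lambda>x. b x * f x) \<le> C * L2_norm M f"
proof -
  have "L2_norm M (\<lambda>x. b x * f x) \<le> L2_norm M (\<lambda>x. C * f x)"
  proof (rule L2_norm_mono(2)[OF L2_scale[OF f]])
    show "(\<lambda>x. b x * f x) \<in> borel_measurable M" using b L2_measurable[OF f] by measurable
    show "AE x in M. \<bar>b x * f x\<bar> \<le> \<bar>C * f x\<bar>"
      using C(1) by eventually_elim (use C(2) in \<open>auto simp: abs_mult intro!: mult_right_mono\<close>)
  qed
  then show ?thesis using C by (simp add: L2_norm_scale)
qed

text \<open>Only the first factor varies: limits of \<open>H\<^sup>2\<close> approximations are taken in one function at a
  time, while the other one is kept fixed.\<close>

lemma L2_inner_tendsto_left:
  assumes "\<And>n. f n \<in> L2 M" "f' \<in> L2 M" "g \<in> L2 M" "(\<lambda>n. L2_norm M (\<lambda>x. f n x - f' x)) \<longlonglongrightarrow> 0"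
  shows "(\<lambda>n. L2_inner M (f n) g) \<longlonglongrightarrow> L2_inner M f' g"
proof -
  have "(\<lambda>n. L2_inner M (f n) g - L2_inner M f' g) \<longlonglongrightarrow> 0"
  proof (rule Lim_null_comparison)
    show "\<forall>\<^sub>F n in sequentially. norm (L2_inner M (f n) g - L2_inner M f' g)
        \<le> L2_norm M (\<lambda>x. f n x - f' x) * L2_norm M g"
      using L2_Cauchy_Schwarz[OF L2_diff[OF assms(1,2)] assms(3)] assms
      by (simp add: L2_inner_diff_left)
    show "(\<lambda>n. L2_norm M (\<lambda>x. f n x - f' x) * L2_norm M g) \<longlonglongrightarrow> 0"
      using tendsto_mult_left_zero[OF assms(4)] by simp
  qed
  then show ?thesis by (simp add: LIM_zero_iff)
qed

lemma L2_integrable: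
  assumes "finite_measure M" "f \<in> L2 M" shows "integrable M f"
proof -
  have "(\<lambda>x. 1) \<in> L2 M" by (rule L2_bounded[OF assms(1), of _ 1]) auto
  from L2_integrable_mult[OF assms(2) this] show ?thesis by simp
qed

text \<open>On a finite measure space geometric decay of the increments makes their \<open>L\<^sup>1\<close> norms summable,
  hence the sequence converges almost everywhere, and Fatou's lemma turns this into convergence in
  \<open>L\<^sup>2\<close>.  Contraction iterates have such increments.\<close>

lemma L2_complete_geometric:
  assumes fin: "finite_measure M" and f: "\<And>n. f n \<in> L2 M"
    and step: "\<And>n. L2_norm M (\<lambda>x. f (Suc n) x - f n x) \<le> C * \<theta> ^ n" and \<theta>: "0 \<le> \<theta>" "\<theta> < 1"
  shows "\<exists>g\<in>L2 M. (\<lambda>n. L2_norm M (\<lambda>x. f n x - g x)) \<longlonglongrightarrow> 0"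
proof -
  interpret finite_measure M by fact
  note [measurable] = L2_measurable[OF f]
  have one: "(\<lambda>x. 1) \<in> L2 M" by (rule L2_bounded[OF fin, of _ 1]) auto
  define d where "d n x = \<bar>f (Suc n) x - f n x\<bar>" for n x
  have dL2: "d n \<in> L2 M" for n
    unfolding d_def by (rule L2_norm_mono(1)[OF L2_diff[OF f f, of "Suc n" n]]) auto
  have dn: "L2_norm M (d n) \<le> C * \<theta> ^ n" for n
    unfolding d_def using L2_norm_mono(2)[OF L2_diff[OF f f, of "Suc n" n], of "\<lambda>x. \<bar>f (Suc n) x - f n x\<bar>"]
      step[of n] by auto
  have [measurable]: "d n \<in> borel_measurable M" for n using dL2 by (rule L2_measurable)
  have dint: "integrable M (d n)" for n by (rule L2_integrable[OF fin dL2])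
  have dI: "(LINT x|M. d n x) \<le> C * \<theta> ^ n * L2_norm M (\<lambda>x. 1)" for n
  proof -
    have "(LINT x|M. d n x) \<le> \<bar>L2_inner M (d n) (\<lambda>x. 1)\<bar>" by (simp add: L2_inner_def)
    also have "\<dots> \<le> L2_norm M (d n) * L2_norm M (\<lambda>x. 1)" by (rule L2_Cauchy_Schwarz[OF dL2 one])
    also have "\<dots> \<le> C * \<theta> ^ n * L2_norm M (\<lambda>x. 1)" by (intro mult_right_mono dn) auto
    finally show ?thesis .
  qed
  have geo: "summable (\<lambda>n. C * \<theta> ^ n * B)" for B
    using \<theta> by (intro summable_mult2 summable_mult summable_geometric) auto
  have "(\<integral>\<^sup>+x. (\<Sum>n. ennreal (d n x)) \<partial>M) = (\<Sum>n. \<integral>\<^sup>+x. ennreal (d n x) \<partial>M)"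
    by (rule nn_integral_suminf) measurable
  also have "\<dots> = (\<Sum>n. ennreal (LINT x|M. d n x))"
    by (intro suminf_cong nn_integral_eq_integral dint) (simp add: d_def)
  also have "\<dots> \<le> (\<Sum>n. ennreal (C * \<theta> ^ n * L2_norm M (\<lambda>x. 1)))"
    by (intro suminf_le ennreal_leI dI) auto
  also have "\<dots> < \<infinity>"
  proof -
    have "0 \<le> C * \<theta> ^ n * L2_norm M (\<lambda>x. 1)" for n
      using order.trans[OF L2_norm_nonneg dn, of n] by simp
    then show ?thesis
      using suminf_ennreal_eq[OF _ summable_sums[OF geo]] by simp
  qed
  finally have "AE x in M. (\<Sum>n. ennreal (d n x)) \<noteq> \<infinity>"
    by (intro nn_integral_noteq_infinite) auto
  then have cv: "AE x in M. convergent (\<lambda>n. f n x)"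
  proof eventually_elim
    case (elim x)
    have "summable (\<lambda>n. d n x)"
      using elim by (intro summable_suminf_not_top) (auto simp: d_def)
    then have "summable (\<lambda>n. f (Suc n) x - f n x)"
      by (rule summable_comparison_test'[where N = 0]) (simp add: d_def)
    then have "convergent (\<lambda>n. \<Sum>i<n. f (Suc i) x - f i x)"
      by (simp add: summable_iff_convergent)
    then have "convergent (\<lambda>n. (f n x - f 0 x) + f 0 x)"
      unfolding sum_lessThan_telescope[of "\<lambda>n. f n x"] by (intro convergent_add convergent_const)
    then show ?case by simp
  qed
  define g where "g x = lim (\<lambda>n. f n x)" for x
  have conv: "AE x in M. (\<lambda>n. f n x) \<longlonglongrightarrow> g x"
  proof (rule eventually_mono[OF cv])
    show "(\<lambda>n. f n x) \<longlonglongrightarrow> g x" if "convergent (\<lambda>n. f n x)" for x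
      using that unfolding g_def convergent_LIMSEQ_iff .
  qed
  have [measurable]: "g \<in> borel_measurable M"
    unfolding g_def by (rule borel_measurable_lim_metric) measurable
  define C' where "C' = \<bar>C\<bar> / (1 - \<theta>)"
  have dist: "L2_norm M (\<lambda>x. f m x - f n x) \<le> C' * \<theta> ^ n" if "n \<le> m" for n m
  proof -
    have "(\<lambda>x. f m x - f n x) = (\<lambda>x. \<Sum>i\<in>{n..<m}. f (Suc i) x - f i x)"
      using sum_Suc_diff'[OF that, of "\<lambda>i. f i _"] by auto
    then have "L2_norm M (\<lambda>x. f m x - f n x) \<le> (\<Sum>i\<in>{n..<m}. L2_norm M (\<lambda>x. f (Suc i) x - f i x))"
      using L2_norm_sum_le[of "{n..<m}" "\<lambda>i x. f (Suc i) x - f i x" M] by (simp add: L2_diff f)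
    also have "\<dots> \<le> (\<Sum>i\<in>{n..<m}. \<bar>C\<bar> * \<theta> ^ i)"
      by (intro sum_mono order.trans[OF step] mult_right_mono) (use \<theta> in auto)
    also have "\<dots> = \<bar>C\<bar> * ((\<theta> ^ n - \<theta> ^ m) / (1 - \<theta>))"
    proof -
      have "(1 - \<theta>) * (\<Sum>i\<in>{n..<m}. \<theta> ^ i) = \<theta> ^ n - \<theta> ^ m"
        using that
      proof (induction m rule: dec_induct)
        case (step k)
        have "(1 - \<theta>) * \<theta> ^ k = \<theta> ^ k - \<theta> ^ Suc k" by (simp add: left_diff_distrib)
        with step show ?case by (simp add: distrib_left)
      qed simp
      then have "(\<Sum>i\<in>{n..<m}. \<theta> ^ i) = (\<theta> ^ n - \<theta> ^ m) / (1 - \<theta>)"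
        using \<theta> by (simp add: eq_divide_eq mult.commute)
      then show ?thesis by (simp add: sum_distrib_left[symmetric])
    qed
    also have "\<dots> \<le> \<bar>C\<bar> * (\<theta> ^ n / (1 - \<theta>))"
      using \<theta> by (intro mult_left_mono divide_right_mono) auto
    finally show ?thesis by (simp add: C'_def)
  qed
  have key: "(\<lambda>x. f n x - g x) \<in> L2 M \<and> L2_norm M (\<lambda>x. f n x - g x) \<le> C' * \<theta> ^ n" for n
  proof -
    have C'0: "0 \<le> C' * \<theta> ^ n" using \<theta> by (simp add: C'_def)
    have "(\<integral>\<^sup>+x. ennreal ((f n x - g x)\<^sup>2) \<partial>M) = (\<integral>\<^sup>+x. liminf (\<lambda>m. ennreal ((f m x - f n x)\<^sup>2)) \<partial>M)"
    proof (rule nn_integral_cong_AE)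
      show "AE x in M. ennreal ((f n x - g x)\<^sup>2) = liminf (\<lambda>m. ennreal ((f m x - f n x)\<^sup>2))"
        using conv
      proof eventually_elim
        case (elim x)
        have "(\<lambda>m. ennreal ((f m x - f n x)\<^sup>2)) \<longlonglongrightarrow> ennreal ((g x - f n x)\<^sup>2)"
          using elim by (intro tendsto_intros)
        from lim_imp_Liminf[OF sequentially_bot this] show ?case
          unfolding power2_commute[of "f n x" "g x"] by (rule sym)
      qed
    qed
    also have "\<dots> \<le> liminf (\<lambda>m. \<integral>\<^sup>+x. ennreal ((f m x - f n x)\<^sup>2) \<partial>M)"
      by (rule nn_integral_liminf) measurable
    also have "\<dots> = liminf (\<lambda>m. ennreal ((L2_norm M (\<lambda>x. f m x - f n x))\<^sup>2))"
      by (simp add: L2_norm_power2_integral nn_integral_eq_integral L2_integrable_square[OF L2_diff[OF f f]])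
    also have "\<dots> \<le> ennreal ((C' * \<theta> ^ n)\<^sup>2)"
    proof (rule order.trans[OF Liminf_mono])
      show "\<forall>\<^sub>F m in sequentially. ennreal ((L2_norm M (\<lambda>x. f m x - f n x))\<^sup>2) \<le> ennreal ((C' * \<theta> ^ n)\<^sup>2)"
        using eventually_ge_at_top[of n]
        by eventually_elim (intro ennreal_leI power_mono dist; simp)
    qed (simp add: Liminf_const)
    finally have le: "(\<integral>\<^sup>+x. ennreal ((f n x - g x)\<^sup>2) \<partial>M) \<le> ennreal ((C' * \<theta> ^ n)\<^sup>2)" .
    have int: "integrable M (\<lambda>x. (f n x - g x)\<^sup>2)"
      by (rule integrableI_bounded) (use le_less_trans[OF le] in auto)
    have "(L2_norm M (\<lambda>x. f n x - g x))\<^sup>2 \<le> (C' * \<theta> ^ n)\<^sup>2"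
      using le by (simp add: L2_norm_power2_integral nn_integral_eq_integral[OF int] ennreal_le_iff)
    then show ?thesis
      using int power2_le_imp_le[OF _ C'0] by (simp add: L2_def)
  qed
  have "(\<lambda>x. f 0 x - (f 0 x - g x)) \<in> L2 M"
    by (rule L2_diff[OF f conjunct1[OF key]])
  moreover have "(\<lambda>x. f 0 x - (f 0 x - g x)) = g" by auto
  ultimately have "g \<in> L2 M" by (simp only:)
  moreover have "(\<lambda>n. L2_norm M (\<lambda>x. f n x - g x)) \<longlonglongrightarrow> 0"
  proof (rule Lim_null_comparison)
    show "\<forall>\<^sub>F n in sequentially. norm (L2_norm M (\<lambda>x. f n x - g x)) \<le> C' * \<theta> ^ n"
      using key by simp
    show "(\<lambda>n. C' * \<theta> ^ n) \<longlonglongrightarrow> 0"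
      using \<theta> by (intro tendsto_mult_right_zero LIMSEQ_power_zero) auto
  qed
  ultimately show ?thesis by blast
qed

section \<open>Smooth functions and uniqueness of weak derivatives\<close>

lemma Ck_SucI:
  assumes "\<And>x. (f has_derivative f' x) (at x)" "\<And>v. Ck k (\<lambda>x. f' x v)"
  shows "Ck (Suc k) f"
proof -
  have "frechet_derivative f (at x) = f' x" for x
    using frechet_derivative_at[OF assms(1)] by simp
  then show ?thesis
    using assms by (auto simp: differentiable_def)
qed

lemma Ck_has_derivative: "Ck (Suc k) f \<Longrightarrow> (f has_derivative frechet_derivative f (at x)) (at x)"
  by (simp add: frechet_derivative_works[symmetric])

lemma Ck_Suc_imp_Ck: "Ck (Suc k) f \<Longrightarrow> Ck k f"
proof (induction k arbitrary: f)
  case 0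
  then show ?case
    by (auto intro!: continuous_at_imp_continuous_on differentiable_imp_continuous_within)
next
  case (Suc k)
  then show ?case by (metis Ck.simps(2))
qed

lemma Ck_imp_continuous: "Ck k f \<Longrightarrow> continuous_on UNIV f"
  by (induction k) (auto dest: Ck_Suc_imp_Ck simp del: Ck.simps(2))

lemma Ck_const: "Ck k (\<lambda>x. c)"
proof (induction k arbitrary: c)
  case (Suc k)
  show ?case by (rule Ck_SucI[of _ "\<lambda>x v. 0"]) (use Suc in auto)
qed simp

lemma Ck_add: "Ck k f \<Longrightarrow> Ck k g \<Longrightarrow> Ck k (\<lambda>x. f x + g x)"
proof (induction k arbitrary: f g)
  case (Suc k)
  show ?case
  proof (rule Ck_SucI)
    show "((\<lambda>x. f x + g x) has_derivative
        (\<lambda>v. frechet_derivative f (at x) v + frechet_derivative g (at x) v)) (at x)" for x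
      by (intro has_derivative_add Ck_has_derivative[OF Suc.prems(1)] Ck_has_derivative[OF Suc.prems(2)])
  qed (use Suc in auto)
qed (auto intro: continuous_on_add)

lemma Ck_sum: "(\<And>i. i \<in> I \<Longrightarrow> Ck k (f i)) \<Longrightarrow> Ck k (\<lambda>x. \<Sum>i\<in>I. f i x)"
  by (induction I rule: infinite_finite_induct) (auto intro: Ck_const Ck_add)

lemma Ck_scaleR: "Ck k f \<Longrightarrow> Ck k g \<Longrightarrow> Ck k (\<lambda>x. f x *\<^sub>R g x)"
proof (induction k arbitrary: f g)
  case (Suc k)
  show ?case
  proof (rule Ck_SucI)
    show "((\<lambda>x. f x *\<^sub>R g x) has_derivative
        (\<lambda>v. f x *\<^sub>R frechet_derivative g (at x) v + frechet_derivative f (at x) v *\<^sub>R g x)) (at x)" for x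
      by (intro has_derivative_scaleR Ck_has_derivative[OF Suc.prems(1)] Ck_has_derivative[OF Suc.prems(2)])
    show "Ck k (\<lambda>x. f x *\<^sub>R frechet_derivative g (at x) v + frechet_derivative f (at x) v *\<^sub>R g x)" for v
      using Suc.prems Suc.prems[THEN Ck_Suc_imp_Ck] by (intro Ck_add Suc.IH) auto
  qed
qed (auto intro: continuous_on_scaleR)

lemma Ck_mult: "Ck k f \<Longrightarrow> Ck k g \<Longrightarrow> Ck k (\<lambda>x. f x * g x :: real)"
  using Ck_scaleR[of k f g] by simp

lemma Ck_prod: "(\<And>i. i \<in> I \<Longrightarrow> Ck k (f i)) \<Longrightarrow> Ck k (\<lambda>x. \<Prod>i\<in>I. f i x :: real)"
  by (induction I rule: infinite_finite_induct) (auto intro: Ck_const Ck_mult)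

lemma smooth_const: "smooth (\<lambda>x. c)"
  by (simp add: smooth_def Ck_const)

lemma smooth_add: "smooth f \<Longrightarrow> smooth g \<Longrightarrow> smooth (\<lambda>x. f x + g x)"
  by (simp add: smooth_def Ck_add)

lemma smooth_scale: "smooth f \<Longrightarrow> smooth (\<lambda>x. c * f x :: real)"
  unfolding smooth_def by (intro allI Ck_mult Ck_const) auto

lemma smooth_partial: "smooth f \<Longrightarrow> smooth (partial b f)"
proof -
  assume f: "smooth f"
  have "Ck k (\<lambda>x. frechet_derivative f (at x) b)" for k
    using f[unfolded smooth_def, rule_format, of "Suc k"] by simp
  then show "smooth (partial b f)" by (simp add: smooth_def partial_def[abs_def])
qed

lemma smooth_has_derivative: "smooth f \<Longrightarrow> (f has_derivative frechet_derivative f (at x)) (at x)"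
  unfolding smooth_def by (rule Ck_has_derivative) blast

lemma smooth_continuous: "smooth f \<Longrightarrow> continuous_on S f"
  unfolding smooth_def using Ck_imp_continuous continuous_on_subset by blast

lemma partial_eqI: "(f has_derivative f') (at x) \<Longrightarrow> partial b f x = f' b"
  by (simp add: partial_def frechet_derivative_at[symmetric])

lemma partial_const: "partial b (\<lambda>x. c) = (\<lambda>x. 0)"
  by (rule ext, rule partial_eqI) (rule has_derivative_const)

lemma partial_add:
  assumes "smooth f" "smooth g"
  shows "partial b (\<lambda>x. f x + g x) = (\<lambda>x. partial b f x + partial b g x)"
  by (rule ext, subst partial_eqI[OF has_derivative_add[OF assms[THEN smooth_has_derivative]]])
    (simp add: partial_def)

lemma partial_scale:
  assumes "smooth f"
  shows "partial b (\<lambda>x. c * f x) = (\<lambda>x. c * partial b f x)"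
  by (rule ext, subst partial_eqI[OF has_derivative_mult_right[OF assms[THEN smooth_has_derivative]]])
    (simp add: partial_def)

lemma partial_mult:
  assumes "smooth f" "smooth g"
  shows "partial b (\<lambda>x. f x * g x) x = f x * partial b g x + partial b f x * g x"
  by (subst partial_eqI[OF has_derivative_mult[OF assms[THEN smooth_has_derivative]]])
    (simp add: partial_def)

text \<open>The functions \<open>t \<mapsto> t\<^sup>-\<^sup>j exp (-c/t)\<close>, extended by zero, form a family that is closed under
  differentiation up to linear combinations; this makes the standard bump functions smooth.  They
  supply enough test functions for the uniqueness of weak derivatives.\<close>

definition flat :: "real \<Rightarrow> nat \<Rightarrow> real \<Rightarrow> real" where
  "flat c j t = (if t > 0 then exp (- c / t) / t ^ j else 0)"

lemma flat_tendsto_0: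
  assumes c: "c > 0" shows "(flat c j \<longlongrightarrow> 0) (at 0)"
proof -
  have "((\<lambda>t. (1 / c ^ j) * ((c / t) ^ j / exp (c / t))) \<longlongrightarrow> (1 / c ^ j) * 0) (at_right 0)"
  proof (intro tendsto_mult_left)
    have "filterlim (\<lambda>t. c / t) at_top (at_right 0)"
      using c by real_asymp
    from filterlim_compose[OF tendsto_power_div_exp_0 this]
    show "((\<lambda>t. (c / t) ^ j / exp (c / t)) \<longlongrightarrow> 0) (at_right 0)" .
  qed
  then have "((\<lambda>t. (1 / c ^ j) * ((c / t) ^ j / exp (c / t))) \<longlongrightarrow> 0) (at_right 0)"
    by (simp only: mult_zero_right)
  then have "(flat c j \<longlongrightarrow> 0) (at_right 0)"
  proof (rule Lim_transform_eventually)
    show "\<forall>\<^sub>F t in at_right 0. (1 / c ^ j) * ((c / t) ^ j / exp (c / t)) = flat c j t"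
      using eventually_at_right_less[of "0::real"]
      by eventually_elim (use c in \<open>simp add: flat_def power_divide exp_minus field_simps\<close>)
  qed
  moreover have "(flat c j \<longlongrightarrow> 0) (at_left 0)"
    by (rule tendsto_eventually) (auto simp: flat_def eventually_at_filter)
  ultimately show ?thesis
    by (simp add: filterlim_split_at)
qed

lemma flat_has_derivative:
  assumes c: "c > 0"
  shows "(flat c j has_real_derivative c * flat c (j + 2) t - j * flat c (j + 1) t) (at t)"
proof -
  consider "t > 0" | "t < 0" | "t = 0" by linarith
  then show ?thesis
  proof cases
    case 1
    have "((\<lambda>t. exp (- c / t) / t ^ j) has_real_derivative c * flat c (j + 2) t - j * flat c (j + 1) t) (at t)"
    proof -
      have E: "((\<lambda>t. exp (- c / t)) has_real_derivative exp (- c / t) * (c / t\<^sup>2)) (at t)"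
        using 1 by (auto intro!: derivative_eq_intros simp: field_simps power2_eq_square)
      have "j * t ^ j / t = j * t ^ (j - Suc 0)"
        using 1 by (cases j) auto
      then have P: "((\<lambda>t. t ^ j) has_real_derivative j * t ^ j / t) (at t)"
        by (simp only: DERIV_pow)
      have "((\<lambda>t. exp (- c / t) / t ^ j) has_real_derivative
          (exp (- c / t) * (c / t\<^sup>2) * t ^ j - exp (- c / t) * (j * t ^ j / t)) / (t ^ j * t ^ j)) (at t)"
        using 1 by (intro DERIV_divide E P) auto
      also have "(exp (- c / t) * (c / t\<^sup>2) * t ^ j - exp (- c / t) * (j * t ^ j / t)) / (t ^ j * t ^ j) =
          c * flat c (j + 2) t - j * flat c (j + 1) t"
        using 1 by (simp add: flat_def field_simps power2_eq_square)
      finally show ?thesis .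
    qed
    then show ?thesis
      by (rule has_field_derivative_transform_within_open[of _ _ _ "{0<..}"]) (use 1 in \<open>auto simp: flat_def\<close>)
  next
    case 2
    have "((\<lambda>t. 0) has_real_derivative 0) (at t)" by simp
    then have "(flat c j has_real_derivative 0) (at t)"
      by (rule has_field_derivative_transform_within_open[of _ _ _ "{..<0}"]) (use 2 in \<open>auto simp: flat_def\<close>)
    then show ?thesis using 2 by (simp add: flat_def)
  next
    case 3
    have "((\<lambda>h. (flat c j (0 + h) - flat c j 0) / h) \<longlongrightarrow> 0) (at 0)"
      by (rule Lim_transform_eventually[OF flat_tendsto_0[OF c, of "Suc j"]])
        (auto simp: flat_def eventually_at_filter)
    then show ?thesis using 3 by (simp add: DERIV_def flat_def)
  qed
qed

lemma Ck_flat: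
  assumes c: "c > 0" shows "Ck k (\<lambda>x. flat c j (x \<bullet> a - s))"
proof (induction k arbitrary: j)
  case 0
  have "continuous_on UNIV (flat c j)"
    using flat_has_derivative[OF c] DERIV_isCont continuous_at_imp_continuous_on by blast
  then show ?case
    by (auto intro!: continuous_on_compose2[of UNIV "flat c j"] continuous_intros)
next
  case (Suc k)
  show ?case
  proof (rule Ck_SucI)
    have "((\<lambda>x. x \<bullet> a - s) has_derivative (\<lambda>v. v \<bullet> a)) (at x)" for x
      by (auto intro!: derivative_eq_intros)
    from has_derivative_compose[OF this flat_has_derivative[OF c, unfolded has_field_derivative_def]]
    show "((\<lambda>x. flat c j (x \<bullet> a - s)) has_derivative (\<lambda>v. (v \<bullet> a) *
        (c * flat c (j + 2) (x \<bullet> a - s) + (- real j) * flat c (j + 1) (x \<bullet> a - s)))) (at x)" for x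
      by (simp add: mult.commute)
    show "Ck k (\<lambda>x. (v \<bullet> a) * (c * flat c (j + 2) (x \<bullet> a - s) + (- real j) * flat c (j + 1) (x \<bullet> a - s)))" for v
      by (intro Ck_mult Ck_add Ck_const Suc.IH)
  qed
qed

text \<open>The upper face of the box enters through \<open>x \<bullet> (- b)\<close>, so that both factors are flat functions of
  an affine form and the same smoothness lemma covers them.  The parameter \<open>c\<close> only controls the
  steepness; the limit \<open>c \<rightarrow> 0\<close> is the indicator function of the open box.\<close>

definition bump :: "'a::euclidean_space \<Rightarrow> 'a \<Rightarrow> real \<Rightarrow> 'a \<Rightarrow> real" where
  "bump l u c x = (\<Prod>b\<in>Basis. flat c 0 (x \<bullet> b - l \<bullet> b) * flat c 0 (x \<bullet> (- b) - (- u \<bullet> b)))"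

lemma bump_eq_0: "x \<notin> box l u \<Longrightarrow> bump l u c x = 0"
  by (force simp: bump_def mem_box flat_def not_less)

lemma bump_test_function:
  assumes "c > 0" "cbox l u \<subseteq> D" shows "bump l u c \<in> test_functions D"
proof -
  have "Ck k (bump l u c)" for k
    unfolding bump_def by (intro Ck_prod Ck_mult Ck_flat assms)
  moreover have "bump l u c x = 0" if "x \<notin> cbox l u" for x
    using that bump_eq_0 box_subset_cbox by blast
  ultimately show ?thesis
    using assms compact_cbox[of l u] unfolding test_functions_def smooth_def by blast
qed

lemma bump_bounds: "c > 0 \<Longrightarrow> 0 \<le> bump l u c x \<and> bump l u c x \<le> 1"
  unfolding bump_def
  by (auto intro!: prod_nonneg prod_le_1 mult_nonneg_nonneg mult_le_one simp: flat_def divide_nonpos_pos)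

lemma bump_tendsto_indicator: "(\<lambda>n. bump l u (1 / Suc n) x) \<longlonglongrightarrow> indicator (box l u) x"
proof (cases "x \<in> box l u")
  case True
  have flat1: "(\<lambda>n. flat (1 / Suc n) 0 t) \<longlonglongrightarrow> 1" if "t > 0" for t
    using that unfolding flat_def by simp real_asymp
  have "(\<lambda>n. bump l u (1 / Suc n) x) \<longlonglongrightarrow> (\<Prod>b\<in>(Basis::'a set). 1 * 1)"
    unfolding bump_def by (intro tendsto_prod tendsto_mult flat1) (use True in \<open>auto simp: mem_box\<close>)
  then show ?thesis using True by simp
qed (simp add: bump_eq_0)

text \<open>As \<open>c \<rightarrow> 0\<close> the bump functions increase to the indicator function of a box, so the integrals
  over all boxes compactly contained in \<open>D\<close> vanish; boxes generate the Borel sets and countably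
  many of them cover \<open>D\<close>.\<close>

lemma fundamental_lemma:
  fixes D :: "'a::euclidean_space set"
  assumes D: "open D" and g: "g \<in> borel_measurable (lebesgue_on D)" and int: "integrable (lebesgue_on D) g"
    and zero: "\<And>\<phi>. \<phi> \<in> test_functions D \<Longrightarrow> (LINT x|lebesgue_on D. g x * \<phi> x) = 0"
  shows "AE x in lebesgue_on D. g x = 0"
proof -
  have Dm: "D \<in> sets lebesgue" using D by simp
  then have Dm': "D \<inter> space lebesgue \<in> sets lebesgue" by simp
  define h where "h x = indicator D x * g x" for x
  have hint: "integrable lebesgue h"
    using int integrable_restrict_space[OF Dm', of g] by (simp add: h_def[abs_def])
  \<comment> \<open>boxes generate the Borel sets only, hence the passage to a Borel representative\<close>
  obtain h' where h'm [measurable]: "h' \<in> borel_measurable lborel" and hh': "AE x in lborel. h x = h' x"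
    using completion_ex_borel_measurable_real[of h lborel] borel_measurable_integrable[OF hint] by auto
  have AEc: "AE x in lebesgue. h x = h' x" using hh' by (rule AE_completion)
  have h'm2: "h' \<in> borel_measurable lebesgue"
    using h'm by (rule measurable_completion)
  have "integrable lebesgue h'"
    using hint integrable_cong_AE[OF borel_measurable_integrable[OF hint] h'm2 AEc] by simp
  then have h'int: "integrable lborel h'"
    by (simp add: integrable_completion)
  have box0: "(LINT x|lborel. indicator (box l u) x * h' x) = 0" if "cbox l u \<subseteq> D" for l u
  proof -
    have "(\<lambda>n. LINT x|lebesgue_on D. g x * bump l u (1 / Suc n) x) \<longlonglongrightarrow>
        (LINT x|lebesgue_on D. g x * indicator (box l u) x)"
    proof (rule integral_dominated_convergence)
      show "integrable (lebesgue_on D) (\<lambda>x. norm (g x))" using int by (rule integrable_norm)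
      have bm: "bump l u c \<in> borel_measurable (lebesgue_on D)" if "c > 0" for c
      proof -
        have "continuous_on D (bump l u c)"
          using bump_test_function[OF that \<open>cbox l u \<subseteq> D\<close>] smooth_continuous
          by (auto simp: test_functions_def)
        then show ?thesis by (rule continuous_imp_measurable_on_sets_lebesgue[OF _ Dm])
      qed
      then show "(\<lambda>x. g x * bump l u (1 / Suc n) x) \<in> borel_measurable (lebesgue_on D)" for n
        using g by (intro borel_measurable_times) auto
      have "box l u \<inter> D \<in> sets (lebesgue_on D)" using D by (auto simp: sets_restrict_space)
      then have "(indicator (box l u) :: _ \<Rightarrow> real) \<in> borel_measurable (lebesgue_on D)"
        by (subst borel_measurable_indicator_iff) (simp add: Int_commute)
      then show "(\<lambda>x. g x * indicator (box l u) x) \<in> borel_measurable (lebesgue_on D)"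
        using g by (intro borel_measurable_times)
      show "AE x in lebesgue_on D. (\<lambda>n. g x * bump l u (1 / Suc n) x) \<longlonglongrightarrow> g x * indicator (box l u) x"
        by (intro AE_I2 tendsto_mult_left bump_tendsto_indicator)
      show "AE x in lebesgue_on D. norm (g x * bump l u (1 / Suc n) x) \<le> norm (g x)" for n
        using bump_bounds[of "1 / Suc n" l u]
        by (intro AE_I2) (auto simp: abs_mult intro!: mult_left_le)
    qed
    moreover have "(LINT x|lebesgue_on D. g x * bump l u (1 / Suc n) x) = 0" for n
      by (intro zero bump_test_function that) simp
    ultimately have "(LINT x|lebesgue_on D. g x * indicator (box l u) x) = 0"
      by (simp add: LIMSEQ_const_iff)
    also have "(LINT x|lebesgue_on D. g x * indicator (box l u) x) = (LINT x|lebesgue. indicator (box l u) x * h x)"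
      by (subst integral_restrict_space[OF Dm']) (simp add: h_def mult_ac)
    also have "\<dots> = (LINT x|lebesgue. indicator (box l u) x * h' x)"
    proof (rule integral_cong_AE)
      have [measurable]: "box l u \<in> sets lebesgue" by simp
      note [measurable] = h'm2 borel_measurable_integrable[OF hint]
      show "(\<lambda>x. indicator (box l u) x * h x) \<in> borel_measurable lebesgue" by measurable
      show "(\<lambda>x. indicator (box l u) x * h' x) \<in> borel_measurable lebesgue" by measurable
    qed (use AEc in auto)
    also have "\<dots> = (LINT x|lborel. indicator (box l u) x * h' x)"
      by (rule integral_completion) measurable
    finally show ?thesis .
  qed
  have pointwise: "AE x in lborel. x \<in> box l u \<longrightarrow> h' x = 0" if lu: "cbox l u \<subseteq> D" for l u
  proof -
    define k where "k x = indicator (box l u) x * h' x" for x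
    have kint: "integrable lborel k"
      unfolding k_def using integrable_mult_indicator[of "box l u" lborel h'] h'int by simp
    have "set_lebesgue_integral lborel A k = 0" if A: "A \<in> sets lborel" for A
    proof -
      have "Int_stable (range (\<lambda>(a, b). box a b :: 'a set))"
        by (auto simp: Int_stable_def box_Int_box)
      moreover have "range (\<lambda>(a, b). box a b :: 'a set) \<subseteq> Pow UNIV" by auto
      moreover have "A \<in> sigma_sets UNIV (range (\<lambda>(a, b). box a b))"
        using A unfolding sets_lborel borel_eq_box by simp
      ultimately show ?thesis
      proof (induction rule: sigma_sets_induct_disjoint)
        case (basic A)
        then obtain a b where A: "A = box a b" by auto
        obtain r s where rs: "box a b \<inter> box l u = box r s" by (simp add: box_Int_box)
        have "cbox r s \<subseteq> D \<or> box r s = {}"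
        proof (cases "box r s = {}")
          case False
          have "closure (box r s) \<subseteq> closure (box l u)" unfolding rs[symmetric] by (intro closure_mono) auto
          moreover have "closure (box l u) = cbox l u" using False rs by (intro closure_box) auto
          ultimately show ?thesis using lu closure_box[OF False] by auto
        qed simp
        then have "(LINT x|lborel. indicator (box r s) x * h' x) = 0"
          using box0 by auto
        then show ?case
          unfolding A set_lebesgue_integral_def k_def rs[symmetric]
          by (simp add: indicator_inter_arith mult.assoc)
      next
        case empty
        then show ?case by (simp add: set_lebesgue_integral_def)
      next
        case (compl A)
        then have [measurable]: "A \<in> sets borel" by (simp add: borel_eq_box)
        have "(LINT x|lborel. k x) = 0" using box0[OF lu] by (simp add: k_def[abs_def])
        moreover have "set_lebesgue_integral lborel (UNIV - A) k =
            (LINT x|lborel. k x) - set_lebesgue_integral lborel A k"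
        proof -
          have "set_lebesgue_integral lborel (UNIV - A) k = (LINT x|lborel. k x - indicator A x * k x)"
            unfolding set_lebesgue_integral_def by (intro Bochner_Integration.integral_cong) (auto simp: indicator_def)
          also have "\<dots> = (LINT x|lborel. k x) - (LINT x|lborel. indicator A x * k x)"
            using kint integrable_mult_indicator[of A lborel k] by (intro Bochner_Integration.integral_diff) auto
          finally show ?thesis by (simp add: set_lebesgue_integral_def)
        qed
        ultimately show ?case using compl by simp
      next
        case (union F)
        then have [measurable]: "F i \<in> sets borel" for i by (auto simp: borel_eq_box)
        have "set_integrable lborel (\<Union>i. F i) k"
          unfolding set_integrable_def by (rule integrable_mult_indicator[OF _ kint]) auto
        then have "set_lebesgue_integral lborel (\<Union>i. F i) k = (\<Sum>i. set_lebesgue_integral lborel (F i) k)"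
          using union by (intro lebesgue_integral_countable_add) (auto simp: disjoint_family_on_def)
        then show ?case using union by simp
      qed
    qed
    then have "AE x in lborel. k x = 0"
      by (intro sigma_finite_measure.density_zero[OF _ kint] lborel.sigma_finite_measure_axioms) auto
    then show ?thesis
      by eventually_elim (auto simp: k_def)
  qed
  define \<F> where "\<F> = {box l u | l u. cbox l u \<subseteq> D}"
  obtain \<F>' where \<F>': "\<F>' \<subseteq> \<F>" "countable \<F>'" "\<Union>\<F>' = \<Union>\<F>"
    by (rule Lindelof[of \<F>]) (auto simp: \<F>_def)
  have "\<Union>\<F> = D"
  proof (rule antisym)
    show "\<Union>\<F> \<subseteq> D" using box_subset_cbox unfolding \<F>_def by fastforce
    show "D \<subseteq> \<Union>\<F>"
    proof
      fix x assume "x \<in> D"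
      from open_contains_cbox[OF D this] obtain a b where "cbox a b \<subseteq> D" "x \<in> box a b" by metis
      then show "x \<in> \<Union>\<F>" unfolding \<F>_def by blast
    qed
  qed
  have "AE x in lborel. \<forall>X\<in>\<F>'. x \<in> X \<longrightarrow> h' x = 0"
    unfolding AE_ball_countable[OF \<F>'(2)] using \<F>'(1) pointwise by (auto simp: \<F>_def)
  then have "AE x in lborel. x \<in> D \<longrightarrow> h' x = 0"
    by eventually_elim (use \<F>'(3) \<open>\<Union>\<F> = D\<close> in auto)
  with hh' have "AE x in lborel. x \<in> D \<longrightarrow> g x = 0"
    by eventually_elim (auto simp: h_def)
  then show ?thesis
    unfolding AE_restrict_space_iff[OF Dm'] by (rule AE_completion)
qed

section \<open>Second-order Sobolev spaces and Green's identity\<close>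

locale sobolev_domain =
  fixes D :: "'a::euclidean_space set"
  assumes open_D: "open D" and bounded_D: "bounded D"
begin

abbreviation "M \<equiv> lebesgue_on D"

lemma D_lebesgue [simp]: "D \<in> sets lebesgue"
  using open_D by simp

lemma D_lebesgue_Int [simp]: "D \<inter> space lebesgue \<in> sets lebesgue"
  by simp

lemma finite_measure_M: "finite_measure M"
proof (rule finite_measureI)
  have "D \<in> lmeasurable" using open_D bounded_D by (rule lmeasurable_open[rotated])
  then show "emeasure M (space M) \<noteq> \<infinity>"
    by (simp add: emeasure_restrict_space space_restrict_space fmeasurable_def top.not_eq_extremum)
qed

lemma continuous_L2:
  assumes "continuous_on UNIV (f :: 'a \<Rightarrow> real)" shows "f \<in> L2 M"
proof -
  have "compact (f ` closure D)"
    by (rule compact_continuous_image)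
      (use assms bounded_D continuous_on_subset in \<open>auto simp: compact_closure\<close>)
  then obtain C where C: "\<And>x. x \<in> closure D \<Longrightarrow> \<bar>f x\<bar> \<le> C"
    using compact_imp_bounded bounded_iff by (metis imageI real_norm_def)
  have "f \<in> borel_measurable M"
    by (rule continuous_imp_measurable_on_sets_lebesgue)
      (use assms continuous_on_subset in auto)
  moreover have "AE x in M. \<bar>f x\<bar> \<le> C"
    by (rule AE_I2) (use C closure_subset[of D] in \<open>auto simp: space_restrict_space\<close>)
  ultimately show ?thesis by (rule L2_bounded[OF finite_measure_M])
qed

lemma smooth_L2: "smooth f \<Longrightarrow> f \<in> L2 M"
  by (intro continuous_L2 smooth_continuous)

lemma test_function_smooth: "\<phi> \<in> test_functions D \<Longrightarrow> smooth \<phi>"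
  by (simp add: test_functions_def)

lemma weak_partial_unique:
  assumes "g \<in> L2 M" "g' \<in> L2 M" "has_weak_partial D b f g" "has_weak_partial D b f g'"
  shows "AE x in M. g x = g' x"
proof -
  have "AE x in M. g x - g' x = 0"
  proof (rule fundamental_lemma[OF open_D])
    show "integrable M (\<lambda>x. g x - g' x)"
      by (intro L2_integrable[OF finite_measure_M] L2_diff assms)
    then show "(\<lambda>x. g x - g' x) \<in> borel_measurable M" by auto
    fix \<phi> assume \<phi>: "\<phi> \<in> test_functions D"
    have "L2_inner M g \<phi> = L2_inner M g' \<phi>"
      using assms(3,4) \<phi> unfolding has_weak_partial_def by fastforce
    then show "(LINT x|M. (g x - g' x) * \<phi> x) = 0"
      using L2_inner_diff_left[OF assms(1,2) smooth_L2[OF test_function_smooth[OF \<phi>]]]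
      by (simp add: L2_inner_def)
  qed
  then show ?thesis by simp
qed

lemma wpartial_works:
  assumes "f \<in> H1 D" "b \<in> Basis"
  shows "wpartial D b f \<in> L2 M" "has_weak_partial D b f (wpartial D b f)"
proof -
  have "\<exists>g. g \<in> L2 M \<and> has_weak_partial D b f g" using assms by (auto simp: H1_def)
  from someI_ex[OF this] show "wpartial D b f \<in> L2 M" "has_weak_partial D b f (wpartial D b f)"
    by (auto simp: wpartial_def)
qed

lemma wpartial_unique:
  assumes "g \<in> L2 M" "has_weak_partial D b f g"
  shows "AE x in M. wpartial D b f x = g x"
proof -
  have "\<exists>g. g \<in> L2 M \<and> has_weak_partial D b f g" using assms by auto
  from someI_ex[OF this] show ?thesis
    using assms by (intro weak_partial_unique) (auto simp: wpartial_def)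
qed

lemma H1_L2: "f \<in> H1 D \<Longrightarrow> f \<in> L2 M"
  by (simp add: H1_def)

lemma has_weak_partial_cong:
  assumes "f \<in> borel_measurable M" "f' \<in> borel_measurable M" "AE x in M. f x = f' x"
  shows "has_weak_partial D b f g \<longleftrightarrow> has_weak_partial D b f' g"
proof -
  have "L2_inner M f (partial b \<phi>) = L2_inner M f' (partial b \<phi>)" if "\<phi> \<in> test_functions D" for \<phi>
    by (intro L2_inner_cong_AE assms L2_measurable smooth_L2 smooth_partial test_function_smooth that)
  then show ?thesis by (simp add: has_weak_partial_def)
qed

text \<open>Functions that agree almost everywhere have the same weak derivatives, hence even the same
  chosen representative of a weak derivative.\<close>

lemma wpartial_cong:
  assumes "f \<in> borel_measurable M" "f' \<in> borel_measurable M" "AE x in M. f x = f' x"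
  shows "wpartial D b f = wpartial D b f'"
  unfolding wpartial_def has_weak_partial_cong[OF assms] ..

lemma H1_cong:
  assumes "f \<in> H1 D" "f' \<in> borel_measurable M" "AE x in M. f x = f' x"
  shows "f' \<in> H1 D"
  using assms(1) L2_cong_AE[OF H1_L2[OF assms(1)] assms(2,3)]
    has_weak_partial_cong[OF L2_measurable[OF H1_L2[OF assms(1)]] assms(2,3)]
  by (auto simp: H1_def)

lemma has_weak_partial_lincomb:
  assumes "f \<in> L2 M" "g \<in> L2 M" "f' \<in> L2 M" "g' \<in> L2 M"
    "has_weak_partial D b f f'" "has_weak_partial D b g g'"
  shows "has_weak_partial D b (\<lambda>x. f x + c * g x) (\<lambda>x. f' x + c * g' x)"
  unfolding has_weak_partial_def
proof
  fix \<phi> assume \<phi>: "\<phi> \<in> test_functions D"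
  have "\<phi> \<in> L2 M" "partial b \<phi> \<in> L2 M"
    by (intro smooth_L2 smooth_partial test_function_smooth \<phi>)+
  then show "L2_inner M (\<lambda>x. f x + c * g x) (partial b \<phi>) = - L2_inner M (\<lambda>x. f' x + c * g' x) \<phi>"
    using assms \<phi> by (simp add: L2_inner_add_left L2_scale L2_inner_scale_left has_weak_partial_def)
qed

lemma H1_lincomb:
  assumes "f \<in> H1 D" "g \<in> H1 D"
  shows "(\<lambda>x. f x + c * g x) \<in> H1 D"
    and "b \<in> Basis \<Longrightarrow> AE x in M. wpartial D b (\<lambda>x. f x + c * g x) x = wpartial D b f x + c * wpartial D b g x"
proof -
  have *: "(\<lambda>x. wpartial D b f x + c * wpartial D b g x) \<in> L2 M"
    "has_weak_partial D b (\<lambda>x. f x + c * g x) (\<lambda>x. wpartial D b f x + c * wpartial D b g x)"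
    if "b \<in> Basis" for b
    using wpartial_works[OF assms(1) that] wpartial_works[OF assms(2) that] assms[THEN H1_L2]
    by (auto intro!: L2_add L2_scale has_weak_partial_lincomb)
  show "(\<lambda>x. f x + c * g x) \<in> H1 D"
    using * L2_add[OF H1_L2[OF assms(1)] L2_scale[OF H1_L2[OF assms(2)]]] by (auto simp: H1_def)
  show "b \<in> Basis \<Longrightarrow> AE x in M. wpartial D b (\<lambda>x. f x + c * g x) x = wpartial D b f x + c * wpartial D b g x"
    using * by (rule wpartial_unique)
qed

lemma H2_H1: "f \<in> H2 D \<Longrightarrow> f \<in> H1 D" "f \<in> H2 D \<Longrightarrow> b \<in> Basis \<Longrightarrow> wpartial D b f \<in> H1 D"
  by (simp_all add: H2_def)

lemma H2_L2: "f \<in> H2 D \<Longrightarrow> f \<in> L2 M"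
  and H2_wpartial_L2: "f \<in> H2 D \<Longrightarrow> b \<in> Basis \<Longrightarrow> wpartial D b f \<in> L2 M"
  and H2_wpartial2_L2: "f \<in> H2 D \<Longrightarrow> b \<in> Basis \<Longrightarrow> c \<in> Basis \<Longrightarrow> wpartial D c (wpartial D b f) \<in> L2 M"
  by (auto simp: H2_H1 H1_L2 wpartial_works)

lemma H2_measurable: "f \<in> H2 D \<Longrightarrow> f \<in> borel_measurable M"
  by (intro L2_measurable H2_L2)

lemma H2_cong:
  assumes "f \<in> H2 D" "f' \<in> borel_measurable M" "AE x in M. f x = f' x"
  shows "f' \<in> H2 D" "wpartial D b f' = wpartial D b f" "H2_norm D f' = H2_norm D f" "laplacian D f' = laplacian D f"
proof -
  have *: "wpartial D b f' = wpartial D b f" for b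
    using wpartial_cong[OF H2_measurable[OF assms(1)] assms(2,3)] by simp
  show "wpartial D b f' = wpartial D b f" by (rule *)
  show "f' \<in> H2 D"
    using assms(1) H1_cong[OF H2_H1(1)[OF assms(1)] assms(2,3)] by (simp add: H2_def *)
  show "H2_norm D f' = H2_norm D f"
    using L2_norm_cong_AE[OF H2_measurable[OF assms(1)] assms(2,3)] by (simp add: H2_norm_def *)
  show "laplacian D f' = laplacian D f" by (simp add: laplacian_def[abs_def] *)
qed

text \<open>The chosen weak derivatives are linear only up to null sets.  For the second derivatives this
  is harmless, since changing the first derivative on a null set does not change its derivatives at
  all.\<close>

lemma H2_lincomb:
  assumes "f \<in> H2 D" "g \<in> H2 D"
  shows "(\<lambda>x. f x + c * g x) \<in> H2 D"
    and "b \<in> Basis \<Longrightarrow> AE x in M. wpartial D b (\<lambda>x. f x + c * g x) x = wpartial D b f x + c * wpartial D b g x"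
    and "b \<in> Basis \<Longrightarrow> b' \<in> Basis \<Longrightarrow> AE x in M. wpartial D b' (wpartial D b (\<lambda>x. f x + c * g x)) x
        = wpartial D b' (wpartial D b f) x + c * wpartial D b' (wpartial D b g) x"
proof -
  note h = assms[THEN H2_H1(1)]
  show 1: "AE x in M. wpartial D b (\<lambda>x. f x + c * g x) x = wpartial D b f x + c * wpartial D b g x"
    if "b \<in> Basis" for b
    by (rule H1_lincomb(2)[OF h that])
  have 2: "(\<lambda>x. wpartial D b f x + c * wpartial D b g x) \<in> H1 D" if "b \<in> Basis" for b
    using assms that by (intro H1_lincomb H2_H1)
  have L: "wpartial D b (\<lambda>x. f x + c * g x) \<in> L2 M" if "b \<in> Basis" for b
    using H1_lincomb(1)[OF h] that by (rule wpartial_works)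
  have "wpartial D b (\<lambda>x. f x + c * g x) \<in> H1 D" if b: "b \<in> Basis" for b
    by (rule H1_cong[OF 2[OF b] L2_measurable[OF L[OF b]]]) (use 1[OF b] in auto)
  then show "(\<lambda>x. f x + c * g x) \<in> H2 D"
    using H1_lincomb(1)[OF h] by (simp add: H2_def)
  assume b: "b \<in> Basis" and b': "b' \<in> Basis"
  have "wpartial D b' (wpartial D b (\<lambda>x. f x + c * g x)) = wpartial D b' (\<lambda>x. wpartial D b f x + c * wpartial D b g x)"
    by (intro wpartial_cong L2_measurable L 1 b H1_L2 2)
  with H1_lincomb(2)[OF H2_H1(2)[OF assms(1) b] H2_H1(2)[OF assms(2) b] b']
  show "AE x in M. wpartial D b' (wpartial D b (\<lambda>x. f x + c * g x)) x
      = wpartial D b' (wpartial D b f) x + c * wpartial D b' (wpartial D b g) x"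
    by simp
qed

lemma laplacian_lincomb:
  assumes "f \<in> H2 D" "g \<in> H2 D"
  shows "AE x in M. laplacian D (\<lambda>x. f x + c * g x) x = laplacian D f x + c * laplacian D g x"
proof -
  have "AE x in M. \<forall>b\<in>Basis. wpartial D b (wpartial D b (\<lambda>x. f x + c * g x)) x
        = wpartial D b (wpartial D b f) x + c * wpartial D b (wpartial D b g) x"
    by (intro AE_finite_allI finite_Basis H2_lincomb assms)
  then show ?thesis
    by eventually_elim (simp add: laplacian_def sum.distrib sum_distrib_left)
qed

lemma laplacian_L2: "f \<in> H2 D \<Longrightarrow> laplacian D f \<in> L2 M"
  unfolding laplacian_def[abs_def] by (intro L2_sum H2_wpartial2_L2)

lemma H2_norm_L2_set:
  "H2_norm D f = sqrt ((L2_norm M f)\<^sup>2 + (L2_set (\<lambda>b. L2_norm M (wpartial D b f)) Basis)\<^sup>2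
     + (L2_set (\<lambda>(b, c). L2_norm M (wpartial D c (wpartial D b f))) (Basis \<times> Basis))\<^sup>2)"
  by (simp add: H2_norm_def L2_set_def sum_nonneg sum.cartesian_product case_prod_unfold)

lemma H2_norm_nonneg [simp]: "H2_norm D f \<ge> 0"
  unfolding H2_norm_L2_set by simp

lemma H2_norm_ge:
  shows "L2_norm M f \<le> H2_norm D f"
    and "b \<in> Basis \<Longrightarrow> L2_norm M (wpartial D b f) \<le> H2_norm D f"
    and "b \<in> Basis \<Longrightarrow> c \<in> Basis \<Longrightarrow> L2_norm M (wpartial D c (wpartial D b f)) \<le> H2_norm D f"
proof -
  have triple: "a \<le> sqrt (a\<^sup>2 + b\<^sup>2 + c\<^sup>2)" "b \<le> sqrt (a\<^sup>2 + b\<^sup>2 + c\<^sup>2)" "c \<le> sqrt (a\<^sup>2 + b\<^sup>2 + c\<^sup>2)" for a b c :: real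
    by (rule real_le_rsqrt, simp)+
  show "L2_norm M f \<le> H2_norm D f"
    unfolding H2_norm_L2_set by (rule triple)
  show "L2_norm M (wpartial D b f) \<le> H2_norm D f" if "b \<in> Basis"
    unfolding H2_norm_L2_set
    by (rule order.trans[OF member_le_L2_set triple(2)]) (use that in auto)
  show "L2_norm M (wpartial D c (wpartial D b f)) \<le> H2_norm D f" if "b \<in> Basis" "c \<in> Basis"
    unfolding H2_norm_L2_set
    using member_le_L2_set[of "Basis \<times> Basis" "(b, c)" "\<lambda>(b, c). L2_norm M (wpartial D c (wpartial D b f))"] that
    by (intro order.trans[OF _ triple(3)]) auto
qed

text \<open>The norm is the Euclidean norm of the triple formed by the Euclidean norms of the derivatives of
  order zero, one and two, so the triangle inequality is inherited from Euclidean space.\<close>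

lemma H2_norm_lincomb_le:
  assumes f: "f \<in> H2 D" and g: "g \<in> H2 D"
  shows "H2_norm D (\<lambda>x. f x + c * g x) \<le> H2_norm D f + \<bar>c\<bar> * H2_norm D g"
proof -
  let ?h = "\<lambda>x. f x + c * g x"
  have tri: "L2_norm M k \<le> L2_norm M p + \<bar>c\<bar> * L2_norm M q"
    if "AE x in M. k x = p x + c * q x" "k \<in> L2 M" "p \<in> L2 M" "q \<in> L2 M" for k p q
  proof -
    have "L2_norm M k = L2_norm M (\<lambda>x. p x + c * q x)"
      using that by (intro L2_norm_cong_AE L2_measurable L2_add L2_scale) auto
    also have "\<dots> \<le> L2_norm M p + L2_norm M (\<lambda>x. c * q x)"
      using that by (intro L2_norm_triangle L2_scale)
    finally show ?thesis by (simp add: L2_norm_scale)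
  qed
  note h = H2_lincomb[OF f g, where c = c]
  have a: "L2_norm M ?h \<le> L2_norm M f + \<bar>c\<bar> * L2_norm M g"
    using f g h by (intro tri) (auto intro: H2_L2)
  have set_tri: "L2_set k I \<le> L2_set p I + \<bar>c\<bar> * L2_set q I"
    if "\<And>i. i \<in> I \<Longrightarrow> 0 \<le> k i \<and> k i \<le> p i + \<bar>c\<bar> * q i" for k p q and I :: "'i set"
  proof -
    have "L2_set k I \<le> L2_set (\<lambda>i. p i + \<bar>c\<bar> * q i) I"
      using that by (intro L2_set_mono) auto
    also have "\<dots> \<le> L2_set p I + L2_set (\<lambda>i. \<bar>c\<bar> * q i) I" by (rule L2_set_triangle_ineq)
    finally show ?thesis by (simp add: L2_set_right_distrib)
  qed
  define n1 where "n1 f = L2_set (\<lambda>b. L2_norm M (wpartial D b f)) Basis" for f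
  define n2 where "n2 f = L2_set (\<lambda>(b, c). L2_norm M (wpartial D c (wpartial D b f))) (Basis \<times> Basis)" for f
  have b: "n1 ?h \<le> n1 f + \<bar>c\<bar> * n1 g"
    unfolding n1_def
    by (intro set_tri conjI tri) (auto intro: h f g H2_wpartial_L2)
  have c: "n2 ?h \<le> n2 f + \<bar>c\<bar> * n2 g"
    unfolding n2_def
    by (intro set_tri) (auto intro!: tri intro: h f g H2_wpartial2_L2)
  have N: "H2_norm D k = norm (L2_norm M k, n1 k, n2 k)" for k
    by (simp add: H2_norm_L2_set n1_def n2_def norm_prod_def add.assoc)
  have "H2_norm D ?h \<le> norm ((L2_norm M f, n1 f, n2 f) + \<bar>c\<bar> *\<^sub>R (L2_norm M g, n1 g, n2 g))"
    unfolding N norm_prod_def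
    using a b c by (auto intro!: real_sqrt_le_mono add_mono power_mono simp: n1_def n2_def L2_set_nonneg)
  also have "\<dots> \<le> norm (L2_norm M f, n1 f, n2 f) + norm (\<bar>c\<bar> *\<^sub>R (L2_norm M g, n1 g, n2 g))"
    by (rule norm_triangle_ineq)
  also have "\<dots> = H2_norm D f + \<bar>c\<bar> * H2_norm D g"
    unfolding N norm_scaleR by simp
  finally show ?thesis .
qed

lemma H2_norm_eq_0_AE:
  assumes "f \<in> H2 D" "H2_norm D f = 0" shows "AE x in M. f x = 0"
proof -
  have "L2_norm M f = 0" using H2_norm_ge(1)[of f] L2_norm_nonneg[of M f] assms(2) by linarith
  then show ?thesis using L2_norm_eq_0_iff[OF H2_L2[OF assms(1)]] by simp
qed

end

text \<open>The divergence theorem, which characterises the outer unit normal, is what connects weak and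
  classical derivatives (test functions vanish on the boundary) and yields Green's identity.\<close>

locale normal_domain = sobolev_domain D for D :: "'a::euclidean_space set" +
  fixes \<nu> :: "'a \<Rightarrow> 'a" and S :: "'a measure"
  assumes normal: "outer_unit_normal D \<nu> S"
begin

lemma sets_S: "sets S = sets borel"
  and finite_measure_S: "finite_measure S"
  and \<nu>_measurable: "\<nu> \<in> borel_measurable S"
  and AE_norm_\<nu>: "AE x in S. norm (\<nu> x) = 1"
  and divergence_theorem: "Ck 1 F \<Longrightarrow> (LINT x|M. divergence F x) = (LINT x|S. F x \<bullet> \<nu> x)"
  using normal by (auto simp: outer_unit_normal_def)

lemma AE_frontier: "AE x in S. x \<in> frontier D"
proof (rule AE_I')
  show "- frontier D \<in> null_sets S"
    using normal by (auto simp: outer_unit_normal_def null_sets_def intro: frontier_closed)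
qed auto

lemma measurable_S_continuous: "continuous_on UNIV f \<Longrightarrow> f \<in> borel_measurable S"
  for f :: "'a \<Rightarrow> 'b::topological_space"
  using borel_measurable_continuous_onI[of f] measurable_cong_sets[OF sets_S refl] by blast

lemma continuous_bounded_frontier:
  fixes f :: "'a \<Rightarrow> 'b::real_normed_vector"
  assumes "continuous_on UNIV f"
  obtains C where "C \<ge> 0" "AE x in S. norm (f x) \<le> C"
proof -
  have "compact (f ` frontier D)"
    by (rule compact_continuous_image)
      (use assms bounded_D continuous_on_subset in \<open>auto simp: compact_frontier_bounded\<close>)
  then obtain C where C: "\<And>x. x \<in> frontier D \<Longrightarrow> norm (f x) \<le> C"
    using compact_imp_bounded bounded_iff by (metis imageI)
  show thesis
  proof (rule that[of "max C 0"])
    show "AE x in S. norm (f x) \<le> max C 0"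
      using AE_frontier by eventually_elim (use C in \<open>fastforce\<close>)
  qed simp
qed

lemma divergence_scaleR_Basis:
  assumes f: "smooth f" and b: "b \<in> Basis"
  shows "divergence (\<lambda>x. f x *\<^sub>R b) x = partial b f x"
proof -
  have "((\<lambda>x. f x *\<^sub>R b) has_derivative (\<lambda>v. frechet_derivative f (at x) v *\<^sub>R b)) (at x)"
    using smooth_has_derivative[OF f] by (rule has_derivative_scaleR_left)
  then have *: "frechet_derivative (\<lambda>x. f x *\<^sub>R b) (at x) = (\<lambda>v. frechet_derivative f (at x) v *\<^sub>R b)"
    by (rule frechet_derivative_at[symmetric])
  have "divergence (\<lambda>x. f x *\<^sub>R b) x = (\<Sum>b'\<in>Basis. if b' = b then frechet_derivative f (at x) b' else 0)"
    unfolding divergence_def * by (intro sum.cong) (auto simp: inner_Basis b)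
  then show ?thesis by (simp add: b partial_def)
qed

lemma integration_by_parts:
  assumes f: "smooth f" and \<phi>: "\<phi> \<in> test_functions D" and b: "b \<in> Basis"
  shows "L2_inner M f (partial b \<phi>) = - L2_inner M (partial b f) \<phi>"
proof -
  note s\<phi> = test_function_smooth[OF \<phi>]
  have fp: "smooth (\<lambda>x. f x * \<phi> x)"
    using f s\<phi> unfolding smooth_def by (intro allI Ck_mult) auto
  have "Ck 1 (\<lambda>x. (f x * \<phi> x) *\<^sub>R b)"
    using fp unfolding smooth_def by (intro Ck_scaleR Ck_const) auto
  then have "(LINT x|M. partial b (\<lambda>x. f x * \<phi> x) x) = (LINT x|S. ((f x * \<phi> x) *\<^sub>R b) \<bullet> \<nu> x)"
    unfolding divergence_scaleR_Basis[OF fp b, symmetric] by (rule divergence_theorem)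
  also have "\<dots> = (LINT x|S. 0)"
  proof (rule Bochner_Integration.integral_cong_AE)
    obtain C where "C \<subseteq> D" "\<And>x. x \<notin> C \<Longrightarrow> \<phi> x = 0" using \<phi> by (auto simp: test_functions_def)
    then have \<phi>0: "x \<in> frontier D \<Longrightarrow> \<phi> x = 0" for x
      using open_D by (auto simp: frontier_def interior_open)
    show "AE x in S. ((f x * \<phi> x) *\<^sub>R b) \<bullet> \<nu> x = 0"
      using AE_frontier by eventually_elim (simp add: \<phi>0)
    have [measurable]: "(\<lambda>x. f x * \<phi> x) \<in> borel_measurable S"
      by (rule measurable_S_continuous[OF smooth_continuous[OF fp]])
    note [measurable] = \<nu>_measurable
    show "(\<lambda>x. ((f x * \<phi> x) *\<^sub>R b) \<bullet> \<nu> x) \<in> borel_measurable S" by measurable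
  qed simp
  finally have "(LINT x|M. f x * partial b \<phi> x + partial b f x * \<phi> x) = 0"
    by (simp add: partial_mult[OF f s\<phi>])
  moreover have "integrable M (\<lambda>x. f x * partial b \<phi> x)" "integrable M (\<lambda>x. partial b f x * \<phi> x)"
    by (intro L2_integrable_mult smooth_L2 smooth_partial f s\<phi>)+
  ultimately show ?thesis by (simp add: L2_inner_def)
qed

lemma smooth_weak_partial: "smooth f \<Longrightarrow> b \<in> Basis \<Longrightarrow> has_weak_partial D b f (partial b f)"
  by (simp add: has_weak_partial_def integration_by_parts)

lemma smooth_H1: "smooth f \<Longrightarrow> f \<in> H1 D"
  by (auto simp: H1_def intro!: smooth_L2 bexI[of _ "partial _ f"] smooth_weak_partial smooth_partial)

lemma smooth_wpartial: "smooth f \<Longrightarrow> b \<in> Basis \<Longrightarrow> AE x in M. wpartial D b f x = partial b f x"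
  by (intro wpartial_unique smooth_weak_partial smooth_L2 smooth_partial)

lemma smooth_wpartial_eq:
  "smooth f \<Longrightarrow> b \<in> Basis \<Longrightarrow> wpartial D c (wpartial D b f) = wpartial D c (partial b f)"
  by (intro wpartial_cong smooth_wpartial L2_measurable wpartial_works smooth_H1 smooth_L2 smooth_partial)

lemma smooth_wpartial2:
  "smooth f \<Longrightarrow> b \<in> Basis \<Longrightarrow> c \<in> Basis \<Longrightarrow> AE x in M. wpartial D c (wpartial D b f) x = partial c (partial b f) x"
  unfolding smooth_wpartial_eq by (intro smooth_wpartial smooth_partial)

lemma smooth_H2: assumes "smooth f" shows "f \<in> H2 D"
proof -
  have "wpartial D b f \<in> H1 D" if "b \<in> Basis" for b
    by (rule H1_cong[OF smooth_H1[OF smooth_partial[OF assms, of b]] L2_measurable])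
      (use assms that smooth_wpartial[OF assms that] in \<open>auto intro: wpartial_works smooth_H1\<close>)
  then show ?thesis using smooth_H1[OF assms] by (simp add: H2_def)
qed

lemma smooth_approx_L2:
  assumes \<phi>: "smooth \<phi>" and v: "v \<in> H2 D"
  defines "e \<equiv> H2_norm D (\<lambda>x. \<phi> x - v x)"
  shows "L2_norm M (\<lambda>x. \<phi> x - v x) \<le> e"
    and "b \<in> Basis \<Longrightarrow> L2_norm M (\<lambda>x. partial b \<phi> x - wpartial D b v x) \<le> e"
    and "b \<in> Basis \<Longrightarrow> c \<in> Basis \<Longrightarrow> L2_norm M (\<lambda>x. partial c (partial b \<phi>) x - wpartial D c (wpartial D b v) x) \<le> e"
proof -
  let ?d = "\<lambda>x. \<phi> x - v x"
  note h = smooth_H2[OF \<phi>]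
  note lin = H2_lincomb[OF h v, where c = "-1", simplified]
  show "L2_norm M ?d \<le> e" unfolding e_def by (rule H2_norm_ge)
  show "L2_norm M (\<lambda>x. partial b \<phi> x - wpartial D b v x) \<le> e" if b: "b \<in> Basis"
  proof -
    have "AE x in M. wpartial D b ?d x = partial b \<phi> x - wpartial D b v x"
      using lin(2)[OF b] smooth_wpartial[OF \<phi> b] by eventually_elim simp
    then have "L2_norm M (\<lambda>x. partial b \<phi> x - wpartial D b v x) = L2_norm M (wpartial D b ?d)"
      by (intro L2_norm_cong_AE L2_measurable L2_diff smooth_L2 smooth_partial \<phi> H2_wpartial_L2 v b lin(1)) auto
    then show ?thesis using H2_norm_ge(2)[OF b, of ?d] by (simp add: e_def)
  qed
  show "L2_norm M (\<lambda>x. partial c (partial b \<phi>) x - wpartial D c (wpartial D b v) x) \<le> e"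
    if b: "b \<in> Basis" and c: "c \<in> Basis"
  proof -
    have "AE x in M. wpartial D c (wpartial D b ?d) x = partial c (partial b \<phi>) x - wpartial D c (wpartial D b v) x"
      using lin(3)[OF b c] smooth_wpartial2[OF \<phi> b c] by eventually_elim simp
    then have "L2_norm M (\<lambda>x. partial c (partial b \<phi>) x - wpartial D c (wpartial D b v) x)
        = L2_norm M (wpartial D c (wpartial D b ?d))"
      by (intro L2_norm_cong_AE L2_measurable L2_diff smooth_L2 smooth_partial \<phi> H2_wpartial2_L2 v b c lin(1)) auto
    then show ?thesis using H2_norm_ge(3)[OF b c, of ?d] by (simp add: e_def)
  qed
qed

lemma grad_smooth: "smooth f \<Longrightarrow> smooth (grad f)"
proof -
  assume f: "smooth f"
  have "Ck k (\<lambda>x. \<Sum>b\<in>Basis. partial b f x *\<^sub>R b)" for k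
    using smooth_partial[OF f] unfolding smooth_def by (intro Ck_sum Ck_scaleR Ck_const) auto
  then show ?thesis by (simp add: smooth_def grad_def[abs_def])
qed

lemma normal_derivative_L2: assumes "smooth f" shows "(\<lambda>x. \<nu> x \<bullet> grad f x) \<in> L2 S"
proof -
  note cont = smooth_continuous[OF grad_smooth[OF assms], of UNIV]
  obtain C where C: "C \<ge> 0" "AE x in S. norm (grad f x) \<le> C"
    by (rule continuous_bounded_frontier[OF cont])
  note [measurable] = measurable_S_continuous[OF cont] \<nu>_measurable
  have "AE x in S. \<bar>\<nu> x \<bullet> grad f x\<bar> \<le> C"
    using C(2) AE_norm_\<nu>
  proof eventually_elim
    case (elim x)
    have "\<bar>\<nu> x \<bullet> grad f x\<bar> \<le> norm (\<nu> x) * norm (grad f x)" by (rule Cauchy_Schwarz_ineq2)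
    then show ?case using elim by simp
  qed
  then show ?thesis by (intro L2_bounded[OF finite_measure_S]) measurable
qed

lemma Green_smooth:
  assumes \<phi>: "smooth \<phi>" and \<psi>: "smooth \<psi>"
  shows "(\<Sum>b\<in>Basis. L2_inner M (partial b \<phi>) (partial b \<psi>)) + (\<Sum>b\<in>Basis. L2_inner M \<phi> (partial b (partial b \<psi>)))
    = L2_inner S \<phi> (\<lambda>x. \<nu> x \<bullet> grad \<psi> x)"
proof -
  have fd: "smooth (\<lambda>x. \<phi> x * partial b \<psi> x)" for b
    using \<phi> smooth_partial[OF \<psi>] unfolding smooth_def by (intro allI Ck_mult) auto
  have F: "(\<lambda>x. \<phi> x *\<^sub>R grad \<psi> x) = (\<lambda>x. \<Sum>b\<in>Basis. (\<phi> x * partial b \<psi> x) *\<^sub>R b)"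
    by (simp add: grad_def scaleR_sum_right)
  have "Ck 1 (\<lambda>x. \<phi> x *\<^sub>R grad \<psi> x)"
    using \<phi> grad_smooth[OF \<psi>] unfolding smooth_def by (intro Ck_scaleR) auto
  from divergence_theorem[OF this]
  have "(LINT x|M. divergence (\<lambda>x. \<phi> x *\<^sub>R grad \<psi> x) x) = L2_inner S \<phi> (\<lambda>x. \<nu> x \<bullet> grad \<psi> x)"
    by (simp add: L2_inner_def inner_commute)
  also have "divergence (\<lambda>x. \<phi> x *\<^sub>R grad \<psi> x)
      = (\<lambda>x. \<Sum>b\<in>Basis. partial b \<phi> x * partial b \<psi> x + \<phi> x * partial b (partial b \<psi>) x)"
  proof
    fix x
    have "((\<lambda>x. \<Sum>b\<in>Basis. (\<phi> x * partial b \<psi> x) *\<^sub>R b) has_derivative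
        (\<lambda>v. \<Sum>b\<in>Basis. frechet_derivative (\<lambda>x. \<phi> x * partial b \<psi> x) (at x) v *\<^sub>R b)) (at x)"
      by (intro has_derivative_sum has_derivative_scaleR_left smooth_has_derivative fd)
    then have "divergence (\<lambda>x. \<phi> x *\<^sub>R grad \<psi> x) x =
        (\<Sum>b'\<in>Basis. (\<Sum>b\<in>Basis. frechet_derivative (\<lambda>x. \<phi> x * partial b \<psi> x) (at x) b' *\<^sub>R b) \<bullet> b')"
      unfolding F divergence_def by (simp add: frechet_derivative_at[symmetric])
    also have "\<dots> = (\<Sum>b'\<in>Basis. partial b' (\<lambda>x. \<phi> x * partial b' \<psi> x) x)"
      by (intro sum.cong refl) (simp add: inner_sum_left_Basis partial_def)
    also have "\<dots> = (\<Sum>b\<in>Basis. partial b \<phi> x * partial b \<psi> x + \<phi> x * partial b (partial b \<psi>) x)"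
      by (simp add: partial_mult[OF \<phi> smooth_partial[OF \<psi>]] add.commute)
    finally show "divergence (\<lambda>x. \<phi> x *\<^sub>R grad \<psi> x) x
      = (\<Sum>b\<in>Basis. partial b \<phi> x * partial b \<psi> x + \<phi> x * partial b (partial b \<psi>) x)" .
  qed
  also have "(LINT x|M. (\<Sum>b\<in>Basis. partial b \<phi> x * partial b \<psi> x + \<phi> x * partial b (partial b \<psi>) x))
      = (\<Sum>b\<in>Basis. L2_inner M (partial b \<phi>) (partial b \<psi>) + L2_inner M \<phi> (partial b (partial b \<psi>)))"
  proof -
    have "integrable M (\<lambda>x. partial b \<phi> x * partial b \<psi> x)" "integrable M (\<lambda>x. \<phi> x * partial b (partial b \<psi>) x)" for b
      by (intro L2_integrable_mult smooth_L2 smooth_partial \<phi> \<psi>)+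
    then show ?thesis by (simp add: L2_inner_def Bochner_Integration.integral_sum)
  qed
  finally show ?thesis by (simp add: sum.distrib)
qed

definition Dirichlet :: "('a \<Rightarrow> real) \<Rightarrow> ('a \<Rightarrow> real) \<Rightarrow> real" where
  "Dirichlet v w = (\<Sum>b\<in>Basis. L2_inner M (wpartial D b v) (wpartial D b w))"

abbreviation "HN \<equiv> H2_Neumann D \<nu> S"

lemma HN_H2: "v \<in> HN \<Longrightarrow> v \<in> H2 D"
  by (simp add: H2_Neumann_def)

lemma HN_approx:
  assumes "v \<in> HN"
  obtains \<phi> where "\<And>n::nat. smooth (\<phi> n)" "(\<lambda>n. H2_norm D (\<lambda>x. \<phi> n x - v x)) \<longlonglongrightarrow> 0"
    "(\<lambda>n. L2_norm S (\<lambda>x. \<nu> x \<bullet> grad (\<phi> n) x)) \<longlonglongrightarrow> 0"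
proof -
  have "has_normal_derivative D \<nu> S v (\<lambda>x. 0)" using assms by (simp add: H2_Neumann_def)
  then obtain \<phi> where "\<forall>n::nat. smooth (\<phi> n)" "(\<lambda>n. H2_norm D (\<lambda>x. \<phi> n x - v x)) \<longlonglongrightarrow> 0"
    "(\<lambda>n. L2_norm S (\<lambda>x. \<nu> x \<bullet> grad (\<phi> n) x - 0)) \<longlonglongrightarrow> 0"
    unfolding has_normal_derivative_def by blast
  then show thesis using that[of \<phi>] by simp
qed

text \<open>Approximating \<open>w\<close> by smooth functions with vanishing normal derivatives in the limit kills the
  boundary term, because the smooth function \<open>\<phi>\<close> is bounded on the boundary.\<close>

lemma Green_smooth_left:
  assumes \<phi>: "smooth \<phi>" and w: "w \<in> HN"
  shows "(\<Sum>b\<in>Basis. L2_inner M (partial b \<phi>) (wpartial D b w)) + (\<Sum>b\<in>Basis. L2_inner M \<phi> (wpartial D b (wpartial D b w))) = 0"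
proof -
  obtain \<psi> where \<psi>: "\<And>n::nat. smooth (\<psi> n)" "(\<lambda>n. H2_norm D (\<lambda>x. \<psi> n x - w x)) \<longlonglongrightarrow> 0"
    "(\<lambda>n. L2_norm S (\<lambda>x. \<nu> x \<bullet> grad (\<psi> n) x)) \<longlonglongrightarrow> 0"
    by (rule HN_approx[OF w]) blast
  note w2 = HN_H2[OF w]
  have conv: "(\<lambda>n. L2_norm M (\<lambda>x. partial b (\<psi> n) x - wpartial D b w x)) \<longlonglongrightarrow> 0"
    "(\<lambda>n. L2_norm M (\<lambda>x. partial b (partial b (\<psi> n)) x - wpartial D b (wpartial D b w) x)) \<longlonglongrightarrow> 0"
    if "b \<in> Basis" for b
    using smooth_approx_L2[OF \<psi>(1) w2] that
    by (auto intro!: tendsto_sandwich[OF _ _ tendsto_const \<psi>(2)])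
  have "(\<lambda>n. (\<Sum>b\<in>Basis. L2_inner M (partial b (\<psi> n)) (partial b \<phi>)) + (\<Sum>b\<in>Basis. L2_inner M (partial b (partial b (\<psi> n))) \<phi>))
    \<longlonglongrightarrow> (\<Sum>b\<in>Basis. L2_inner M (wpartial D b w) (partial b \<phi>)) + (\<Sum>b\<in>Basis. L2_inner M (wpartial D b (wpartial D b w)) \<phi>)"
    by (intro tendsto_add tendsto_sum L2_inner_tendsto_left conv smooth_L2 smooth_partial \<phi> \<psi>
        H2_wpartial_L2 H2_wpartial2_L2 w2)
  moreover have "(\<lambda>n. (\<Sum>b\<in>Basis. L2_inner M (partial b (\<psi> n)) (partial b \<phi>)) + (\<Sum>b\<in>Basis. L2_inner M (partial b (partial b (\<psi> n))) \<phi>)) \<longlonglongrightarrow> 0"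
  proof -
    note cont = smooth_continuous[OF \<phi>, of UNIV]
    obtain C where "C \<ge> 0" "AE x in S. norm (\<phi> x) \<le> C" by (rule continuous_bounded_frontier[OF cont])
    then have \<phi>S: "\<phi> \<in> L2 S"
      by (intro L2_bounded[OF finite_measure_S measurable_S_continuous[OF cont]]) auto
    have "(\<lambda>n. L2_inner S (\<lambda>x. \<nu> x \<bullet> grad (\<psi> n) x) \<phi>) \<longlonglongrightarrow> L2_inner S (\<lambda>x. 0) \<phi>"
      by (intro L2_inner_tendsto_left normal_derivative_L2 \<psi> L2_zero \<phi>S) (use \<psi>(3) in simp)
    then have "(\<lambda>n. L2_inner S \<phi> (\<lambda>x. \<nu> x \<bullet> grad (\<psi> n) x)) \<longlonglongrightarrow> 0"
      by (simp add: L2_inner_commute[of S \<phi>]) (simp add: L2_inner_def)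
    then show ?thesis
      unfolding Green_smooth[OF \<phi> \<psi>(1), symmetric] by (simp add: L2_inner_commute)
  qed
  ultimately show ?thesis
    by (simp add: LIMSEQ_unique L2_inner_commute[of M "partial _ \<phi>"] L2_inner_commute[of M \<phi>])
qed

text \<open>The second approximation, of \<open>v\<close>, has no boundary term left to control.\<close>

lemma Green:
  assumes v: "v \<in> HN" and w: "w \<in> HN"
  shows "L2_inner M v (laplacian D w) = - Dirichlet v w"
proof -
  obtain \<phi> where \<phi>: "\<And>n::nat. smooth (\<phi> n)" "(\<lambda>n. H2_norm D (\<lambda>x. \<phi> n x - v x)) \<longlonglongrightarrow> 0"
    by (rule HN_approx[OF v]) blast
  note v2 = HN_H2[OF v] and w2 = HN_H2[OF w]
  have conv: "(\<lambda>n. L2_norm M (\<lambda>x. partial b (\<phi> n) x - wpartial D b v x)) \<longlonglongrightarrow> 0"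
    "(\<lambda>n. L2_norm M (\<lambda>x. \<phi> n x - v x)) \<longlonglongrightarrow> 0"
    if "b \<in> Basis" for b
    using smooth_approx_L2[OF \<phi>(1) v2] that
    by (auto intro!: tendsto_sandwich[OF _ _ tendsto_const \<phi>(2)])
  have "(\<lambda>n. (\<Sum>b\<in>Basis. L2_inner M (partial b (\<phi> n)) (wpartial D b w)) + (\<Sum>b\<in>Basis. L2_inner M (\<phi> n) (wpartial D b (wpartial D b w))))
    \<longlonglongrightarrow> (\<Sum>b\<in>Basis. L2_inner M (wpartial D b v) (wpartial D b w)) + (\<Sum>b\<in>Basis. L2_inner M v (wpartial D b (wpartial D b w)))"
    by (intro tendsto_add tendsto_sum L2_inner_tendsto_left conv smooth_L2 smooth_partial \<phi>
        H2_L2 H2_wpartial_L2 H2_wpartial2_L2 v2 w2)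
  then have "(\<Sum>b\<in>Basis. L2_inner M (wpartial D b v) (wpartial D b w)) + (\<Sum>b\<in>Basis. L2_inner M v (wpartial D b (wpartial D b w))) = 0"
    by (simp add: Green_smooth_left[OF \<phi>(1) w] LIMSEQ_const_iff)
  moreover have "L2_inner M v (laplacian D w) = (\<Sum>b\<in>Basis. L2_inner M v (wpartial D b (wpartial D b w)))"
    unfolding laplacian_def[abs_def] L2_inner_commute[of M v]
    by (intro L2_inner_sum_left H2_wpartial2_L2 w2 H2_L2 v2)
  ultimately show ?thesis by (simp add: Dirichlet_def)
qed

lemma laplacian_symmetric:
  assumes "v \<in> HN" "w \<in> HN"
  shows "L2_inner M v (laplacian D w) = L2_inner M w (laplacian D v)"
  using Green[OF assms] Green[OF assms(2,1)] by (simp add: Dirichlet_def L2_inner_commute)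

lemma grad_lincomb:
  assumes "smooth f" "smooth g"
  shows "grad (\<lambda>x. f x + c * g x) = (\<lambda>x. grad f x + c *\<^sub>R grad g x)"
  unfolding grad_def partial_add[OF assms(1) smooth_scale[OF assms(2)]] partial_scale[OF assms(2)]
  by (simp add: scaleR_left_distrib sum.distrib scaleR_sum_right)

lemma HN_lincomb:
  assumes v: "v \<in> HN" and w: "w \<in> HN"
  shows "(\<lambda>x. v x + c * w x) \<in> HN"
proof -
  obtain \<phi> where \<phi>: "\<And>n::nat. smooth (\<phi> n)" "(\<lambda>n. H2_norm D (\<lambda>x. \<phi> n x - v x)) \<longlonglongrightarrow> 0"
    "(\<lambda>n. L2_norm S (\<lambda>x. \<nu> x \<bullet> grad (\<phi> n) x)) \<longlonglongrightarrow> 0"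
    by (rule HN_approx[OF v]) blast
  obtain \<psi> where \<psi>: "\<And>n::nat. smooth (\<psi> n)" "(\<lambda>n. H2_norm D (\<lambda>x. \<psi> n x - w x)) \<longlonglongrightarrow> 0"
    "(\<lambda>n. L2_norm S (\<lambda>x. \<nu> x \<bullet> grad (\<psi> n) x)) \<longlonglongrightarrow> 0"
    by (rule HN_approx[OF w]) blast
  have diff: "(\<lambda>x. f x - g x) \<in> H2 D" if "f \<in> H2 D" "g \<in> H2 D" for f g
    using H2_lincomb(1)[OF that, where c = "-1"] by simp
  define \<theta> where "\<theta> n x = \<phi> n x + c * \<psi> n x" for n x
  have s: "smooth (\<theta> n)" for n
    unfolding \<theta>_def by (intro smooth_add smooth_scale \<phi> \<psi>)
  have "(\<lambda>n. H2_norm D (\<lambda>x. \<theta> n x - (v x + c * w x))) \<longlonglongrightarrow> 0"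
  proof (rule Lim_null_comparison)
    have "(\<lambda>n. H2_norm D (\<lambda>x. \<phi> n x - v x) + \<bar>c\<bar> * H2_norm D (\<lambda>x. \<psi> n x - w x)) \<longlonglongrightarrow> 0 + \<bar>c\<bar> * 0"
      by (intro tendsto_intros \<phi> \<psi>)
    then show "(\<lambda>n. H2_norm D (\<lambda>x. \<phi> n x - v x) + \<bar>c\<bar> * H2_norm D (\<lambda>x. \<psi> n x - w x)) \<longlonglongrightarrow> 0" by simp
    have "H2_norm D (\<lambda>x. \<theta> n x - (v x + c * w x)) \<le> H2_norm D (\<lambda>x. \<phi> n x - v x) + \<bar>c\<bar> * H2_norm D (\<lambda>x. \<psi> n x - w x)" for n
    proof -
      have "(\<lambda>x. \<theta> n x - (v x + c * w x)) = (\<lambda>x. (\<phi> n x - v x) + c * (\<psi> n x - w x))"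
        by (auto simp: \<theta>_def algebra_simps)
      then show ?thesis
        using H2_norm_lincomb_le[OF diff[OF smooth_H2[OF \<phi>(1)] HN_H2[OF v]] diff[OF smooth_H2[OF \<psi>(1)] HN_H2[OF w]]]
        by simp
    qed
    then show "\<forall>\<^sub>F n in sequentially. norm (H2_norm D (\<lambda>x. \<theta> n x - (v x + c * w x)))
        \<le> H2_norm D (\<lambda>x. \<phi> n x - v x) + \<bar>c\<bar> * H2_norm D (\<lambda>x. \<psi> n x - w x)" by simp
  qed
  moreover have "(\<lambda>n. L2_norm S (\<lambda>x. \<nu> x \<bullet> grad (\<theta> n) x - 0)) \<longlonglongrightarrow> 0"
  proof (rule Lim_null_comparison)
    have "(\<lambda>n. L2_norm S (\<lambda>x. \<nu> x \<bullet> grad (\<phi> n) x) + \<bar>c\<bar> * L2_norm S (\<lambda>x. \<nu> x \<bullet> grad (\<psi> n) x)) \<longlonglongrightarrow> 0 + \<bar>c\<bar> * 0"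
      by (intro tendsto_intros \<phi> \<psi>)
    then show "(\<lambda>n. L2_norm S (\<lambda>x. \<nu> x \<bullet> grad (\<phi> n) x) + \<bar>c\<bar> * L2_norm S (\<lambda>x. \<nu> x \<bullet> grad (\<psi> n) x)) \<longlonglongrightarrow> 0" by simp
    have "L2_norm S (\<lambda>x. \<nu> x \<bullet> grad (\<theta> n) x) \<le> L2_norm S (\<lambda>x. \<nu> x \<bullet> grad (\<phi> n) x) + \<bar>c\<bar> * L2_norm S (\<lambda>x. \<nu> x \<bullet> grad (\<psi> n) x)" for n
      unfolding \<theta>_def grad_lincomb[OF \<phi>(1) \<psi>(1)] inner_add_right inner_scaleR_right
      using L2_norm_triangle[OF normal_derivative_L2[OF \<phi>(1)] L2_scale[OF normal_derivative_L2[OF \<psi>(1)]]]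
      by (simp add: L2_norm_scale)
    then show "\<forall>\<^sub>F n in sequentially. norm (L2_norm S (\<lambda>x. \<nu> x \<bullet> grad (\<theta> n) x - 0))
        \<le> L2_norm S (\<lambda>x. \<nu> x \<bullet> grad (\<phi> n) x) + \<bar>c\<bar> * L2_norm S (\<lambda>x. \<nu> x \<bullet> grad (\<psi> n) x)" by simp
  qed
  ultimately have "has_normal_derivative D \<nu> S (\<lambda>x. v x + c * w x) (\<lambda>x. 0)"
    unfolding has_normal_derivative_def using s L2_zero by blast
  then show ?thesis
    using H2_lincomb(1)[OF HN_H2[OF v] HN_H2[OF w]] by (simp add: H2_Neumann_def)
qed

text \<open>Constants lie in the kernel of the Neumann Laplacian, which excludes the potential zero from
  elliptic regularity and so makes its lower bound for the potentials positive.\<close>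

lemma HN_const: "(\<lambda>x. k) \<in> HN"
proof -
  have "H2_norm D (\<lambda>x. k - k) = 0"
  proof -
    have "H2_norm D (\<lambda>x. 0 + 0 * (0::real)) \<le> H2_norm D (\<lambda>x. 0) + \<bar>0\<bar> * H2_norm D (\<lambda>x. 0)"
      by (intro H2_norm_lincomb_le smooth_H2 smooth_const)
    have z: "AE x in M. wpartial D b (\<lambda>x. 0) x = 0" if "b \<in> Basis" for b
      using smooth_wpartial[OF smooth_const that, of 0] by (simp add: partial_const)
    have z2: "AE x in M. wpartial D c (wpartial D b (\<lambda>x. 0)) x = 0" if "b \<in> Basis" "c \<in> Basis" for b c
      using smooth_wpartial2[OF smooth_const that, of 0] by (simp add: partial_const)
    show ?thesis
      using L2_norm_eq_0_iff[OF H2_wpartial_L2[OF smooth_H2[OF smooth_const[of 0]]]]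
        L2_norm_eq_0_iff[OF H2_wpartial2_L2[OF smooth_H2[OF smooth_const[of 0]]]] z z2
      by (simp add: H2_norm_def)
  qed
  moreover have "grad (\<lambda>x::'a. k) = (\<lambda>x. 0)" by (simp add: grad_def[abs_def] partial_const)
  ultimately have "(\<lambda>n::nat. H2_norm D (\<lambda>x. k - k)) \<longlonglongrightarrow> 0"
    "(\<lambda>n::nat. L2_norm S (\<lambda>x. \<nu> x \<bullet> grad (\<lambda>x. k) x - 0)) \<longlonglongrightarrow> 0"
    by simp_all
  then have "has_normal_derivative D \<nu> S (\<lambda>x. k) (\<lambda>x. 0)"
    unfolding has_normal_derivative_def using smooth_const[of k] L2_zero
    by (intro conjI exI[of _ "\<lambda>n x. k"]) auto
  then show ?thesis
    using smooth_H2[OF smooth_const[of k]] by (simp add: H2_Neumann_def)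
qed

lemma laplacian_const: "AE x in M. laplacian D (\<lambda>x. k) x = 0"
proof -
  have "AE x in M. \<forall>b\<in>Basis. wpartial D b (wpartial D b (\<lambda>x. k)) x = 0"
    using smooth_wpartial2[OF smooth_const, of _ _ k]
    by (intro AE_finite_allI finite_Basis) (simp add: partial_const)
  then show ?thesis by eventually_elim (simp add: laplacian_def)
qed

end

section \<open>The regularised multi-bang nonlinearity\<close>

definition ramp :: "real \<Rightarrow> real \<Rightarrow> real \<Rightarrow> real" where
  "ramp a b q = max 0 (min (q - a) (b - a))"

lemma ramp_lipschitz: "a \<le> b \<Longrightarrow> \<bar>ramp a b q - ramp a b q'\<bar> \<le> \<bar>q - q'\<bar>"
  by (auto simp: ramp_def max_def min_def abs_if)

lemma ramp_bounds: "a \<le> b \<Longrightarrow> 0 \<le> ramp a b q \<and> ramp a b q \<le> b - a"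
  by (auto simp: ramp_def max_def min_def)

lemma ramp_remainder_le:
  assumes "a \<le> b"
  shows "\<bar>ramp a b q - ramp a b q' - indicator {a..b} q * (q - q')\<bar> \<le> 2 * \<bar>q - q'\<bar>"
proof -
  have "\<bar>indicator {a..b} q * (q - q')\<bar> \<le> \<bar>q - q'\<bar>" by (simp add: indicator_def)
  then show ?thesis
    using ramp_lipschitz[OF assms, of q q']
    by (intro order.trans[OF abs_triangle_ineq4]) simp
qed

lemma ramp_remainder_eq_0:
  assumes "a < b" "q' = a \<or> \<bar>q - q'\<bar> < \<bar>q' - a\<bar>" "q' = b \<or> \<bar>q - q'\<bar> < \<bar>q' - b\<bar>"
  shows "ramp a b q - ramp a b q' - indicator {a..b} q * (q - q') = 0"
  using assms by (auto simp: ramp_def max_def min_def indicator_def abs_if split: if_splits)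

lemma indicator_interval_eq:
  fixes a b q q' :: real
  assumes "\<bar>q - q'\<bar> < \<bar>q' - a\<bar>" "\<bar>q - q'\<bar> < \<bar>q' - b\<bar>"
  shows "(indicator {a..b} q :: real) = indicator {a..b} q'"
  using assms by (auto simp: indicator_def abs_if split: if_splits)

locale multibang =
  fixes \<alpha> \<gamma> :: real and d :: nat and u :: "nat \<Rightarrow> real"
  assumes \<alpha>_pos: "\<alpha> > 0" and \<gamma>_pos: "\<gamma> > 0" and d_ge_2: "d \<ge> 2" and u_mono: "strict_mono_on {1..d} u"
begin

abbreviation "H \<equiv> H_reg \<alpha> d u \<gamma>"
abbreviation "mix \<equiv> chi \<alpha> d u \<gamma>"

definition lo :: "nat \<Rightarrow> real" where "lo i = \<alpha>/2 * (u i + u (i + 1)) + \<gamma> * u i"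
definition hi :: "nat \<Rightarrow> real" where "hi i = \<alpha>/2 * (u i + u (i + 1)) + \<gamma> * u (i + 1)"
definition breakpoints :: "real set" where "breakpoints = lo ` {1..<d} \<union> hi ` {1..<d}"

lemma finite_breakpoints: "finite breakpoints"
  by (simp add: breakpoints_def)

lemma u_less: "1 \<le> i \<Longrightarrow> i < j \<Longrightarrow> j \<le> d \<Longrightarrow> u i < u j"
  using u_mono by (auto intro: strict_mono_onD)

lemma u_le: "1 \<le> i \<Longrightarrow> i \<le> j \<Longrightarrow> j \<le> d \<Longrightarrow> u i \<le> u j"
  using u_less[of i j] by (cases "i = j") auto

lemma lo_less_hi: "1 \<le> i \<Longrightarrow> i < d \<Longrightarrow> lo i < hi i"
  using u_less[of i "i + 1"] \<gamma>_pos by (simp add: lo_def hi_def)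

lemma hi_less_lo:
  assumes "1 \<le> i" "i < j" "j < d" shows "hi i < lo j"
proof -
  have "\<alpha>/2 * (u i + u (i + 1)) < \<alpha>/2 * (u j + u (j + 1))"
    using u_less[of i j] u_less[of "i + 1" "j + 1"] assms \<alpha>_pos by simp
  moreover have "\<gamma> * u (i + 1) \<le> \<gamma> * u j"
    using u_le[of "i + 1" j] assms \<gamma>_pos by simp
  ultimately show ?thesis by (simp add: lo_def hi_def)
qed

lemma threshold_eq:
  "\<alpha>/2 * ((1 + 2*\<gamma>/\<alpha>) * u i + u (i + 1)) = lo i"
  "\<alpha>/2 * (u i + (1 + 2*\<gamma>/\<alpha>) * u (i + 1)) = hi i"
  using \<alpha>_pos by (simp_all add: lo_def hi_def field_simps)

lemma Q_mixed_eq: "Q_mixed \<alpha> u \<gamma> i = {lo i..hi i}"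
  unfolding Q_mixed_def threshold_eq by auto

lemma Q_pure_eq: "Q_pure \<alpha> n u \<gamma> i = {q. (1 < i \<longrightarrow> hi (i - 1) < q) \<and> (i < n \<longrightarrow> q < lo i)}"
proof -
  have "\<alpha>/2 * (u (i - 1) + (1 + 2*\<gamma>/\<alpha>) * u i) = hi (i - 1)" if "1 < i"
    using threshold_eq(2)[of "i - 1"] that by simp
  then show ?thesis unfolding Q_pure_def threshold_eq by auto
qed

text \<open>Adding one more control value to the list adds one ramp to the nonlinearity; this turns the
  definition by cases into a sum of Lipschitz functions of a single interval each.\<close>

lemma H_reg_eq_sum_ramps:
  assumes "1 \<le> n" "n \<le> d"
  shows "H_reg \<alpha> n u \<gamma> q = u 1 + (\<Sum>i\<in>{1..<n}. ramp (lo i) (hi i) q / \<gamma>)"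
  using assms
proof (induction n rule: nat_induct_at_least)
  case base
  then show ?case by (simp add: H_reg_def Q_pure_eq)
next
  case (Suc n)
  then have n: "1 \<le> n" "n < d" by auto
  have order: "lo n < hi n" using lo_less_hi n by simp
  have prev: "1 < n \<Longrightarrow> hi (n - 1) < lo n" using hi_less_lo[of "n - 1" n] n by simp
  define pure where "pure m i = (if q \<in> Q_pure \<alpha> m u \<gamma> i then u i else 0)" for m i
  define mixed where "mixed i = (if q \<in> Q_mixed \<alpha> u \<gamma> i then 1/\<gamma> * (q - \<alpha>/2 * (u i + u (i + 1))) else 0)" for i
  have H: "H_reg \<alpha> m u \<gamma> q = (\<Sum>i\<in>{1..m}. pure m i) + (\<Sum>i\<in>{1..<m}. mixed i)" for m
    by (simp add: H_reg_def pure_def mixed_def)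
  have s1: "{1..n} = insert n {1..<n}" "{1..Suc n} = insert (Suc n) (insert n {1..<n})" "{1..<Suc n} = insert n {1..<n}"
    using n by auto
  have same: "(\<Sum>i\<in>{1..<n}. pure (Suc n) i) = (\<Sum>i\<in>{1..<n}. pure n i)"
    by (intro sum.cong) (auto simp: pure_def Q_pure_eq)
  have "H_reg \<alpha> (Suc n) u \<gamma> q - H_reg \<alpha> n u \<gamma> q
      = pure (Suc n) (Suc n) + pure (Suc n) n - pure n n + mixed n"
    unfolding H s1 by (simp add: same[simplified])
  also have "\<dots> = ramp (lo n) (hi n) q / \<gamma>"
  proof -
    consider "q < lo n" | "lo n \<le> q" "q \<le> hi n" | "hi n < q" by linarith
    then show ?thesis
    proof cases
      case 1
      then show ?thesis using order n
        by (auto simp: pure_def mixed_def Q_pure_eq Q_mixed_eq ramp_def)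
    next
      case 2
      then have "pure (Suc n) (Suc n) = 0" "pure (Suc n) n = 0" "pure n n = u n"
        using order prev n by (auto simp: pure_def Q_pure_eq)
      moreover have "mixed n = (q - lo n) / \<gamma> + u n"
        using 2 \<gamma>_pos by (simp add: mixed_def Q_mixed_eq lo_def field_simps)
      ultimately show ?thesis using 2 by (simp add: ramp_def)
    next
      case 3
      then have "pure (Suc n) (Suc n) = u (Suc n)" "pure (Suc n) n = 0" "pure n n = u n" "mixed n = 0"
        using order prev n by (auto simp: pure_def mixed_def Q_pure_eq Q_mixed_eq)
      moreover have "ramp (lo n) (hi n) q = \<gamma> * (u (Suc n) - u n)"
        using 3 order by (simp add: ramp_def lo_def hi_def algebra_simps)
      ultimately show ?thesis using \<gamma>_pos by simp
    qed
  qed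
  finally show ?case using Suc by simp
qed

lemma H_eq: "H q = u 1 + (\<Sum>i\<in>{1..<d}. ramp (lo i) (hi i) q / \<gamma>)"
  using H_reg_eq_sum_ramps[of d] d_ge_2 by simp

lemma chi_eq: "mix q = (\<Sum>i\<in>{1..<d}. indicator {lo i..hi i} q)"
proof -
  have "disjoint_family_on (\<lambda>i. {lo i..hi i}) {1..<d}"
    unfolding disjoint_family_on_def
  proof (intro ballI impI)
    fix i j assume ij: "i \<in> {1..<d}" "j \<in> {1..<d}" "i \<noteq> j"
    then consider "hi i < lo j" | "hi j < lo i"
      using hi_less_lo[of i j] hi_less_lo[of j i] by (metis atLeastLessThan_iff linorder_neqE_nat)
    then show "{lo i..hi i} \<inter> {lo j..hi j} = {}" by cases auto
  qed
  then show ?thesis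
    unfolding chi_def Q_mixed_eq by (subst indicator_UN_disjoint) auto
qed

lemma chi_bounds: "0 \<le> mix q" "mix q \<le> 1"
  by (auto simp: chi_def indicator_def)

lemma H_lower: "u 1 \<le> H q"
proof -
  have "0 \<le> (\<Sum>i\<in>{1..<d}. ramp (lo i) (hi i) q / \<gamma>)"
    by (rule sum_nonneg) (use \<gamma>_pos in \<open>auto simp: ramp_def\<close>)
  then show ?thesis by (simp add: H_eq)
qed

lemma H_upper: "H q \<le> u d"
proof -
  have "(\<Sum>i\<in>{1..<d}. ramp (lo i) (hi i) q / \<gamma>) \<le> (\<Sum>i\<in>{1..<d}. u (Suc i) - u i)"
  proof (rule sum_mono)
    fix i assume i: "i \<in> {1..<d}"
    then have "ramp (lo i) (hi i) q \<le> hi i - lo i"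
      using ramp_bounds[of "lo i" "hi i" q] lo_less_hi[of i] by simp
    also have "\<dots> = \<gamma> * (u (Suc i) - u i)" by (simp add: lo_def hi_def algebra_simps)
    finally show "ramp (lo i) (hi i) q / \<gamma> \<le> u (Suc i) - u i"
      using \<gamma>_pos by (simp add: pos_divide_le_eq mult.commute)
  qed
  also have "\<dots> = u d - u 1" using d_ge_2 by (intro sum_Suc_diff') simp
  finally show ?thesis by (simp add: H_eq)
qed

lemma H_lipschitz: "\<bar>H q - H q'\<bar> \<le> d / \<gamma> * \<bar>q - q'\<bar>"
proof -
  have "\<bar>H q - H q'\<bar> = \<bar>\<Sum>i\<in>{1..<d}. (ramp (lo i) (hi i) q - ramp (lo i) (hi i) q') / \<gamma>\<bar>"
    by (simp add: H_eq sum_subtractf diff_divide_distrib)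
  also have "\<dots> \<le> (\<Sum>i\<in>{1..<d}. \<bar>q - q'\<bar> / \<gamma>)"
    using \<gamma>_pos by (intro order.trans[OF sum_abs] sum_mono)
      (auto simp: abs_divide intro!: divide_right_mono ramp_lipschitz less_imp_le[OF lo_less_hi])
  also have "\<dots> \<le> d / \<gamma> * \<bar>q - q'\<bar>"
    using \<gamma>_pos by (simp add: divide_right_mono mult_right_mono)
  finally show ?thesis .
qed

definition remainder :: "real \<Rightarrow> real \<Rightarrow> real" where
  "remainder q q' = H q - H q' - mix q / \<gamma> * (q - q')"

lemma remainder_eq:
  "remainder q q' = (\<Sum>i\<in>{1..<d}. (ramp (lo i) (hi i) q - ramp (lo i) (hi i) q' - indicator {lo i..hi i} q * (q - q')) / \<gamma>)"
  by (simp add: remainder_def H_eq chi_eq sum_subtractf diff_divide_distrib sum_divide_distrib[symmetric]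
      sum_distrib_right)

lemma remainder_le: "\<bar>remainder q q'\<bar> \<le> 2 * d / \<gamma> * \<bar>q - q'\<bar>"
proof -
  have "\<bar>remainder q q'\<bar> \<le> (\<Sum>i\<in>{1..<d}. 2 * \<bar>q - q'\<bar> / \<gamma>)"
    unfolding remainder_eq
    using \<gamma>_pos by (intro order.trans[OF sum_abs] sum_mono)
      (auto simp: abs_divide simp del: times_divide_eq_left
        intro!: divide_right_mono ramp_remainder_le less_imp_le[OF lo_less_hi])
  also have "\<dots> \<le> 2 * d / \<gamma> * \<bar>q - q'\<bar>"
    using \<gamma>_pos by (simp add: divide_right_mono mult_right_mono)
  finally show ?thesis .
qed

text \<open>\<open>H\<close> is piecewise linear and the slope is taken at the perturbed point \<open>q\<close>; hence the
  linearisation is exact as soon as no break point other than \<open>q'\<close> itself lies within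
  distance \<open>\<bar>q - q'\<bar>\<close> of \<open>q'\<close>.\<close>

lemma remainder_eq_0:
  assumes "\<And>p. p \<in> breakpoints \<Longrightarrow> q' = p \<or> \<bar>q - q'\<bar> < \<bar>q' - p\<bar>"
  shows "remainder q q' = 0"
  unfolding remainder_eq
proof (intro sum.neutral ballI)
  fix i assume i: "i \<in> {1..<d}"
  then have "lo i \<in> breakpoints" "hi i \<in> breakpoints" by (auto simp: breakpoints_def)
  then show "(ramp (lo i) (hi i) q - ramp (lo i) (hi i) q' - indicator {lo i..hi i} q * (q - q')) / \<gamma> = 0"
    using ramp_remainder_eq_0[OF lo_less_hi[of i] assms[of "lo i"] assms[of "hi i"]] i by simp
qed

lemma chi_eq_chi:
  assumes "\<And>p. p \<in> breakpoints \<Longrightarrow> \<bar>q - q'\<bar> < \<bar>q' - p\<bar>"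
  shows "mix q = mix q'"
  unfolding chi_eq by (intro sum.cong refl indicator_interval_eq assms) (auto simp: breakpoints_def)

text \<open>For positive controls the mixed intervals lie on the positive half-line.\<close>

lemma chi_times_nonneg: assumes "u 1 > 0" shows "0 \<le> mix q * q"
proof (cases "mix q = 0")
  case False
  then obtain i where i: "i \<in> {1..<d}" "lo i \<le> q"
    by (auto simp: chi_def Q_mixed_eq indicator_def split: if_splits)
  have "0 < u i" "0 < u (i + 1)"
    using assms u_le[of 1 i] u_le[of 1 "i + 1"] i by auto
  then have "0 < lo i" using \<alpha>_pos \<gamma>_pos by (simp add: lo_def add_pos_pos)
  then show ?thesis using i chi_bounds by (intro mult_nonneg_nonneg) auto
qed simp

lemma H_measurable [measurable]: "H \<in> borel_measurable borel"
  unfolding H_eq[abs_def] ramp_def by measurable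

lemma chi_measurable [measurable]: "mix \<in> borel_measurable borel"
  unfolding chi_eq[abs_def] by measurable

lemma omega_boundary_eq: "omega_boundary D \<alpha> d u \<gamma> y w = {x \<in> D. - y x * w x \<in> breakpoints}"
proof -
  have "frontier {lo i..hi i} = {lo i, hi i}" if "i \<in> {1..<d}" for i
    using lo_less_hi[of i] that by (auto simp: frontier_def interior_atLeastAtMost_real)
  then show ?thesis
    unfolding omega_boundary_def Q_mixed_eq breakpoints_def by fastforce
qed

lemma omega_mixed_eq: "omega_mixed D \<alpha> d u \<gamma> y w = {x \<in> D. mix (- y x * w x) = 1}"
  by (auto simp: omega_mixed_def chi_def indicator_def)

end

text \<open>The sets where \<open>0 < \<bar>g - p\<bar> \<le> 1/n\<close> decrease to the empty set.  The punctured neighbourhood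
  matters: \<open>g = p\<close> may well hold on a set of positive measure.\<close>

lemma (in finite_measure) punctured_nbhd_small:
  assumes g [measurable]: "g \<in> borel_measurable M" and P: "finite (P :: real set)" and \<eta>: "\<eta> > 0"
  shows "\<exists>s>0. measure M {x \<in> space M. \<exists>p\<in>P. 0 < \<bar>g x - p\<bar> \<and> \<bar>g x - p\<bar> \<le> s} < \<eta>"
  using P \<eta>
proof (induction P arbitrary: \<eta> rule: finite_induct)
  case empty
  then show ?case by (auto intro: exI[of _ 1])
next
  case (insert p P)
  define A where "A n = {x \<in> space M. 0 < \<bar>g x - p\<bar> \<and> \<bar>g x - p\<bar> \<le> 1 / Suc n}" for n :: nat
  have [measurable]: "A n \<in> sets M" for n unfolding A_def by measurable
  have "(\<lambda>n. measure M (A n)) \<longlonglongrightarrow> measure M (\<Inter>n. A n)"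
  proof (rule finite_Lim_measure_decseq)
    show "decseq A"
    proof (rule decseq_SucI)
      fix n
      have "1 / real (Suc (Suc n)) \<le> 1 / real (Suc n)" by (simp add: frac_le)
      then show "A (Suc n) \<subseteq> A n" unfolding A_def by (auto intro: order.trans)
    qed
  qed auto
  moreover have "(\<Inter>n. A n) = {}"
  proof safe
    fix x assume x: "x \<in> (\<Inter>n. A n)"
    then have "0 < \<bar>g x - p\<bar>" by (auto simp: A_def)
    then obtain n where "1 / real (Suc n) < \<bar>g x - p\<bar>" using nat_approx_posE by metis
    moreover have "x \<in> A n" using x by blast
    ultimately show "x \<in> {}" by (simp add: A_def)
  qed
  ultimately have "\<forall>\<^sub>F n in sequentially. measure M (A n) < \<eta> / 2"
    using insert.prems by (intro order_tendstoD) auto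
  then obtain n where n: "measure M (A n) < \<eta> / 2"
    by (auto simp: eventually_sequentially)
  obtain s where s: "s > 0" "measure M {x \<in> space M. \<exists>p\<in>P. 0 < \<bar>g x - p\<bar> \<and> \<bar>g x - p\<bar> \<le> s} < \<eta> / 2"
    using insert.IH[of "\<eta> / 2"] insert.prems by auto
  let ?B = "\<lambda>s P. {x \<in> space M. \<exists>p\<in>P. 0 < \<bar>g x - p\<bar> \<and> \<bar>g x - p\<bar> \<le> s}"
  have Bm: "?B s P \<in> sets M" for s
  proof -
    have "?B s P = (\<Union>p\<in>P. {x \<in> space M. 0 < \<bar>g x - p\<bar> \<and> \<bar>g x - p\<bar> \<le> s})" by auto
    also have "\<dots> \<in> sets M" using insert.hyps by (intro sets.finite_UN) measurable
    finally show ?thesis .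
  qed
  define t where "t = min s (1 / Suc n)"
  have "measure M (?B t (insert p P)) \<le> measure M (A n \<union> ?B s P)"
    by (rule finite_measure_mono) (use Bm in \<open>auto simp: A_def t_def\<close>)
  also have "\<dots> \<le> measure M (A n) + measure M (?B s P)"
    by (rule measure_Un_le) (use Bm in auto)
  also have "\<dots> < \<eta>" using n s(2) by simp
  finally show ?case using s(1) by (intro exI[of _ t]) (auto simp: t_def)
qed

lemma sets_punctured_nbhd:
  assumes [measurable]: "g \<in> borel_measurable M" and P: "finite (P :: real set)"
  shows "{x \<in> space M. \<exists>p\<in>P. 0 < \<bar>g x - p\<bar> \<and> \<bar>g x - p\<bar> \<le> s} \<in> sets M"
proof -
  have "{x \<in> space M. \<exists>p\<in>P. 0 < \<bar>g x - p\<bar> \<and> \<bar>g x - p\<bar> \<le> s}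
      = (\<Union>p\<in>P. {x \<in> space M. 0 < \<bar>g x - p\<bar> \<and> \<bar>g x - p\<bar> \<le> s})" by auto
  also have "\<dots> \<in> sets M" using P by (intro sets.finite_UN) measurable
  finally show ?thesis .
qed

text \<open>Coefficient errors are small except on a small set \<open>A\<close>, where they are merely bounded; smallness
  in \<open>L\<^sup>2\<close> suffices, since they are multiplied by functions that the \<open>H\<^sup>2\<close> norm controls in the
  supremum norm.\<close>

lemma L2_norm_indicator_bound:
  assumes fin: "finite_measure M" and k: "k \<in> borel_measurable M" and A: "A \<in> sets M"
    and le: "AE x in M. \<bar>k x\<bar> \<le> C * (indicator A x + e)" and C: "C \<ge> 0" "e \<ge> 0"
  shows "k \<in> L2 M" "L2_norm M k \<le> C * (sqrt (measure M A) + e * sqrt (measure M (space M)))"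
proof -
  interpret finite_measure M by fact
  have iA: "indicator A \<in> L2 M" and ie: "(\<lambda>x. e) \<in> L2 M"
    by (rule L2_bounded[OF fin, of _ "max 1 e"], use A C in \<open>auto simp: indicator_def\<close>)+
  note sum = L2_add[OF iA ie]
  have le': "AE x in M. \<bar>k x\<bar> \<le> \<bar>C * (indicator A x + e)\<bar>"
    using le by eventually_elim simp
  show "k \<in> L2 M" by (rule L2_norm_mono(1)[OF L2_scale[OF sum] k le'])
  have n1: "L2_norm M (indicator A) = sqrt (measure M A)"
  proof -
    have "(\<lambda>x. indicator A x * indicator A x) = (indicator A :: _ \<Rightarrow> real)" by (auto simp: indicator_def)
    then show ?thesis using A by (simp add: L2_norm_def L2_inner_def)
  qed
  have n2: "L2_norm M (\<lambda>x. e) = e * sqrt (measure M (space M))"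
    using C by (simp add: L2_norm_def L2_inner_def real_sqrt_mult mult.commute)
  have "L2_norm M k \<le> L2_norm M (\<lambda>x. C * (indicator A x + e))"
    by (rule L2_norm_mono(2)[OF L2_scale[OF sum] k le'])
  also have "\<dots> \<le> C * (L2_norm M (indicator A) + L2_norm M (\<lambda>x. e))"
    unfolding L2_norm_scale using L2_norm_triangle[OF iA ie] C by (simp add: mult_left_mono)
  finally show "L2_norm M k \<le> C * (sqrt (measure M A) + e * sqrt (measure M (space M)))"
    unfolding n1 n2 .
qed

section \<open>The linearised optimality system\<close>

locale elliptic_domain = normal_domain D \<nu> S for D :: "'a::euclidean_space set" and \<nu> S +
  fixes \<mu> :: real
  assumes D_nonempty: "D \<noteq> {}"
    and regularity: "elliptic_regularity D \<nu> S \<mu>"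
    and embedding: "H2_embeds_continuous D"
begin

text \<open>For \<open>\<mu> \<le> 0\<close> the potential zero would be admissible, but the constants are in the kernel of
  the Neumann Laplacian.\<close>

lemma \<mu>_pos: "\<mu> > 0"
proof (rule ccontr)
  assume "\<not> \<mu> > 0"
  then have "\<mu> \<le> 0" by simp
  then obtain C where C: "\<forall>g\<in>L2 M. \<forall>u\<in>U_set D \<mu> 0. \<exists>y. neumann_solution D \<nu> S u g y \<and>
         (\<forall>y'. neumann_solution D \<nu> S u g y' \<longrightarrow> ae_eq M y' y) \<and> H2_norm D y \<le> C * L2_norm M g"
    using regularity unfolding elliptic_regularity_def by blast
  have "(\<lambda>x. 0) \<in> U_set D \<mu> 0" using \<open>\<mu> \<le> 0\<close> by (simp add: U_set_def L2_zero)
  then obtain y where y: "\<And>y'. neumann_solution D \<nu> S (\<lambda>x. 0) (\<lambda>x. 0) y' \<Longrightarrow> ae_eq M y' y"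
    using C L2_zero by blast
  have "neumann_solution D \<nu> S (\<lambda>x. 0) (\<lambda>x. 0) (\<lambda>x. k)" for k
    using HN_const[of k] laplacian_const[of k] by (simp add: neumann_solution_def ae_eq_def)
  from y[OF this[of 0]] y[OF this[of 1]] have "AE x in M. False"
    unfolding ae_eq_def by eventually_elim simp
  then have "AE x in lebesgue. x \<notin> D" by (simp add: AE_restrict_space_iff)
  then have "D \<in> null_sets lebesgue" by (simp add: AE_iff_null_sets)
  then show False
    using open_D D_nonempty open_not_negligible negligible_iff_null_sets by blast
qed

lemma embedding_bound:
  obtains C where "C \<ge> 0" "\<And>v. v \<in> H2 D \<Longrightarrow> AE x in M. \<bar>v x\<bar> \<le> C * H2_norm D v"
proof -
  obtain C where C: "\<And>v. v \<in> H2 D \<Longrightarrow> \<exists>v'. continuous_on (closure D) v' \<and> ae_eq M v' v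
      \<and> (\<forall>x\<in>closure D. \<bar>v' x\<bar> \<le> C * H2_norm D v)"
    using embedding unfolding H2_embeds_continuous_def by blast
  show thesis
  proof (rule that[of "max C 0"])
    fix v assume "v \<in> H2 D"
    then obtain v' where v': "AE x in M. v' x = v x" "\<And>x. x \<in> closure D \<Longrightarrow> \<bar>v' x\<bar> \<le> C * H2_norm D v"
      using C unfolding ae_eq_def by blast
    have "C * H2_norm D v \<le> max C 0 * H2_norm D v" by (intro mult_right_mono) auto
    then have "AE x in M. \<bar>v' x\<bar> \<le> max C 0 * H2_norm D v"
      using v'(2) closure_subset by (intro AE_I2) (fastforce simp: space_restrict_space)
    with v'(1) show "AE x in M. \<bar>v x\<bar> \<le> max C 0 * H2_norm D v"
      by eventually_elim simp
  qed simp
qed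

definition bounded_coeff :: "('a \<Rightarrow> real) \<Rightarrow> bool" where
  "bounded_coeff k \<longleftrightarrow> k \<in> borel_measurable M \<and> (\<exists>C. AE x in M. \<bar>k x\<bar> \<le> C)"

lemma bounded_coeffI: "k \<in> borel_measurable M \<Longrightarrow> AE x in M. \<bar>k x\<bar> \<le> C \<Longrightarrow> bounded_coeff k"
  by (auto simp: bounded_coeff_def)

lemma bounded_coeff_measurable: "bounded_coeff k \<Longrightarrow> k \<in> borel_measurable M"
  by (simp add: bounded_coeff_def)

lemma bounded_coeff_mult_L2: "bounded_coeff k \<Longrightarrow> f \<in> L2 M \<Longrightarrow> (\<lambda>x. k x * f x) \<in> L2 M"
  unfolding bounded_coeff_def by (blast intro: L2_mult_bounded)

lemma bounded_coeff_diff: "bounded_coeff k \<Longrightarrow> bounded_coeff k' \<Longrightarrow> bounded_coeff (\<lambda>x. k x - k' x)"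
proof -
  assume "bounded_coeff k" "bounded_coeff k'"
  then obtain C C' where C: "AE x in M. \<bar>k x\<bar> \<le> C" "AE x in M. \<bar>k' x\<bar> \<le> C'"
    and [measurable]: "k \<in> borel_measurable M" "k' \<in> borel_measurable M"
    by (auto simp: bounded_coeff_def)
  from C have "AE x in M. \<bar>k x - k' x\<bar> \<le> C + C'"
    by eventually_elim linarith
  then show ?thesis by (intro bounded_coeffI[of _ "C + C'"]) measurable
qed

definition Lop :: "('a \<Rightarrow> real) \<Rightarrow> ('a \<Rightarrow> real) \<Rightarrow> 'a \<Rightarrow> real" where
  "Lop b v x = - laplacian D v x + b x * v x"

lemma Lop_L2: "bounded_coeff b \<Longrightarrow> v \<in> H2 D \<Longrightarrow> Lop b v \<in> L2 M"
  unfolding Lop_def[abs_def] by (intro L2_add L2_minus laplacian_L2 bounded_coeff_mult_L2 H2_L2)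

lemma Lop_lincomb:
  assumes "v \<in> H2 D" "w \<in> H2 D"
  shows "AE x in M. Lop b (\<lambda>x. v x + c * w x) x = Lop b v x + c * Lop b w x"
  using laplacian_lincomb[OF assms, of c] by eventually_elim (simp add: Lop_def algebra_simps)

lemma Lop_diff:
  assumes "v \<in> H2 D" "w \<in> H2 D"
  shows "AE x in M. Lop b (\<lambda>x. v x - w x) x = Lop b v x - Lop b w x"
  using Lop_lincomb[OF assms, of b "-1"] by simp

lemma HN_diff: "v \<in> HN \<Longrightarrow> w \<in> HN \<Longrightarrow> (\<lambda>x. v x - w x) \<in> HN"
  using HN_lincomb[of v w "-1"] by simp

lemma HN_add: "v \<in> HN \<Longrightarrow> w \<in> HN \<Longrightarrow> (\<lambda>x. v x + w x) \<in> HN"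
  using HN_lincomb[of v w 1] by simp

lemma HN_L2: "v \<in> HN \<Longrightarrow> v \<in> L2 M"
  by (intro H2_L2 HN_H2)

lemma Lop_symmetric:
  assumes b: "bounded_coeff b" and v: "v \<in> HN" and w: "w \<in> HN"
  shows "L2_inner M v (Lop b w) = L2_inner M w (Lop b v)"
proof -
  have *: "L2_inner M p (Lop b r) = - L2_inner M p (laplacian D r) + L2_inner M p (\<lambda>x. b x * r x)"
    if "p \<in> HN" "r \<in> HN" for p r
    unfolding Lop_def[abs_def]
    using L2_inner_add_right[OF L2_minus[OF laplacian_L2[OF HN_H2[OF that(2)]]]
        bounded_coeff_mult_L2[OF b HN_L2[OF that(2)]] HN_L2[OF that(1)]]
    by (simp add: L2_inner_minus_right)
  have "L2_inner M v (\<lambda>x. b x * w x) = L2_inner M w (\<lambda>x. b x * v x)"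
    by (simp add: L2_inner_def mult_ac)
  then show ?thesis using *[OF v w] *[OF w v] laplacian_symmetric[OF v w] by simp
qed

definition admissible :: "real \<Rightarrow> ('a \<Rightarrow> real) \<Rightarrow> bool" where
  "admissible m b \<longleftrightarrow> b \<in> borel_measurable M \<and> (AE x in M. \<mu> \<le> b x \<and> b x \<le> m)"

lemma admissible_bounded: "admissible m b \<Longrightarrow> bounded_coeff b"
proof -
  assume b: "admissible m b"
  then have "AE x in M. \<mu> \<le> b x \<and> b x \<le> m" by (simp add: admissible_def)
  then have "AE x in M. \<bar>b x\<bar> \<le> m" by eventually_elim (use \<mu>_pos in auto)
  then show ?thesis using b by (auto simp: bounded_coeff_def admissible_def)
qed

lemma uniform_solvability:
  assumes "m \<ge> \<mu>"
  obtains C where "C > 0"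
    "\<And>b g. admissible m b \<Longrightarrow> g \<in> L2 M \<Longrightarrow> \<exists>v\<in>HN. AE x in M. Lop b v x = g x"
    "\<And>b v. admissible m b \<Longrightarrow> v \<in> HN \<Longrightarrow> H2_norm D v \<le> C * L2_norm M (Lop b v)"
proof -
  obtain C where C: "\<forall>g\<in>L2 M. \<forall>u\<in>U_set D \<mu> m. \<exists>y. neumann_solution D \<nu> S u g y \<and>
         (\<forall>y'. neumann_solution D \<nu> S u g y' \<longrightarrow> ae_eq M y' y) \<and> H2_norm D y \<le> C * L2_norm M g"
    using regularity assms unfolding elliptic_regularity_def by blast
  have U: "b \<in> U_set D \<mu> m" if b: "admissible m b" for b
  proof -
    obtain C where "AE x in M. \<bar>b x\<bar> \<le> C" using admissible_bounded[OF b] by (auto simp: bounded_coeff_def)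
    then have "b \<in> L2 M" using b by (intro L2_bounded[OF finite_measure_M]) (auto simp: admissible_def)
    then show ?thesis using b by (simp add: U_set_def admissible_def)
  qed
  have sol: "neumann_solution D \<nu> S b g y \<longleftrightarrow> y \<in> HN \<and> (AE x in M. Lop b y x = g x)" for b g y
    by (simp add: neumann_solution_def ae_eq_def Lop_def)
  show thesis
  proof (rule that[of "max C 1"])
    show "\<exists>v\<in>HN. AE x in M. Lop b v x = g x" if "admissible m b" "g \<in> L2 M" for b g
      using C U[OF that(1)] that(2) unfolding sol by blast
    show "H2_norm D v \<le> max C 1 * L2_norm M (Lop b v)" if b: "admissible m b" and v: "v \<in> HN" for b v
    proof -
      have "Lop b v \<in> L2 M" using Lop_L2[OF admissible_bounded[OF b] HN_H2[OF v]] .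
      then obtain y where y: "y \<in> HN" "\<And>y'. y' \<in> HN \<and> (AE x in M. Lop b y' x = Lop b v x) \<Longrightarrow> ae_eq M y' y"
        "H2_norm D y \<le> C * L2_norm M (Lop b v)"
        using C U[OF b] unfolding sol by blast
      have "AE x in M. v x = y x" using y(2)[of v] v by (simp add: ae_eq_def)
      then have eq: "H2_norm D y = H2_norm D v"
        by (intro H2_cong(3) HN_H2 v H2_measurable y)
      have "C * L2_norm M (Lop b v) \<le> max C 1 * L2_norm M (Lop b v)" by (intro mult_right_mono) auto
      then show ?thesis using y(3) eq by linarith
    qed
  qed simp
qed

text \<open>The two rows of the linearised system, with abstract coefficients: \<open>b\<close> is the potential of the
  elliptic operator off the diagonal, \<open>h\<close> and \<open>- c\<close> are the diagonal entries.\<close>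

definition sys1 :: "('a \<Rightarrow> real) \<Rightarrow> ('a \<Rightarrow> real) \<Rightarrow> ('a \<Rightarrow> real) \<Rightarrow> ('a \<Rightarrow> real) \<Rightarrow> 'a \<Rightarrow> real" where
  "sys1 b h v w x = h x * v x + Lop b w x"

definition sys2 :: "('a \<Rightarrow> real) \<Rightarrow> ('a \<Rightarrow> real) \<Rightarrow> ('a \<Rightarrow> real) \<Rightarrow> ('a \<Rightarrow> real) \<Rightarrow> 'a \<Rightarrow> real" where
  "sys2 b c v w x = Lop b v x - c x * w x"

lemma sys1_L2: "bounded_coeff b \<Longrightarrow> bounded_coeff h \<Longrightarrow> v \<in> HN \<Longrightarrow> w \<in> HN \<Longrightarrow> sys1 b h v w \<in> L2 M"
  unfolding sys1_def[abs_def] by (intro L2_add bounded_coeff_mult_L2 Lop_L2 HN_L2 HN_H2)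

lemma sys2_L2: "bounded_coeff b \<Longrightarrow> bounded_coeff c \<Longrightarrow> v \<in> HN \<Longrightarrow> w \<in> HN \<Longrightarrow> sys2 b c v w \<in> L2 M"
  unfolding sys2_def[abs_def] by (intro L2_diff bounded_coeff_mult_L2 Lop_L2 HN_L2 HN_H2)

lemma sys1_lincomb:
  assumes "v \<in> HN" "w \<in> HN" "v' \<in> HN" "w' \<in> HN"
  shows "AE x in M. sys1 b h (\<lambda>x. v x + k * v' x) (\<lambda>x. w x + k * w' x) x = sys1 b h v w x + k * sys1 b h v' w' x"
  using Lop_lincomb[OF HN_H2[OF assms(2)] HN_H2[OF assms(4)], of b k]
  by eventually_elim (simp add: sys1_def algebra_simps)

lemma sys2_lincomb:
  assumes "v \<in> HN" "w \<in> HN" "v' \<in> HN" "w' \<in> HN"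
  shows "AE x in M. sys2 b c (\<lambda>x. v x + k * v' x) (\<lambda>x. w x + k * w' x) x = sys2 b c v w x + k * sys2 b c v' w' x"
  using Lop_lincomb[OF HN_H2[OF assms(1)] HN_H2[OF assms(3)], of b k]
  by eventually_elim (simp add: sys2_def algebra_simps)

definition a_priori :: "('a \<Rightarrow> real) \<Rightarrow> ('a \<Rightarrow> real) \<Rightarrow> ('a \<Rightarrow> real) \<Rightarrow> real \<Rightarrow> bool" where
  "a_priori b h c K \<longleftrightarrow> (\<forall>v\<in>HN. \<forall>w\<in>HN.
     H2_norm D v + H2_norm D w \<le> K * (L2_norm M (sys1 b h v w) + L2_norm M (sys2 b c v w)))"

definition solvable :: "('a \<Rightarrow> real) \<Rightarrow> ('a \<Rightarrow> real) \<Rightarrow> ('a \<Rightarrow> real) \<Rightarrow> bool" where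
  "solvable b h c \<longleftrightarrow> (\<forall>r\<in>L2 M. \<forall>s\<in>L2 M. \<exists>v\<in>HN. \<exists>w\<in>HN.
     (AE x in M. sys1 b h v w x = r x) \<and> (AE x in M. sys2 b c v w x = s x))"

text \<open>The a priori estimate survives by absorption: the perturbation, as an operator from \<open>H\<^sup>2\<close> to
  \<open>L\<^sup>2\<close>, is small compared with \<open>1 / K\<close>.  Solvability survives by a Banach iteration for the
  right-hand sides \<open>\<rho> \<mapsto> (r, s) - E (G\<^sup>-\<^sup>1 \<rho>)\<close>; it takes place in \<open>L\<^sup>2\<close>, whose
  completeness provides the limit.\<close>

lemma small_perturbation:
  assumes b: "bounded_coeff b" and h: "bounded_coeff h" and c: "bounded_coeff c"
    and b': "bounded_coeff b'" and h': "bounded_coeff h'" and c': "bounded_coeff c'"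
    and ap: "a_priori b h c K" and solv: "solvable b h c" and K: "K > 0" and \<delta>: "0 \<le> \<delta>" "4 * K * \<delta> \<le> 1"
    and db: "\<And>v. v \<in> HN \<Longrightarrow> L2_norm M (\<lambda>x. (b' x - b x) * v x) \<le> \<delta> * H2_norm D v"
    and dh: "\<And>v. v \<in> HN \<Longrightarrow> L2_norm M (\<lambda>x. (h' x - h x) * v x) \<le> \<delta> * H2_norm D v"
    and dc: "\<And>v. v \<in> HN \<Longrightarrow> L2_norm M (\<lambda>x. (c' x - c x) * v x) \<le> \<delta> * H2_norm D v"
  shows "a_priori b' h' c' (2 * K)" "solvable b' h' c'"
proof -
  \<comment> \<open>the two equations are indexed by truth values, so that each estimate is made once\<close>
  define G where "G i = (if i then sys1 b h else sys2 b c)" for i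
  define G' where "G' i = (if i then sys1 b' h' else sys2 b' c')" for i
  define E where "E i v w x = (if i then (h' x - h x) * v x + (b' x - b x) * w x
    else (b' x - b x) * v x - (c' x - c x) * w x)" for i v w x
  define N where "N v w = H2_norm D v + H2_norm D w" for v w
  have N0: "N v w \<ge> 0" for v w by (simp add: N_def)
  have GL: "G i v w \<in> L2 M" and G'L: "G' i v w \<in> L2 M" if "v \<in> HN" "w \<in> HN" for i v w
    unfolding G_def G'_def using that by (auto intro: sys1_L2 sys2_L2 b h c b' h' c')
  note mL = bounded_coeff_mult_L2[OF bounded_coeff_diff HN_L2]
  have EL: "E i v w \<in> L2 M" if v: "v \<in> HN" and w: "w \<in> HN" for i v w
    unfolding E_def[abs_def]
    using L2_add[OF mL[OF h' h v] mL[OF b' b w]] L2_diff[OF mL[OF b' b v] mL[OF c' c w]] by (cases i) simp_all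
  have En: "L2_norm M (E i v w) \<le> \<delta> * N v w" if v: "v \<in> HN" and w: "w \<in> HN" for i v w
    using L2_norm_triangle[OF mL[OF h' h v] mL[OF b' b w]] dh[OF v] db[OF w]
      L2_norm_triangle_diff[OF mL[OF b' b v] mL[OF c' c w]] db[OF v] dc[OF w]
    by (cases i) (simp_all add: E_def[abs_def] N_def distrib_left)
  have G'_eq: "G' i v w = (\<lambda>x. G i v w x + E i v w x)" for i v w
    by (auto simp: G_def G'_def E_def sys1_def sys2_def Lop_def algebra_simps)
  have E_diff: "E i (\<lambda>x. v x - v' x) (\<lambda>x. w x - w' x) = (\<lambda>x. E i v w x - E i v' w' x)" for i v w v' w'
    by (auto simp: E_def algebra_simps)
  have G_diff: "AE x in M. G i (\<lambda>x. v x - v' x) (\<lambda>x. w x - w' x) x = G i v w x - G i v' w' x"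
    if "v \<in> HN" "w \<in> HN" "v' \<in> HN" "w' \<in> HN" for i v w v' w'
    using sys1_lincomb[OF that, of b h "-1"] sys2_lincomb[OF that, of b c "-1"] by (cases i) (simp_all add: G_def)
  have apN: "N v w \<le> K * (L2_norm M (G True v w) + L2_norm M (G False v w))" if "v \<in> HN" "w \<in> HN" for v w
    using ap that by (simp add: a_priori_def N_def G_def)
  have "N v w \<le> 2 * K * (L2_norm M (G' True v w) + L2_norm M (G' False v w))"
    if v: "v \<in> HN" and w: "w \<in> HN" for v w
  proof -
    let ?G' = "L2_norm M (G' True v w) + L2_norm M (G' False v w)"
    have "L2_norm M (G i v w) \<le> L2_norm M (G' i v w) + \<delta> * N v w" for i
      using L2_norm_triangle_diff[OF G'L[OF v w] EL[OF v w], of i i] En[OF v w, of i] by (simp add: G'_eq)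
    from add_mono[OF this[of True] this[of False]]
    have "L2_norm M (G True v w) + L2_norm M (G False v w) \<le> ?G' + 2 * \<delta> * N v w" by simp
    then have "K * (L2_norm M (G True v w) + L2_norm M (G False v w)) \<le> K * (?G' + 2 * \<delta> * N v w)"
      using K by (intro mult_left_mono) auto
    then have "N v w \<le> K * (?G' + 2 * \<delta> * N v w)" using apN[OF v w] by linarith
    also have "\<dots> = K * ?G' + (4 * K * \<delta>) * N v w / 2" by (simp add: algebra_simps)
    also have "\<dots> \<le> K * ?G' + 1 * N v w / 2"
      using \<delta> N0 by (intro add_left_mono divide_right_mono mult_right_mono) auto
    finally have "N v w \<le> K * ?G' + N v w / 2" by (simp only: mult_1)
    then have "N v w \<le> 2 * (K * ?G')" by linarith
    then show ?thesis by (simp only: mult.assoc)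
  qed
  then show "a_priori b' h' c' (2 * K)" by (simp add: a_priori_def N_def G'_def)
  show "solvable b' h' c'"
    unfolding solvable_def
  proof (intro ballI)
    fix r s assume "r \<in> L2 M" "s \<in> L2 M"
    define rs where "rs i = (if i then r else s)" for i
    have rsL: "rs i \<in> L2 M" for i using \<open>r \<in> L2 M\<close> \<open>s \<in> L2 M\<close> by (simp add: rs_def)
    define sol where "sol \<rho> v w \<longleftrightarrow> v \<in> HN \<and> w \<in> HN \<and> (\<forall>i. AE x in M. G i v w x = \<rho> i x)" for \<rho> v w
    define V where "V \<rho> = fst (SOME vw. sol \<rho> (fst vw) (snd vw))" for \<rho>
    define W where "W \<rho> = snd (SOME vw. sol \<rho> (fst vw) (snd vw))" for \<rho>
    have VW: "V \<rho> \<in> HN" "W \<rho> \<in> HN" "AE x in M. G i (V \<rho>) (W \<rho>) x = \<rho> i x"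
      if \<rho>: "\<And>i. \<rho> i \<in> L2 M" for \<rho> i
    proof -
      obtain v w where "v \<in> HN" "w \<in> HN" "AE x in M. sys1 b h v w x = \<rho> True x" "AE x in M. sys2 b c v w x = \<rho> False x"
        using solv[unfolded solvable_def, rule_format, OF \<rho>[of True] \<rho>[of False]] by blast
      then have "sol \<rho> v w" by (simp add: sol_def G_def all_bool_eq)
      then have "\<exists>vw. sol \<rho> (fst vw) (snd vw)" by (intro exI[of _ "(v, w)"]) simp
      from someI_ex[OF this] have "sol \<rho> (V \<rho>) (W \<rho>)" by (simp add: V_def W_def)
      then show "V \<rho> \<in> HN" "W \<rho> \<in> HN" "AE x in M. G i (V \<rho>) (W \<rho>) x = \<rho> i x"
        by (auto simp: sol_def)
    qed
    define dist2 where "dist2 \<sigma> \<tau> = L2_norm M (\<lambda>x. \<sigma> True x - \<tau> True x) + L2_norm M (\<lambda>x. \<sigma> False x - \<tau> False x)"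
      for \<sigma> \<tau> :: "bool \<Rightarrow> 'a \<Rightarrow> real"
    have dist2: "L2_norm M (\<lambda>x. \<sigma> i x - \<tau> i x) \<le> dist2 \<sigma> \<tau>" for \<sigma> \<tau> i
      by (cases i) (simp_all add: dist2_def)
    define step where "step \<rho> = (\<lambda>i x. rs i x - E i (V \<rho>) (W \<rho>) x)" for \<rho>
    have stepL: "step \<tau> i \<in> L2 M" if "\<And>i. \<tau> i \<in> L2 M" for \<tau> i
      unfolding step_def by (intro L2_diff[OF rsL] EL VW that)
    have step_close: "L2_norm M (\<lambda>x. step \<sigma> i x - step \<tau> i x) \<le> \<delta> * (K * dist2 \<sigma> \<tau>)"
      if \<sigma>: "\<And>i. \<sigma> i \<in> L2 M" and \<tau>: "\<And>i. \<tau> i \<in> L2 M" for \<sigma> \<tau> i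
    proof -
      let ?v = "\<lambda>x. V \<tau> x - V \<sigma> x" and ?w = "\<lambda>x. W \<tau> x - W \<sigma> x"
      note a = VW[of \<sigma>, OF \<sigma>] and t = VW[of \<tau>, OF \<tau>]
      have d: "?v \<in> HN" "?w \<in> HN" by (intro HN_diff a t)+
      have "L2_norm M (G i ?v ?w) = L2_norm M (\<lambda>x. \<sigma> i x - \<tau> i x)" for i
      proof -
        have "AE x in M. G i ?v ?w x = \<tau> i x - \<sigma> i x"
          using G_diff[OF t(1,2) a(1,2), of i] a(3)[of i] t(3)[of i] by eventually_elim simp
        then have "L2_norm M (G i ?v ?w) = L2_norm M (\<lambda>x. \<tau> i x - \<sigma> i x)"
          by (intro L2_norm_cong_AE L2_measurable[OF GL[OF d]] L2_measurable[OF L2_diff[OF \<tau> \<sigma>]])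
        then show ?thesis by (simp only: L2_norm_diff_commute[of M "\<tau> i"])
      qed
      then have "N ?v ?w \<le> K * dist2 \<sigma> \<tau>" using apN[OF d] by (simp add: dist2_def)
      then have "\<delta> * N ?v ?w \<le> \<delta> * (K * dist2 \<sigma> \<tau>)" using \<delta>(1) by (rule mult_left_mono)
      moreover have "(\<lambda>x. step \<sigma> i x - step \<tau> i x) = E i ?v ?w"
        unfolding E_diff by (auto simp: step_def)
      ultimately show ?thesis using En[OF d, of i] by simp
    qed
    define \<rho> where "\<rho> n = (step ^^ n) rs" for n
    have \<rho>S: "\<rho> (Suc n) = step (\<rho> n)" for n by (simp add: \<rho>_def)
    have \<rho>L: "\<rho> n i \<in> L2 M" for n i
      by (induction n arbitrary: i) (simp add: \<rho>_def rsL, unfold \<rho>S, rule stepL)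
    define inc where "inc n = dist2 (\<rho> (Suc n)) (\<rho> n)" for n
    have inc0: "inc n \<ge> 0" for n by (simp add: inc_def dist2_def)
    have inc_half: "inc (Suc n) \<le> inc n * (1/2)" for n
    proof -
      have "inc (Suc n) \<le> \<delta> * (K * inc n) + \<delta> * (K * inc n)"
        unfolding inc_def \<rho>S[of "Suc n"] \<rho>S[of n]
        by (subst dist2_def) (intro add_mono step_close stepL \<rho>L)
      also have "\<dots> = (4 * K * \<delta>) * (inc n / 2)" by simp
      also have "\<dots> \<le> 1 * (inc n / 2)" using \<delta> inc0 by (intro mult_right_mono) auto
      finally show ?thesis by simp
    qed
    have inc: "inc n \<le> inc 0 * (1/2) ^ n" for n
    proof (induction n)
      case (Suc n)
      then show ?case using inc_half[of n] by simp
    qed simp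
    have "\<forall>i. \<exists>g. g \<in> L2 M \<and> (\<lambda>n. L2_norm M (\<lambda>x. \<rho> n i x - g x)) \<longlonglongrightarrow> 0"
    proof
      fix i
      have "L2_norm M (\<lambda>x. \<rho> (Suc n) i x - \<rho> n i x) \<le> inc 0 * (1/2) ^ n" for n
        using dist2[of "\<rho> (Suc n)" i "\<rho> n"] inc[of n] unfolding inc_def by linarith
      then show "\<exists>g. g \<in> L2 M \<and> (\<lambda>n. L2_norm M (\<lambda>x. \<rho> n i x - g x)) \<longlonglongrightarrow> 0"
        using L2_complete_geometric[OF finite_measure_M, of "\<lambda>n. \<rho> n i" "inc 0" "1/2"] \<rho>L by auto
    qed
    from choice[OF this] obtain p where p: "\<And>i. p i \<in> L2 M"
      and lim_p: "\<And>i. (\<lambda>n. L2_norm M (\<lambda>x. \<rho> n i x - p i x)) \<longlonglongrightarrow> 0" by blast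
    note vw = VW[of p, OF p]
    define e where "e n = dist2 (\<rho> n) p" for n
    have e: "e \<longlonglongrightarrow> 0"
      using tendsto_add[OF lim_p[of True] lim_p[of False]] by (simp add: e_def[abs_def] dist2_def)
    have lim: "(\<lambda>n. e (Suc n) + \<delta> * (K * e n)) \<longlonglongrightarrow> 0"
      using tendsto_add[OF LIMSEQ_Suc[OF e] tendsto_mult_right_zero[OF tendsto_mult_right_zero[OF e]]] by simp
    have fixpoint: "AE x in M. p i x = step p i x" for i
    proof -
      have "L2_norm M (\<lambda>x. p i x - step p i x) \<le> e (Suc n) + \<delta> * (K * e n)" for n
      proof -
        have "L2_norm M (\<lambda>x. p i x - step p i x) \<le> L2_norm M (\<lambda>x. p i x - \<rho> (Suc n) i x)
            + L2_norm M (\<lambda>x. \<rho> (Suc n) i x - step p i x)"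
          by (rule L2_norm_triangle_middle[OF p \<rho>L stepL[OF p]])
        moreover have "L2_norm M (\<lambda>x. p i x - \<rho> (Suc n) i x) \<le> e (Suc n)"
          using dist2[of "\<rho> (Suc n)" i p] unfolding e_def L2_norm_diff_commute[of M "p i"] .
        moreover have "L2_norm M (\<lambda>x. \<rho> (Suc n) i x - step p i x) \<le> \<delta> * (K * e n)"
          unfolding \<rho>S e_def by (intro step_close \<rho>L p)
        ultimately show ?thesis by linarith
      qed
      then have "L2_norm M (\<lambda>x. p i x - step p i x) \<le> 0"
        by (intro LIMSEQ_le_const[OF lim]) auto
      then have "L2_norm M (\<lambda>x. p i x - step p i x) = 0" by (intro antisym) auto
      then show ?thesis
        unfolding L2_norm_eq_0_iff[OF L2_diff[OF p stepL[OF p]]] by eventually_elim simp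
    qed
    have "AE x in M. G' i (V p) (W p) x = rs i x" for i
      unfolding G'_eq using vw(3)[of i] fixpoint[of i] by eventually_elim (simp add: step_def)
    from this[of True] this[of False] show "\<exists>v\<in>HN. \<exists>w\<in>HN. (AE x in M. sys1 b' h' v w x = r x) \<and> (AE x in M. sys2 b' c' v w x = s x)"
      using vw(1,2) by (auto simp: G'_def rs_def)
  qed
qed

lemma quadratic_absorption:
  fixes \<kappa> t R A B :: real
  assumes "\<kappa> * t\<^sup>2 \<le> R * (A * t + B * R)" "\<kappa> > 0" "t \<ge> 0" "R \<ge> 0" "A \<ge> 0" "B \<ge> 0"
  shows "t \<le> ((A + B) / \<kappa> + 1) * R"
proof (cases "t \<le> R")
  case True
  have "0 \<le> (A + B) / \<kappa> * R" using assms by simp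
  then show ?thesis using True by (simp add: distrib_right)
next
  case False
  then have t: "t > 0" using assms by linarith
  have "R * (A * t + B * R) \<le> R * (A * t + B * t)"
    using assms False by (intro mult_left_mono add_left_mono) auto
  with assms(1) have "(\<kappa> * t) * t \<le> (R * (A + B)) * t"
    by (simp add: algebra_simps power2_eq_square)
  then have "\<kappa> * t \<le> R * (A + B)" using t by (simp only: mult_le_cancel_right_pos)
  then have "t \<le> (A + B) / \<kappa> * R" using assms by (simp add: field_simps)
  then show ?thesis using assms by (simp add: distrib_right)
qed

text \<open>Testing the first equation with \<open>v\<close> and the second with \<open>w\<close> and
  subtracting cancels the symmetric elliptic part, so a positive weight \<open>h\<close> and a non-negative \<open>c\<close>
  control \<open>v\<close> in \<open>L\<^sup>2\<close>; elliptic regularity does the rest.\<close>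

lemma energy_a_priori:
  assumes m: "m \<ge> \<mu>" and \<kappa>: "\<kappa> > 0"
  obtains K where "K > 0" "\<And>b h c. admissible m b \<Longrightarrow> bounded_coeff h \<Longrightarrow> bounded_coeff c \<Longrightarrow>
    (AE x in M. \<kappa> \<le> h x \<and> h x \<le> 1) \<Longrightarrow> (AE x in M. 0 \<le> c x \<and> c x \<le> Cc) \<Longrightarrow> a_priori b h c K"
proof -
  obtain C where C: "C > 0" "\<And>b v. admissible m b \<Longrightarrow> v \<in> HN \<Longrightarrow> H2_norm D v \<le> C * L2_norm M (Lop b v)"
    by (rule uniform_solvability[OF m]) blast
  define Tv where "Tv = ((1 + C) + C) / \<kappa> + 1"
  define Kw where "Kw = C * (1 + Tv)"
  define Kv where "Kv = C * (1 + \<bar>Cc\<bar> * Kw)"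
  have Tv: "Tv > 0" using C \<kappa> by (simp add: Tv_def add_nonneg_pos)
  have Kw: "Kw > 0" using C Tv by (simp add: Kw_def)
  have Kv: "Kv > 0" using C Kw by (simp add: Kv_def add_pos_nonneg)
  show thesis
  proof (rule that[of "Kv + Kw"])
    show "Kv + Kw > 0" using Kv Kw by simp
    fix b h c
    assume b: "admissible m b" and h: "bounded_coeff h" and c: "bounded_coeff c"
      and hb: "AE x in M. \<kappa> \<le> h x \<and> h x \<le> 1" and cb: "AE x in M. 0 \<le> c x \<and> c x \<le> Cc"
    note b' = admissible_bounded[OF b]
    show "a_priori b h c (Kv + Kw)"
      unfolding a_priori_def
    proof (intro ballI)
      fix v w assume v: "v \<in> HN" and w: "w \<in> HN"
      define r where "r = sys1 b h v w"
      define s where "s = sys2 b c v w"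
      define R where "R = L2_norm M r + L2_norm M s"
      have R0: "R \<ge> 0" by (simp add: R_def)
      have rL: "r \<in> L2 M" and sL: "s \<in> L2 M"
        unfolding r_def s_def by (intro sys1_L2 sys2_L2 b' h c v w)+
      have vL: "v \<in> L2 M" and wL: "w \<in> L2 M" by (intro HN_L2 v w)+
      have hvL: "(\<lambda>x. h x * v x) \<in> L2 M" and cwL: "(\<lambda>x. c x * w x) \<in> L2 M"
        by (intro bounded_coeff_mult_L2 h c vL wL)+
      have LvL: "Lop b v \<in> L2 M" and LwL: "Lop b w \<in> L2 M" by (intro Lop_L2 b' HN_H2 v w)+
      have "L2_inner M v r = L2_inner M v (\<lambda>x. h x * v x) + L2_inner M v (Lop b w)"
        unfolding r_def sys1_def[abs_def] by (rule L2_inner_add_right[OF hvL LwL vL])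
      moreover have "L2_inner M w s = L2_inner M w (Lop b v) - L2_inner M w (\<lambda>x. c x * w x)"
        unfolding s_def sys2_def[abs_def] by (rule L2_inner_diff_right[OF LvL cwL wL])
      ultimately have "L2_inner M v r - L2_inner M w s = L2_inner M v (\<lambda>x. h x * v x) + L2_inner M w (\<lambda>x. c x * w x)"
        using Lop_symmetric[OF b' v w] by simp
      moreover have "L2_inner M w (\<lambda>x. c x * w x) \<ge> 0"
        unfolding L2_inner_def
      proof (rule integral_nonneg_AE)
        show "AE x in M. 0 \<le> w x * (c x * w x)"
          using cb
        proof eventually_elim
          case (elim x)
          then have "0 \<le> c x * (w x * w x)" by (intro mult_nonneg_nonneg zero_le_square) auto
          then show ?case by (simp add: mult_ac)
        qed
      qed
      moreover have "L2_inner M v (\<lambda>x. h x * v x) \<ge> \<kappa> * (L2_norm M v)\<^sup>2"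
      proof -
        have "\<kappa> * L2_inner M v v = (LINT x|M. \<kappa> * (v x * v x))" by (simp add: L2_inner_def)
        also have "\<dots> \<le> L2_inner M v (\<lambda>x. h x * v x)"
          unfolding L2_inner_def
        proof (rule integral_mono_AE)
          show "integrable M (\<lambda>x. \<kappa> * (v x * v x))" using L2_integrable_mult[OF vL vL] by simp
          show "integrable M (\<lambda>x. v x * (h x * v x))" by (rule L2_integrable_mult[OF vL hvL])
          show "AE x in M. \<kappa> * (v x * v x) \<le> v x * (h x * v x)"
            using hb
          proof eventually_elim
            case (elim x)
            then have "\<kappa> * (v x * v x) \<le> h x * (v x * v x)" by (intro mult_right_mono) auto
            then show ?case by (simp add: mult_ac)
          qed
        qed
        finally show ?thesis by (simp add: L2_norm_power2)
      qed
      ultimately have "\<kappa> * (L2_norm M v)\<^sup>2 \<le> L2_inner M v r - L2_inner M w s" by linarith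
      also have "\<dots> \<le> L2_norm M v * L2_norm M r + L2_norm M w * L2_norm M s"
        using L2_Cauchy_Schwarz[OF vL rL] L2_Cauchy_Schwarz[OF wL sL] by linarith
      also have "\<dots> \<le> L2_norm M v * R + L2_norm M w * R"
        by (intro add_mono mult_left_mono) (auto simp: R_def)
      finally have en: "\<kappa> * (L2_norm M v)\<^sup>2 \<le> L2_norm M v * R + L2_norm M w * R" .
      have Hw: "H2_norm D w \<le> C * (R + L2_norm M v)"
      proof -
        have "Lop b w = (\<lambda>x. r x - h x * v x)" by (auto simp: r_def sys1_def)
        then have "L2_norm M (Lop b w) \<le> L2_norm M r + L2_norm M (\<lambda>x. h x * v x)"
          using L2_norm_triangle_diff[OF rL hvL] by simp
        moreover have "L2_norm M (\<lambda>x. h x * v x) \<le> 1 * L2_norm M v"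
        proof (rule L2_norm_mult_bounded[OF vL bounded_coeff_measurable[OF h]])
          show "AE x in M. \<bar>h x\<bar> \<le> 1" using hb by eventually_elim (use \<kappa> in auto)
        qed simp
        ultimately have "L2_norm M (Lop b w) \<le> R + L2_norm M v"
          using L2_norm_nonneg[of M s] unfolding R_def by linarith
        then have "C * L2_norm M (Lop b w) \<le> C * (R + L2_norm M v)" using C(1) by simp
        then show ?thesis using C(2)[OF b w] by linarith
      qed
      have wle: "L2_norm M w \<le> C * (R + L2_norm M v)" using H2_norm_ge(1)[of w] Hw by linarith
      have "L2_norm M v * R + L2_norm M w * R \<le> L2_norm M v * R + C * (R + L2_norm M v) * R"
        using wle R0 by (intro add_left_mono mult_right_mono)
      also have "\<dots> = R * ((1 + C) * L2_norm M v + C * R)" by (simp add: algebra_simps)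
      finally have "L2_norm M v \<le> Tv * R"
        unfolding Tv_def using C \<kappa> R0 en by (intro quadratic_absorption) auto
      then have "C * (R + L2_norm M v) \<le> C * (R + Tv * R)"
        using C by (intro mult_left_mono) auto
      then have W: "H2_norm D w \<le> Kw * R"
        using Hw by (simp add: Kw_def algebra_simps)
      have V: "H2_norm D v \<le> Kv * R"
      proof -
        have "Lop b v = (\<lambda>x. s x + c x * w x)" by (auto simp: s_def sys2_def)
        then have "L2_norm M (Lop b v) \<le> L2_norm M s + L2_norm M (\<lambda>x. c x * w x)"
          using L2_norm_triangle[OF sL cwL] by simp
        moreover have "L2_norm M (\<lambda>x. c x * w x) \<le> \<bar>Cc\<bar> * L2_norm M w"
        proof (rule L2_norm_mult_bounded[OF wL bounded_coeff_measurable[OF c]])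
          show "AE x in M. \<bar>c x\<bar> \<le> \<bar>Cc\<bar>" using cb by eventually_elim auto
        qed simp
        moreover have "\<bar>Cc\<bar> * L2_norm M w \<le> \<bar>Cc\<bar> * (Kw * R)"
          using H2_norm_ge(1)[of w] W by (intro mult_left_mono) auto
        ultimately have "L2_norm M (Lop b v) \<le> R + \<bar>Cc\<bar> * (Kw * R)"
          using L2_norm_nonneg[of M r] unfolding R_def by linarith
        then have "C * L2_norm M (Lop b v) \<le> C * (R + \<bar>Cc\<bar> * (Kw * R))"
          using C by (intro mult_left_mono) auto
        then show ?thesis using C(2)[OF b v] by (simp add: Kv_def algebra_simps)
      qed
      show "H2_norm D v + H2_norm D w \<le> (Kv + Kw) * (L2_norm M (sys1 b h v w) + L2_norm M (sys2 b c v w))"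
        using add_mono[OF V W] unfolding R_def r_def s_def by (simp only: distrib_right)
    qed
  qed
qed

text \<open>This is the method of continuity: for \<open>c = 0\<close> the system is triangular, and since the a priori
  estimate is uniform along \<open>t c\<close>, \<open>0 \<le> t \<le> 1\<close>, finitely many steps of fixed size lead to \<open>c\<close>.\<close>

lemma energy_solvable:
  assumes m: "m \<ge> \<mu>" and \<kappa>: "\<kappa> > 0"
  obtains K where "K > 0" "\<And>b h c. admissible m b \<Longrightarrow> bounded_coeff h \<Longrightarrow> bounded_coeff c \<Longrightarrow>
    (AE x in M. \<kappa> \<le> h x \<and> h x \<le> 1) \<Longrightarrow> (AE x in M. 0 \<le> c x \<and> c x \<le> Cc) \<Longrightarrow>
    a_priori b h c K \<and> solvable b h c"
proof -
  obtain C where C: "\<And>b g. admissible m b \<Longrightarrow> g \<in> L2 M \<Longrightarrow> \<exists>v\<in>HN. AE x in M. Lop b v x = g x"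
    by (rule uniform_solvability[OF m]) blast
  obtain K where K: "K > 0" and apK: "\<And>b h c. admissible m b \<Longrightarrow> bounded_coeff h \<Longrightarrow> bounded_coeff c \<Longrightarrow>
    (AE x in M. \<kappa> \<le> h x \<and> h x \<le> 1) \<Longrightarrow> (AE x in M. 0 \<le> c x \<and> c x \<le> Cc) \<Longrightarrow> a_priori b h c K"
    by (rule energy_a_priori[OF m \<kappa>, of Cc]) blast
  show thesis
  proof (rule that[OF K])
    fix b h c
    assume b: "admissible m b" and h: "bounded_coeff h" and c: "bounded_coeff c"
      and hb: "AE x in M. \<kappa> \<le> h x \<and> h x \<le> 1" and cb: "AE x in M. 0 \<le> c x \<and> c x \<le> Cc"
    note b' = admissible_bounded[OF b]
    \<comment> \<open>steps of size \<open>1/n\<close> are admissible for the perturbation lemma with \<open>\<delta> = \<bar>Cc\<bar> / n\<close>\<close>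
    define n where "n = Suc (nat \<lceil>4 * K * \<bar>Cc\<bar>\<rceil>)"
    have n: "4 * K * \<bar>Cc\<bar> \<le> real n" unfolding n_def by linarith
    define ct where "ct j x = real j / real n * c x" for j x
    have n0: "real n > 0" by (simp add: n_def)
    have ctb: "AE x in M. 0 \<le> ct j x \<and> ct j x \<le> Cc" if "j \<le> n" for j
      using cb
    proof eventually_elim
      case (elim x)
      have "ct j x \<le> 1 * c x" unfolding ct_def using elim that n0 by (intro mult_right_mono) auto
      then show ?case using elim n0 by (simp add: ct_def)
    qed
    have ctc: "bounded_coeff (ct j)" if "j \<le> n" for j
    proof (rule bounded_coeffI[of _ Cc])
      show "ct j \<in> borel_measurable M"
        unfolding ct_def using bounded_coeff_measurable[OF c] by measurable
      show "AE x in M. \<bar>ct j x\<bar> \<le> Cc" using ctb[OF that] by eventually_elim simp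
    qed
    have ap: "a_priori b h (ct j) K" if "j \<le> n" for j
      by (rule apK[OF b h ctc[OF that] hb ctb[OF that]])
    have "solvable b h (ct j)" if "j \<le> n" for j
      using that
    proof (induction j)
      case 0
      show ?case unfolding solvable_def
      proof (intro ballI)
        fix r s assume r: "r \<in> L2 M" and s: "s \<in> L2 M"
        obtain v where v: "v \<in> HN" "AE x in M. Lop b v x = s x" using C[OF b s] by blast
        obtain w where w: "w \<in> HN" "AE x in M. Lop b w x = r x - h x * v x"
          using C[OF b L2_diff[OF r bounded_coeff_mult_L2[OF h HN_L2[OF v(1)]]]] by blast
        have "AE x in M. sys1 b h v w x = r x" using w(2) by eventually_elim (simp add: sys1_def)
        moreover have "AE x in M. sys2 b (ct 0) v w x = s x"
          using v(2) by eventually_elim (simp add: sys2_def ct_def)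
        ultimately show "\<exists>v\<in>HN. \<exists>w\<in>HN. (AE x in M. sys1 b h v w x = r x) \<and> (AE x in M. sys2 b (ct 0) v w x = s x)"
          using v w by blast
      qed
    next
      case (Suc j)
      then have j: "j \<le> n" "Suc j \<le> n" by auto
      have small: "L2_norm M (\<lambda>x. (ct (Suc j) x - ct j x) * v x) \<le> \<bar>Cc\<bar> / n * H2_norm D v" if v: "v \<in> HN" for v
      proof -
        have "L2_norm M (\<lambda>x. (ct (Suc j) x - ct j x) * v x) \<le> \<bar>Cc\<bar> / n * L2_norm M v"
        proof (rule L2_norm_mult_bounded[OF HN_L2[OF v]])
          show "(\<lambda>x. ct (Suc j) x - ct j x) \<in> borel_measurable M"
            using j by (intro borel_measurable_diff bounded_coeff_measurable ctc) auto
          show "AE x in M. \<bar>ct (Suc j) x - ct j x\<bar> \<le> \<bar>Cc\<bar> / real n"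
            using cb
          proof eventually_elim
            case (elim x)
            have "ct (Suc j) x - ct j x = c x / n" by (simp add: ct_def add_divide_distrib distrib_right)
            then show ?case using elim n0 by (simp add: divide_right_mono)
          qed
        qed simp
        also have "\<dots> \<le> \<bar>Cc\<bar> / n * H2_norm D v"
          by (intro mult_left_mono H2_norm_ge) simp
        finally show ?thesis .
      qed
      have zero: "L2_norm M (\<lambda>x. (k x - k x) * v x) \<le> \<bar>Cc\<bar> / n * H2_norm D v" for k v
        by simp
      have "4 * K * (\<bar>Cc\<bar> / n) \<le> 1" using n n0 by simp
      then show ?case
        using small_perturbation(2)[OF b' h ctc[OF j(1)] b' h ctc[OF j(2)] ap[OF j(1)] Suc.IH[OF j(1)] K _ _ zero zero small]
        by simp
    qed
    from this[of n] ap[of n] show "a_priori b h c K \<and> solvable b h c"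
      using n0 by (simp add: ct_def[abs_def])
  qed
qed

end

section \<open>Solvability under the spectral condition\<close>

text \<open>\<open>L\<^sup>2\<close> of a subset is treated as the subspace of functions that vanish outside of it.\<close>

lemma L2_restrict_space:
  assumes A: "A \<inter> space M \<in> sets M"
  shows "f \<in> L2 (restrict_space M A) \<longleftrightarrow> ext_zero A f \<in> L2 M"
    and "L2_inner (restrict_space M A) f g = L2_inner M (ext_zero A f) g"
    and "L2_norm (restrict_space M A) f = L2_norm M (ext_zero A f)"
proof -
  have e: "ext_zero A f = (\<lambda>x. indicator A x *\<^sub>R f x)" for f :: "'a \<Rightarrow> real"
    by (auto simp: ext_zero_def indicator_def)
  have sq: "(\<lambda>x. (indicator A x *\<^sub>R f x)\<^sup>2) = (\<lambda>x. indicator A x *\<^sub>R (f x)\<^sup>2)" for f :: "'a \<Rightarrow> real"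
    by (auto simp: indicator_def)
  show "f \<in> L2 (restrict_space M A) \<longleftrightarrow> ext_zero A f \<in> L2 M"
    unfolding L2_def e mem_Collect_eq borel_measurable_restrict_space_iff[OF A]
      integrable_restrict_space[OF A] sq ..
  show inner: "L2_inner (restrict_space M A) f g = L2_inner M (ext_zero A f) g" for f g
    unfolding L2_inner_def integral_restrict_space[OF A] e by (simp add: mult.assoc)
  have "(\<lambda>x. ext_zero A f x * ext_zero A f x) = (\<lambda>x. ext_zero A f x * f x)" by (auto simp: ext_zero_def)
  then show "L2_norm (restrict_space M A) f = L2_norm M (ext_zero A f)"
    unfolding L2_norm_def inner by (simp add: L2_inner_def)
qed

lemma ext_zero_L2:
  assumes A: "A \<inter> space M \<in> sets M" and f: "f \<in> L2 M"
  shows "ext_zero A f \<in> L2 M" "L2_norm M (ext_zero A f) \<le> L2_norm M f"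
proof -
  have "ext_zero A f = (\<lambda>x. indicator A x *\<^sub>R f x)" by (auto simp: ext_zero_def indicator_def)
  moreover have "f \<in> borel_measurable (restrict_space M A)"
    using L2_measurable[OF f] by (rule measurable_restrict_space1)
  ultimately have m: "ext_zero A f \<in> borel_measurable M"
    using borel_measurable_restrict_space_iff[OF A, of f] by simp
  show "ext_zero A f \<in> L2 M" "L2_norm M (ext_zero A f) \<le> L2_norm M f"
    by (rule L2_norm_mono[OF f m], simp add: ext_zero_def)+
qed

locale newton_setting = elliptic_domain D \<nu> S "u 1" + multibang \<alpha> \<gamma> d u
  for D :: "'a::euclidean_space set" and \<nu> S \<alpha> \<gamma> d and u :: "nat \<Rightarrow> real"
begin

text \<open>With \<open>q = - y w\<close> the operator \<open>B(y, w)\<close> is \<open>- \<Delta> + pot\<close>, because \<open>- \<chi> y w / \<gamma> = \<chi> q / \<gamma>\<close>; \<open>weight\<close> and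
  \<open>- damp\<close> are the diagonal entries of the Newton system.\<close>

definition pot :: "('a \<Rightarrow> real) \<Rightarrow> ('a \<Rightarrow> real) \<Rightarrow> 'a \<Rightarrow> real" where
  "pot y w x = H (- y x * w x) + mix (- y x * w x) * (- y x * w x) / \<gamma>"

abbreviation weight :: "('a \<Rightarrow> real) \<Rightarrow> ('a \<Rightarrow> real) \<Rightarrow> 'a \<Rightarrow> real" where
  "weight \<equiv> h_weight \<alpha> d u \<gamma>"

definition damp :: "('a \<Rightarrow> real) \<Rightarrow> ('a \<Rightarrow> real) \<Rightarrow> 'a \<Rightarrow> real" where
  "damp y w x = mix (- y x * w x) * (y x)\<^sup>2 / \<gamma>"

definition embedding_constant :: "real \<Rightarrow> bool" where
  "embedding_constant C \<longleftrightarrow> C \<ge> 0 \<and> (\<forall>v\<in>H2 D. AE x in M. \<bar>v x\<bar> \<le> C * H2_norm D v)"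

lemma B_op_eq: "B_op D \<alpha> d u \<gamma> y w v = Lop (pot y w) v"
  by (rule ext) (simp add: B_op_def Lop_def pot_def algebra_simps)

lemma mix_le_1: "mix q * t \<le> t" "0 \<le> mix q * t" if "t \<ge> 0"
  using that chi_bounds[of q] by (auto intro: mult_left_le_one_le)

lemma product_bound:
  fixes a b m :: real
  assumes "\<bar>a\<bar> \<le> m" "\<bar>b\<bar> \<le> m" shows "\<bar>- a * b\<bar> \<le> m\<^sup>2"
  using assms by (auto simp: abs_mult power2_eq_square intro!: mult_mono)

lemma square_bound: "\<bar>a\<bar> \<le> m \<Longrightarrow> a\<^sup>2 \<le> m\<^sup>2" for a m :: real
  by (simp add: abs_le_square_iff[symmetric])

text \<open>The lower bound is what makes elliptic regularity applicable at every \<open>(y, w)\<close>: \<open>H\<close> is at least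
  \<open>u\<^sub>1\<close> and \<open>\<chi> q\<close> is non-negative.\<close>

lemma pot_admissible:
  assumes [measurable]: "y \<in> borel_measurable M" "w \<in> borel_measurable M"
    and b: "AE x in M. \<bar>y x\<bar> \<le> m" "AE x in M. \<bar>w x\<bar> \<le> m"
  shows "admissible (u d + m\<^sup>2 / \<gamma>) (pot y w)"
  unfolding admissible_def
proof
  show "pot y w \<in> borel_measurable M" unfolding pot_def[abs_def] by measurable
  show "AE x in M. u 1 \<le> pot y w x \<and> pot y w x \<le> u d + m\<^sup>2 / \<gamma>"
    using b
  proof eventually_elim
    case (elim x)
    let ?q = "- y x * w x"
    have "0 \<le> mix ?q * ?q / \<gamma>" by (rule divide_nonneg_pos[OF chi_times_nonneg[OF \<mu>_pos] \<gamma>_pos])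
    moreover have "mix ?q * ?q / \<gamma> \<le> m\<^sup>2 / \<gamma>"
    proof (rule divide_right_mono)
      have "mix ?q * ?q \<le> mix ?q * \<bar>?q\<bar>" using chi_bounds by (intro mult_left_mono) auto
      also have "\<dots> \<le> \<bar>?q\<bar>" by (intro mix_le_1) simp
      finally show "mix ?q * ?q \<le> m\<^sup>2" using product_bound[OF elim] by linarith
    qed (use \<gamma>_pos in simp)
    ultimately show ?case
      using H_lower[of ?q] H_upper[of ?q] unfolding pot_def by linarith
  qed
qed

lemma weight_bounded:
  assumes [measurable]: "y \<in> borel_measurable M" "w \<in> borel_measurable M"
    and b: "AE x in M. \<bar>w x\<bar> \<le> m"
  shows "weight y w \<in> borel_measurable M" "AE x in M. 1 - m\<^sup>2 / \<gamma> \<le> weight y w x \<and> weight y w x \<le> 1"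
    "bounded_coeff (weight y w)"
proof -
  show m: "weight y w \<in> borel_measurable M" unfolding h_weight_def by measurable
  show 1: "AE x in M. 1 - m\<^sup>2 / \<gamma> \<le> weight y w x \<and> weight y w x \<le> 1"
    using b
  proof eventually_elim
    case (elim x)
    have "mix (- y x * w x) * (w x)\<^sup>2 \<le> m\<^sup>2" using mix_le_1(1)[of "(w x)\<^sup>2"] square_bound[OF elim] by (meson order.trans zero_le_power2)
    then have "mix (- y x * w x) * (w x)\<^sup>2 / \<gamma> \<le> m\<^sup>2 / \<gamma>" using \<gamma>_pos by (intro divide_right_mono) auto
    moreover have "0 \<le> mix (- y x * w x) * (w x)\<^sup>2 / \<gamma>" using \<gamma>_pos chi_bounds by simp
    ultimately show ?case by (simp add: h_weight_def)
  qed
  show "bounded_coeff (weight y w)"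
  proof (rule bounded_coeffI[OF m])
    show "AE x in M. \<bar>weight y w x\<bar> \<le> 1 + m\<^sup>2 / \<gamma>"
      using 1 by eventually_elim (use \<gamma>_pos zero_le_power2[of m] divide_nonneg_pos[of "m\<^sup>2" \<gamma>] in linarith)
  qed
qed

lemma damp_bounded:
  assumes [measurable]: "y \<in> borel_measurable M" "w \<in> borel_measurable M"
    and b: "AE x in M. \<bar>y x\<bar> \<le> m"
  shows "damp y w \<in> borel_measurable M" "AE x in M. 0 \<le> damp y w x \<and> damp y w x \<le> m\<^sup>2 / \<gamma>"
    "bounded_coeff (damp y w)"
proof -
  show m: "damp y w \<in> borel_measurable M" unfolding damp_def[abs_def] by measurable
  show 1: "AE x in M. 0 \<le> damp y w x \<and> damp y w x \<le> m\<^sup>2 / \<gamma>"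
    using b
  proof eventually_elim
    case (elim x)
    have "mix (- y x * w x) * (y x)\<^sup>2 \<le> m\<^sup>2" using mix_le_1(1)[of "(y x)\<^sup>2"] square_bound[OF elim] by (meson order.trans zero_le_power2)
    then show ?case using \<gamma>_pos chi_bounds by (simp add: damp_def divide_right_mono)
  qed
  show "bounded_coeff (damp y w)"
  proof (rule bounded_coeffI[OF m])
    show "AE x in M. \<bar>damp y w x\<bar> \<le> m\<^sup>2 / \<gamma>" using 1 by eventually_elim simp
  qed
qed

lemma embedding_constant_exists: obtains C where "embedding_constant C"
proof -
  obtain C where "C \<ge> 0" "\<And>v. v \<in> H2 D \<Longrightarrow> AE x in M. \<bar>v x\<bar> \<le> C * H2_norm D v"
    by (rule embedding_bound) blast
  then show thesis using that unfolding embedding_constant_def by blast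
qed

lemma HN_measurable: "y \<in> HN \<Longrightarrow> y \<in> borel_measurable M"
  by (intro L2_measurable HN_L2)

lemma HN_bounded:
  assumes "y \<in> HN" "w \<in> HN"
  obtains m where "m \<ge> 0" "AE x in M. \<bar>y x\<bar> \<le> m" "AE x in M. \<bar>w x\<bar> \<le> m"
proof -
  obtain C where C: "embedding_constant C" by (rule embedding_constant_exists)
  define m where "m = C * max (H2_norm D y) (H2_norm D w)"
  have le: "C * H2_norm D y \<le> m" "C * H2_norm D w \<le> m"
    using C by (simp_all add: m_def embedding_constant_def mult_left_mono)
  have AE: "AE x in M. \<bar>y x\<bar> \<le> C * H2_norm D y" "AE x in M. \<bar>w x\<bar> \<le> C * H2_norm D w"
    using C HN_H2[OF assms(1)] HN_H2[OF assms(2)] by (auto simp: embedding_constant_def)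
  show thesis
  proof (rule that)
    show "m \<ge> 0"
      using C by (auto simp: m_def embedding_constant_def le_max_iff_disj intro!: mult_nonneg_nonneg)
    show "AE x in M. \<bar>y x\<bar> \<le> m" using AE(1) by eventually_elim (use le(1) in linarith)
    show "AE x in M. \<bar>w x\<bar> \<le> m" using AE(2) by eventually_elim (use le(2) in linarith)
  qed
qed

lemma coefficients_bounded:
  assumes "y \<in> HN" "w \<in> HN"
  shows "bounded_coeff (pot y w)" "bounded_coeff (weight y w)" "bounded_coeff (damp y w)"
proof -
  note meas = assms[THEN HN_measurable]
  obtain m where m: "AE x in M. \<bar>y x\<bar> \<le> m" "AE x in M. \<bar>w x\<bar> \<le> m" using HN_bounded[OF assms] by metis
  show "bounded_coeff (pot y w)" by (rule admissible_bounded[OF pot_admissible[OF meas m]])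
  show "bounded_coeff (weight y w)" by (rule weight_bounded(3)[OF meas m(2)])
  show "bounded_coeff (damp y w)" by (rule damp_bounded(3)[OF meas m(1)])
qed

text \<open>With \<open>A = B\<^sup>-\<^sup>1\<close>, which is self-adjoint, one has \<open>T v = A (\<gamma>\<^sup>-\<^sup>1\<^sup>/\<^sup>2 y v)\<close> and \<open>T\<^sup>* g\<close> is the restriction of
  \<open>\<gamma>\<^sup>-\<^sup>1\<^sup>/\<^sup>2 y A g\<close>.  Eliminating \<open>\<delta>w = A (r - h \<delta>y)\<close> and \<open>\<delta>y = A t + T v\<close> from the linearised system with
  right-hand side \<open>(r, t)\<close> leaves the equation \<open>(I + K) v = T\<^sup>* (r - h A t)\<close> for the restriction
  \<open>v\<close> of \<open>\<gamma>\<^sup>-\<^sup>1\<^sup>/\<^sup>2 y \<delta>w\<close> to the mixed region, and this is what the spectral condition solves.\<close>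

lemma spectral_solvable:
  assumes y: "y \<in> HN" and w: "w \<in> HN"
    and spec: "-1 \<notin> L2_spectrum (lebesgue_on (omega_mixed D \<alpha> d u \<gamma> y w)) (K_op D \<nu> S \<alpha> d u \<gamma> y w)"
  shows "\<exists>K>0. a_priori (pot y w) (weight y w) (damp y w) K \<and> solvable (pot y w) (weight y w) (damp y w)"
proof -
  note [measurable] = HN_measurable[OF y] HN_measurable[OF w]
  obtain m where m0: "m \<ge> 0" and ym: "AE x in M. \<bar>y x\<bar> \<le> m" and wm: "AE x in M. \<bar>w x\<bar> \<le> m"
    by (rule HN_bounded[OF y w])
  define b where "b = pot y w"
  define h where "h = weight y w"
  define c where "c = damp y w"
  define mu where "mu = u d + m\<^sup>2 / \<gamma>"
  have adm: "admissible mu b" unfolding b_def mu_def by (rule pot_admissible[OF _ _ ym wm]) measurable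
  note bb = admissible_bounded[OF adm]
  have hb: "bounded_coeff h" and cb: "bounded_coeff c"
    unfolding h_def c_def by (intro coefficients_bounded y w)+
  obtain Ch where Ch: "Ch \<ge> 0" "AE x in M. \<bar>h x\<bar> \<le> Ch"
  proof -
    obtain Ch where "AE x in M. \<bar>h x\<bar> \<le> Ch" using hb by (auto simp: bounded_coeff_def)
    then have "AE x in M. \<bar>h x\<bar> \<le> max Ch 0" by eventually_elim simp
    then show thesis using that[of "max Ch 0"] by simp
  qed
  have "u 1 \<le> u d" using u_le[of 1 d] d_ge_2 by simp
  then have "u 1 \<le> mu" using \<gamma>_pos by (simp add: mu_def add_increasing2)
  from this obtain C where C: "C > 0"
    and ex: "\<And>g. g \<in> L2 M \<Longrightarrow> \<exists>v\<in>HN. AE x in M. Lop b v x = g x"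
    and bd: "\<And>v. v \<in> HN \<Longrightarrow> H2_norm D v \<le> C * L2_norm M (Lop b v)"
    by (rule uniform_solvability) (use adm in blast)
  define A where "A = B_inv D \<nu> S \<alpha> d u \<gamma> y w"
  have A: "A g \<in> HN" "AE x in M. Lop b (A g) x = g x" if "g \<in> L2 M" for g
  proof -
    have "\<exists>v. v \<in> HN \<and> ae_eq M (B_op D \<alpha> d u \<gamma> y w v) g"
      using ex[OF that] unfolding B_op_eq ae_eq_def b_def by blast
    from someI_ex[OF this] show "A g \<in> HN" "AE x in M. Lop b (A g) x = g x"
      unfolding A_def B_inv_def B_op_eq ae_eq_def b_def by auto
  qed
  have LHN: "Lop b v \<in> L2 M" if "v \<in> HN" for v by (rule Lop_L2[OF bb HN_H2[OF that]])
  have A_norm: "H2_norm D v \<le> C * L2_norm M g" if "v \<in> HN" "g \<in> L2 M" "AE x in M. Lop b v x = g x" for v g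
    using bd[OF that(1)] L2_norm_cong_AE[OF L2_measurable[OF LHN[OF that(1)]] L2_measurable[OF that(2)] that(3)] by simp
  have A_unique: "AE x in M. v x = A g x" if v: "v \<in> HN" and g: "g \<in> L2 M" and eq: "AE x in M. Lop b v x = g x" for v g
  proof -
    have d: "(\<lambda>x. v x - A g x) \<in> HN" by (intro HN_diff v A g)
    have "AE x in M. Lop b (\<lambda>x. v x - A g x) x = 0"
      using Lop_diff[OF HN_H2[OF v] HN_H2[OF A(1)[OF g]], of b] eq A(2)[OF g] by eventually_elim simp
    from A_norm[OF d L2_zero this] have "H2_norm D (\<lambda>x. v x - A g x) = 0"
      using H2_norm_nonneg[of "\<lambda>x. v x - A g x"] by simp
    from H2_norm_eq_0_AE[OF HN_H2[OF d] this] show ?thesis by eventually_elim simp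
  qed
  have A_symm: "L2_inner M (A f) g = L2_inner M f (A g)" if f: "f \<in> L2 M" and g: "g \<in> L2 M" for f g
  proof -
    have "L2_inner M (A f) g = L2_inner M (A f) (Lop b (A g))"
      unfolding L2_inner_commute[of M "A f"]
      by (rule L2_inner_cong_AE) (use A[OF f] A[OF g] g LHN in \<open>auto intro: L2_measurable HN_L2\<close>)
    also have "\<dots> = L2_inner M (A g) (Lop b (A f))" by (rule Lop_symmetric[OF bb A(1)[OF f] A(1)[OF g]])
    also have "\<dots> = L2_inner M f (A g)"
      unfolding L2_inner_commute[of M "A g"]
      by (rule L2_inner_cong_AE) (use A[OF f] A[OF g] f LHN in \<open>auto intro: L2_measurable HN_L2\<close>)
    finally show ?thesis .
  qed
  define \<omega> where "\<omega> = omega_mixed D \<alpha> d u \<gamma> y w"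
  define N where "N = lebesgue_on \<omega>"
  have \<omega>_eq: "\<omega> = {x \<in> space M. mix (- y x * w x) = 1}"
    by (simp add: \<omega>_def omega_mixed_eq space_restrict_space)
  have "\<omega> \<in> sets M" unfolding \<omega>_eq by measurable
  then have \<omega>s: "\<omega> \<inter> space M \<in> sets M" by auto
  have \<omega>D: "\<omega> \<subseteq> D" by (auto simp: \<omega>_eq space_restrict_space)
  have N: "N = restrict_space M \<omega>"
  proof -
    have "\<omega> \<inter> space lebesgue \<in> sets lebesgue"
      using \<open>\<omega> \<in> sets M\<close> by (simp add: sets_restrict_space_iff)
    then show ?thesis unfolding N_def
      using restrict_restrict_space[of D lebesgue \<omega>] \<omega>D by (simp add: Int_absorb1)
  qed
  note NL = L2_restrict_space[OF \<omega>s, folded N]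
  have AEN: "(AE x in N. P x) \<longleftrightarrow> (AE x in M. x \<in> \<omega> \<longrightarrow> P x)" for P
    unfolding N by (rule AE_restrict_space_iff[OF \<omega>s])
  define s where "s x = 1 / sqrt \<gamma> * y x" for x
  have sm [measurable]: "s \<in> borel_measurable M" unfolding s_def[abs_def] by measurable
  define ms where "ms = 1 / sqrt \<gamma> * m"
  have ms0: "ms \<ge> 0" using m0 \<gamma>_pos by (simp add: ms_def)
  have sb: "AE x in M. \<bar>s x\<bar> \<le> ms"
    using ym by eventually_elim (use \<gamma>_pos in \<open>simp add: s_def ms_def abs_mult divide_right_mono\<close>)
  have sc: "bounded_coeff s" by (rule bounded_coeffI[OF sm sb])
  have NL2: "f \<in> L2 N" if "f \<in> L2 M" for f using ext_zero_L2(1)[OF \<omega>s that] NL(1) by simp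
  define T where "T = T_op D \<nu> S \<alpha> d u \<gamma> y w"
  have T: "T v = A (\<lambda>x. s x * ext_zero \<omega> v x)" for v
    by (simp add: T_def T_op_def A_def s_def \<omega>_def)
  have svL: "(\<lambda>x. s x * ext_zero \<omega> v x) \<in> L2 M" if "v \<in> L2 N" for v
    using that NL(1) by (intro bounded_coeff_mult_L2[OF sc]) auto
  have TN: "T v \<in> HN" if "v \<in> L2 N" for v unfolding T by (intro A svL that)
  define Ts where "Ts g x = s x * A g x" for g x
  have TsL: "Ts g \<in> L2 M" if "g \<in> L2 M" for g
    unfolding Ts_def[abs_def] by (intro bounded_coeff_mult_L2[OF sc] HN_L2 A that)
  have adj: "L2_inner N v (Ts g) = L2_inner M (T v) g" if v: "v \<in> L2 N" and g: "g \<in> L2 M" for v g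
  proof -
    have "L2_inner N v (Ts g) = L2_inner M (\<lambda>x. s x * ext_zero \<omega> v x) (A g)"
      unfolding NL(2) by (simp add: L2_inner_def Ts_def mult_ac)
    also have "\<dots> = L2_inner M (T v) g" unfolding T by (rule A_symm[OF svL[OF v] g, symmetric])
    finally show ?thesis .
  qed
  define hT where "hT v x = h x * T v x" for v x
  have hTL: "hT v \<in> L2 M" if "v \<in> L2 N" for v
    unfolding hT_def[abs_def] by (intro bounded_coeff_mult_L2[OF hb] HN_L2 TN that)
  define Kop where "Kop = K_op D \<nu> S \<alpha> d u \<gamma> y w"
  \<comment> \<open>the adjoint is a chosen function; its defining property fixes it up to a null set\<close>
  have Kop: "AE x in N. Kop v x = Ts (hT v) x" if v: "v \<in> L2 N" for v
  proof -
    have K: "Kop v = L2_adjoint N M T (hT v)"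
      by (simp add: Kop_def K_op_def N_def \<omega>_def T_def hT_def[abs_def] h_def)
    have "\<exists>k. k \<in> L2 N \<and> (\<forall>v'\<in>L2 N. L2_inner N v' k = L2_inner M (T v') (hT v))"
      using adj[OF _ hTL[OF v]] NL2[OF TsL[OF hTL[OF v]]] by blast
    from someI_ex[OF this] have Kv: "Kop v \<in> L2 N" "\<And>v'. v' \<in> L2 N \<Longrightarrow> L2_inner N v' (Kop v) = L2_inner M (T v') (hT v)"
      unfolding K L2_adjoint_def by auto
    define e where "e x = Kop v x - Ts (hT v) x" for x
    have eL: "e \<in> L2 N" unfolding e_def[abs_def] by (intro L2_diff Kv NL2 TsL hTL v)
    have "L2_inner N e e = L2_inner N e (Kop v) - L2_inner N e (Ts (hT v))"
      using L2_inner_diff_right[OF Kv(1) NL2[OF TsL[OF hTL[OF v]]] eL] by (simp add: e_def[abs_def])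
    then have "L2_norm N e = 0" using Kv(2)[OF eL] adj[OF eL hTL[OF v]] by (simp add: L2_norm_def)
    then have "AE x in N. e x = 0" using L2_norm_eq_0_iff[OF eL] by simp
    then show ?thesis by eventually_elim (simp add: e_def)
  qed
  obtain CK where CK: "\<And>g. g \<in> L2 N \<Longrightarrow> \<exists>v\<in>L2 N. ae_eq N (\<lambda>x. Kop v x - (-1) * v x) g \<and>
      (\<forall>v'\<in>L2 N. ae_eq N (\<lambda>x. Kop v' x - (-1) * v' x) g \<longrightarrow> ae_eq N v' v) \<and> L2_norm N v \<le> CK * L2_norm N g"
    using spec unfolding L2_spectrum_def N_def[symmetric] \<omega>_def[symmetric] Kop_def[symmetric]
    by blast
  \<comment> \<open>\<open>\<chi> y\<^sup>2 / \<gamma> = s\<^sup>2\<close> on the mixed region and zero elsewhere\<close>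
  have c_eq: "c x = ext_zero \<omega> (\<lambda>x. s x * s x) x" if "x \<in> D" for x
  proof (cases "x \<in> \<omega>")
    case True
    then show ?thesis using \<gamma>_pos
      by (simp add: c_def damp_def \<omega>_eq ext_zero_def s_def power2_eq_square)
  next
    case False
    then have "mix (- y x * w x) = 0" using that
      by (auto simp: \<omega>_def omega_mixed_def chi_def indicator_def)
    then show ?thesis using False by (simp add: c_def damp_def ext_zero_def)
  qed
  have spM: "AE x in M. x \<in> D" by (rule AE_I2) (simp add: space_restrict_space)
  have solv: "solvable b h c"
    unfolding solvable_def
  proof (intro ballI)
    fix r t assume r: "r \<in> L2 M" and t: "t \<in> L2 M"
    define p where "p = A t"
    have p: "p \<in> HN" "AE x in M. Lop b p x = t x" unfolding p_def by (intro A t)+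
    define rh where "rh x = r x - h x * p x" for x
    have rhL: "rh \<in> L2 M" unfolding rh_def[abs_def] by (intro L2_diff bounded_coeff_mult_L2 hb HN_L2 r p)
    obtain v where v: "v \<in> L2 N" "AE x in N. Kop v x + v x = Ts rh x"
      using CK[OF NL2[OF TsL[OF rhL]]] unfolding ae_eq_def by auto
    define dy where "dy x = p x + T v x" for x
    have dy: "dy \<in> HN" unfolding dy_def[abs_def] by (intro HN_add p TN v)
    define rd where "rd x = r x - h x * dy x" for x
    have rdL: "rd \<in> L2 M" unfolding rd_def[abs_def] by (intro L2_diff bounded_coeff_mult_L2 hb HN_L2 r dy)
    define dw where "dw = A rd"
    have dw: "dw \<in> HN" "AE x in M. Lop b dw x = rd x" unfolding dw_def by (intro A rdL)+
    have Adec: "AE x in M. A rh x - A (hT v) x = dw x"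
      unfolding dw_def
    proof (rule A_unique[OF HN_diff[OF A(1)[OF rhL] A(1)[OF hTL[OF v(1)]]] rdL])
      show "AE x in M. Lop b (\<lambda>x. A rh x - A (hT v) x) x = rd x"
        using Lop_diff[OF HN_H2[OF A(1)[OF rhL]] HN_H2[OF A(1)[OF hTL[OF v(1)]]], of b] A(2)[OF rhL] A(2)[OF hTL[OF v(1)]]
        by eventually_elim (simp add: rd_def rh_def hT_def dy_def algebra_simps)
    qed
    have "AE x in M. sys1 b h dy dw x = r x"
      using dw(2) by eventually_elim (simp add: sys1_def rd_def)
    moreover have "AE x in M. sys2 b c dy dw x = t x"
    proof -
      have "AE x in M. x \<in> \<omega> \<longrightarrow> v x = s x * dw x"
        using v(2)[unfolded AEN] Kop[OF v(1), unfolded AEN] Adec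
        by eventually_elim (auto simp: Ts_def algebra_simps)
      moreover have "AE x in M. Lop b dy x = Lop b p x + Lop b (T v) x"
        using Lop_lincomb[OF HN_H2[OF p(1)] HN_H2[OF TN[OF v(1)]], of b 1] by (simp add: dy_def[abs_def])
      moreover have "AE x in M. Lop b (T v) x = s x * ext_zero \<omega> v x"
        unfolding T by (rule A[OF svL[OF v(1)]])
      ultimately show ?thesis using p(2) spM
        by eventually_elim (auto simp: sys2_def c_eq ext_zero_def)
    qed
    ultimately show "\<exists>v\<in>HN. \<exists>w\<in>HN. (AE x in M. sys1 b h v w x = r x) \<and> (AE x in M. sys2 b c v w x = t x)"
      using dy dw by blast
  qed
  \<comment> \<open>bounds, in terms of the right-hand side, for \<open>v\<close>, then \<open>\<delta>y\<close>, then \<open>\<delta>w\<close>\<close>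
  define K1 where "K1 = \<bar>CK\<bar> * (ms * (C * (1 + Ch * C)))"
  have K10: "K1 \<ge> 0" using ms0 C Ch by (simp add: K1_def)
  define Ky where "Ky = C * (1 + ms * K1)"
  define Kw where "Kw = C * (1 + Ch * Ky)"
  have Ky: "Ky > 0" using C ms0 K10 by (simp add: Ky_def add_pos_nonneg)
  have Kw: "Kw > 0" using C Ch Ky by (simp add: Kw_def add_pos_nonneg)
  have ap: "a_priori b h c (Ky + Kw)"
    unfolding a_priori_def
  proof (intro ballI)
    fix dy dw assume dy: "dy \<in> HN" and dw: "dw \<in> HN"
    define r where "r = sys1 b h dy dw"
    define t where "t = sys2 b c dy dw"
    define R where "R = L2_norm M r + L2_norm M t"
    have r: "r \<in> L2 M" and t: "t \<in> L2 M"
      unfolding r_def t_def by (intro sys1_L2 sys2_L2 bb hb cb dy dw)+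
    have rR: "L2_norm M r \<le> R" and tR: "L2_norm M t \<le> R" and R0: "R \<ge> 0" by (simp_all add: R_def)
    define p where "p = A t"
    have p: "p \<in> HN" "AE x in M. Lop b p x = t x" unfolding p_def by (intro A t)+
    define rh where "rh x = r x - h x * p x" for x
    have hpL: "(\<lambda>x. h x * p x) \<in> L2 M" by (intro bounded_coeff_mult_L2 hb HN_L2 p)
    have rhL: "rh \<in> L2 M" unfolding rh_def[abs_def] by (intro L2_diff[OF r hpL])
    define v where "v x = s x * dw x" for x
    have vM: "v \<in> L2 M" unfolding v_def[abs_def] by (intro bounded_coeff_mult_L2 sc HN_L2 dw)
    have v: "v \<in> L2 N" by (rule NL2[OF vM])
    have cdw: "AE x in M. c x * dw x = s x * ext_zero \<omega> v x"
      using spM by eventually_elim (simp add: c_eq ext_zero_def v_def)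
    have pT: "AE x in M. dy x - p x = T v x"
      unfolding T
    proof (rule A_unique[OF HN_diff[OF dy p(1)] svL[OF v]])
      show "AE x in M. Lop b (\<lambda>x. dy x - p x) x = s x * ext_zero \<omega> v x"
        using Lop_diff[OF HN_H2[OF dy] HN_H2[OF p(1)], of b] p(2) cdw
        by eventually_elim (simp add: t_def sys2_def)
    qed
    have dwA: "AE x in M. dw x + A (hT v) x = A rh x"
    proof (rule A_unique[OF HN_add[OF dw A(1)[OF hTL[OF v]]] rhL])
      show "AE x in M. Lop b (\<lambda>x. dw x + A (hT v) x) x = rh x"
        using Lop_lincomb[OF HN_H2[OF dw] HN_H2[OF A(1)[OF hTL[OF v]]], of b 1] A(2)[OF hTL[OF v]] pT
      proof eventually_elim
        case (elim x)
        have "h x * T v x = h x * dy x - h x * p x" by (simp add: elim(3)[symmetric] right_diff_distrib)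
        then show ?case using elim by (simp add: r_def sys1_def rh_def hT_def)
      qed
    qed
    have "AE x in N. Kop v x + v x = Ts rh x"
      using Kop[OF v] dwA unfolding AEN
    proof eventually_elim
      case (elim x)
      then have "s x * A rh x = s x * dw x + s x * A (hT v) x" by (simp add: elim(2)[symmetric] distrib_left)
      then show ?case using elim(1) by (simp add: Ts_def v_def)
    qed
    then have eqv: "ae_eq N (\<lambda>x. Kop v x - (-1) * v x) (Ts rh)" by (simp add: ae_eq_def)
    obtain v0 where v0: "v0 \<in> L2 N" "ae_eq N v v0" "L2_norm N v0 \<le> CK * L2_norm N (Ts rh)"
      using CK[OF NL2[OF TsL[OF rhL]]] v eqv by blast
    have C0: "C \<ge> 0" using C by simp
    have vle: "L2_norm N v \<le> K1 * R"
    proof -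
      have "L2_norm M (\<lambda>x. h x * p x) \<le> Ch * L2_norm M p"
        by (rule L2_norm_mult_bounded[OF HN_L2[OF p(1)] bounded_coeff_measurable[OF hb] Ch(2,1)])
      moreover have "L2_norm M p \<le> C * R"
        using H2_norm_ge(1)[of p] A_norm[OF p(1) t p(2)] mult_left_mono[OF tR C0] by linarith
      then have "Ch * L2_norm M p \<le> Ch * (C * R)" by (rule mult_left_mono[OF _ Ch(1)])
      ultimately have a4: "L2_norm M rh \<le> R + Ch * (C * R)"
        using L2_norm_triangle_diff[OF r hpL] rR unfolding rh_def[abs_def] by linarith
      have "L2_norm M (A rh) \<le> C * (R + Ch * (C * R))"
        using H2_norm_ge(1)[of "A rh"] A_norm[OF A(1)[OF rhL] rhL A(2)[OF rhL]] mult_left_mono[OF a4 C0] by linarith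
      from mult_left_mono[OF this ms0]
      have "L2_norm M (Ts rh) \<le> ms * (C * (R + Ch * (C * R)))"
        using L2_norm_mult_bounded[OF HN_L2[OF A(1)[OF rhL]] sm sb ms0] unfolding Ts_def[abs_def] by linarith
      then have a1: "L2_norm N (Ts rh) \<le> ms * (C * (R + Ch * (C * R)))"
        using ext_zero_L2(2)[OF \<omega>s TsL[OF rhL]] unfolding NL(3) by linarith
      have "L2_norm N v = L2_norm N v0"
        using v0(2) unfolding ae_eq_def by (intro L2_norm_cong_AE L2_measurable v v0)
      also have "\<dots> \<le> \<bar>CK\<bar> * L2_norm N (Ts rh)"
        using v0(3) by (rule order.trans) (intro mult_right_mono, auto)
      also have "\<dots> \<le> \<bar>CK\<bar> * (ms * (C * (R + Ch * (C * R))))"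
        by (rule mult_left_mono[OF a1]) simp
      also have "\<dots> = K1 * R" by (simp add: K1_def algebra_simps)
      finally show ?thesis .
    qed
    have Hy: "H2_norm D dy \<le> Ky * R"
    proof -
      have sL: "(\<lambda>x. s x * ext_zero \<omega> v x) \<in> L2 M" by (rule svL[OF v])
      have tsL: "(\<lambda>x. t x + s x * ext_zero \<omega> v x) \<in> L2 M" by (rule L2_add[OF t sL])
      have "L2_norm M (\<lambda>x. s x * ext_zero \<omega> v x) \<le> ms * L2_norm N v"
        unfolding NL(3) by (rule L2_norm_mult_bounded[OF _ sm sb ms0]) (use v NL(1) in auto)
      then have "L2_norm M (\<lambda>x. t x + s x * ext_zero \<omega> v x) \<le> R + ms * (K1 * R)"
        using L2_norm_triangle[OF t sL] tR mult_left_mono[OF vle ms0] by linarith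
      from mult_left_mono[OF this C0]
      have "C * L2_norm M (\<lambda>x. t x + s x * ext_zero \<omega> v x) \<le> Ky * R"
        by (simp add: Ky_def algebra_simps)
      moreover have "H2_norm D dy \<le> C * L2_norm M (\<lambda>x. t x + s x * ext_zero \<omega> v x)"
      proof (rule A_norm[OF dy tsL])
        show "AE x in M. Lop b dy x = t x + s x * ext_zero \<omega> v x"
          using cdw by eventually_elim (simp add: t_def sys2_def)
      qed
      ultimately show ?thesis by linarith
    qed
    have Hw: "H2_norm D dw \<le> Kw * R"
    proof -
      have hdL: "(\<lambda>x. h x * dy x) \<in> L2 M" by (intro bounded_coeff_mult_L2 hb HN_L2 dy)
      have "L2_norm M (\<lambda>x. h x * dy x) \<le> Ch * L2_norm M dy"
        by (rule L2_norm_mult_bounded[OF HN_L2[OF dy] bounded_coeff_measurable[OF hb] Ch(2,1)])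
      moreover have "L2_norm M dy \<le> Ky * R" using H2_norm_ge(1)[of dy] Hy by linarith
      then have "Ch * L2_norm M dy \<le> Ch * (Ky * R)" by (rule mult_left_mono[OF _ Ch(1)])
      ultimately have "L2_norm M (\<lambda>x. r x - h x * dy x) \<le> R + Ch * (Ky * R)"
        using L2_norm_triangle_diff[OF r hdL] rR by linarith
      from mult_left_mono[OF this C0]
      have "C * L2_norm M (\<lambda>x. r x - h x * dy x) \<le> Kw * R"
        by (simp add: Kw_def algebra_simps)
      moreover have "H2_norm D dw \<le> C * L2_norm M (\<lambda>x. r x - h x * dy x)"
        by (rule A_norm[OF dw L2_diff[OF r hdL]]) (simp add: r_def sys1_def)
      ultimately show ?thesis by linarith
    qed
    show "H2_norm D dy + H2_norm D dw \<le> (Ky + Kw) * (L2_norm M (sys1 b h dy dw) + L2_norm M (sys2 b c dy dw))"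
      using add_mono[OF Hy Hw] unfolding R_def r_def t_def by (simp only: distrib_right)
  qed
  show ?thesis
    using solv ap Ky Kw unfolding b_def h_def c_def by (intro exI[of _ "Ky + Kw"]) auto
qed

end

section \<open>Uniform solvability near the solution\<close>

context newton_setting
begin

definition uniformly_solvable_near :: "('a \<Rightarrow> real) \<Rightarrow> ('a \<Rightarrow> real) \<Rightarrow> bool" where
  "uniformly_solvable_near y' w' \<longleftrightarrow> (\<exists>K>0. \<exists>\<rho>>0. \<forall>y\<in>HN. \<forall>w\<in>HN.
     H2_norm D (\<lambda>x. y x - y' x) < \<rho> \<longrightarrow> H2_norm D (\<lambda>x. w x - w' x) < \<rho> \<longrightarrow>
       a_priori (pot y w) (weight y w) (damp y w) K \<and> solvable (pot y w) (weight y w) (damp y w))"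

lemma scale_below:
  fixes X \<eta> :: real
  assumes "X \<ge> 0" "\<eta> > 0" obtains k where "k > 0" "X * k \<le> \<eta>"
proof (rule that[of "\<eta> / (X + 1)"])
  show "\<eta> / (X + 1) > 0" using assms by simp
  show "X * (\<eta> / (X + 1)) \<le> \<eta>" using assms by (simp add: field_simps)
qed

lemma AE_close:
  assumes ce: "embedding_constant CE"
    and y: "y \<in> HN" "y' \<in> HN" and \<epsilon>: "H2_norm D (\<lambda>x. y x - y' x) \<le> r" "CE * r \<le> \<epsilon>"
  shows "AE x in M. \<bar>y x - y' x\<bar> \<le> \<epsilon>"
proof -
  have CE: "CE \<ge> 0" "AE x in M. \<bar>y x - y' x\<bar> \<le> CE * H2_norm D (\<lambda>x. y x - y' x)"
    using ce HN_H2[OF HN_diff[OF y]] by (auto simp: embedding_constant_def)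
  have "CE * H2_norm D (\<lambda>x. y x - y' x) \<le> \<epsilon>" using mult_left_mono[OF \<epsilon>(1) CE(1)] \<epsilon>(2) by linarith
  with CE(2) show ?thesis by (auto elim!: eventually_mono)
qed

text \<open>Near \<open>w'\<close> the weight stays above a positive constant, so the energy estimate applies at every
  nearby point separately.  The characteristic function may jump on a set of positive measure here,
  so the linearised operator need not depend continuously on the point.\<close>

lemma uniformly_solvable_small_dual:
  assumes y': "y' \<in> HN" and w': "w' \<in> HN" and small: "Linf_norm M w' < ereal (sqrt \<gamma>)"
  shows "uniformly_solvable_near y' w'"
proof -
  obtain CE where ce: "embedding_constant CE" by (rule embedding_constant_exists)
  then have CE: "CE \<ge> 0" "\<And>v. v \<in> H2 D \<Longrightarrow> AE x in M. \<bar>v x\<bar> \<le> CE * H2_norm D v"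
    by (auto simp: embedding_constant_def)
  obtain m where m: "AE x in M. \<bar>y' x\<bar> \<le> m" using HN_bounded[OF y' w'] by metis
  have sg: "sqrt \<gamma> > 0" using \<gamma>_pos by simp
  obtain r where r: "0 \<le> r" "r < sqrt \<gamma>" "AE x in M. \<bar>w' x\<bar> \<le> r"
  proof -
    have "max (Linf_norm M w') 0 < ereal (sqrt \<gamma>)" using small sg by simp
    then obtain r where r: "max (Linf_norm M w') 0 < ereal r" "ereal r < ereal (sqrt \<gamma>)"
      by (metis ereal_dense2)
    have "AE x in M. \<bar>w' x\<bar> \<le> r"
      using esssup_AE[of "\<lambda>x. ereal \<bar>w' x\<bar>" M]
    proof eventually_elim
      case (elim x)
      then have "ereal \<bar>w' x\<bar> \<le> ereal r"
        using r(1) by (simp only: Linf_norm_def[symmetric] max_less_iff_conj) (meson less_imp_le order.trans)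
      then show ?case by simp
    qed
    moreover have "0 \<le> r" using r(1) by (simp add: zero_ereal_def)
    ultimately show thesis using that[of r] r(2) by simp
  qed
  \<comment> \<open>half of the gap to \<open>sqrt \<gamma>\<close> is granted to the perturbation of \<open>w'\<close>\<close>
  define t where "t = (sqrt \<gamma> - r) / 2"
  have t: "t > 0" "r + t < sqrt \<gamma>" using r(2) by (simp_all add: t_def field_simps)
  obtain \<rho> where \<rho>: "\<rho> > 0" "CE * \<rho> \<le> t" by (rule scale_below[OF CE(1) t(1)])
  define \<kappa> where "\<kappa> = 1 - (r + t)\<^sup>2 / \<gamma>"
  have "(r + t)\<^sup>2 < (sqrt \<gamma>)\<^sup>2" using t r(1) by (intro power_strict_mono) auto
  then have \<kappa>: "\<kappa> > 0" using \<gamma>_pos by (simp add: \<kappa>_def)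
  define B where "B = max (r + t) (m + t)"
  define Cc where "Cc = B\<^sup>2 / \<gamma>"
  have "u 1 \<le> u d" using u_le[of 1 d] d_ge_2 by simp
  then have "u 1 \<le> u d + B\<^sup>2 / \<gamma>" using \<gamma>_pos by (simp add: add_increasing2)
  from energy_solvable[OF this \<kappa>, of Cc] obtain K where K: "K > 0"
    "\<And>b h c. admissible (u d + B\<^sup>2 / \<gamma>) b \<Longrightarrow> bounded_coeff h \<Longrightarrow> bounded_coeff c \<Longrightarrow>
      (AE x in M. \<kappa> \<le> h x \<and> h x \<le> 1) \<Longrightarrow> (AE x in M. 0 \<le> c x \<and> c x \<le> Cc) \<Longrightarrow> a_priori b h c K \<and> solvable b h c"
    by blast
  show ?thesis
    unfolding uniformly_solvable_near_def
  proof (rule exI[of _ K], rule conjI[OF K(1)], rule exI[of _ \<rho>], rule conjI[OF \<rho>(1)], intro ballI impI conjI)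
    fix y w assume y: "y \<in> HN" and w: "w \<in> HN"
      and cy: "H2_norm D (\<lambda>x. y x - y' x) < \<rho>" and cw: "H2_norm D (\<lambda>x. w x - w' x) < \<rho>"
    note ym = HN_measurable[OF y] and wm = HN_measurable[OF w]
    have wr: "AE x in M. \<bar>w x\<bar> \<le> r + t"
      using AE_close[OF ce w w' less_imp_le[OF cw] \<rho>(2)] r(3) by eventually_elim linarith
    then have wB: "AE x in M. \<bar>w x\<bar> \<le> B" by eventually_elim (simp add: B_def)
    have yB: "AE x in M. \<bar>y x\<bar> \<le> B"
      using AE_close[OF ce y y' less_imp_le[OF cy] \<rho>(2)] m by eventually_elim (simp add: B_def)
    show "a_priori (pot y w) (weight y w) (damp y w) K" "solvable (pot y w) (weight y w) (damp y w)"
      using K(2)[OF pot_admissible[OF ym wm yB wB] weight_bounded(3)[OF ym wm wr] damp_bounded(3)[OF ym wm yB]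
          weight_bounded(2)[OF ym wm wr, folded \<kappa>_def] damp_bounded(2)[OF ym wm yB, folded Cc_def]]
      by auto
  qed
qed

lemma product_difference:
  fixes a b a' b' m \<epsilon> :: real
  assumes "\<bar>a'\<bar> \<le> m" "\<bar>b'\<bar> \<le> m" "\<bar>a - a'\<bar> \<le> \<epsilon>" "\<bar>b - b'\<bar> \<le> \<epsilon>" "\<epsilon> \<le> 1"
  shows "\<bar>a * b - a' * b'\<bar> \<le> (2 * m + 1) * \<epsilon>"
proof -
  have e0: "0 \<le> \<epsilon>" "0 \<le> m" using assms by linarith+
  have "a * b - a' * b' = a' * (b - b') + b' * (a - a') + (a - a') * (b - b')" by (simp add: algebra_simps)
  then have "\<bar>a * b - a' * b'\<bar> \<le> \<bar>a' * (b - b')\<bar> + \<bar>b' * (a - a')\<bar> + \<bar>(a - a') * (b - b')\<bar>" by linarith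
  also have "\<dots> \<le> m * \<epsilon> + m * \<epsilon> + 1 * \<epsilon>"
    unfolding abs_mult using assms e0 by (intro add_mono mult_mono) auto
  finally show ?thesis by (simp add: algebra_simps)
qed

definition near_break :: "real \<Rightarrow> real \<Rightarrow> bool" where
  "near_break s q \<longleftrightarrow> (\<exists>p\<in>breakpoints. \<bar>q - p\<bar> \<le> s)"

lemma mix_term_difference:
  fixes t t' m \<epsilon> e :: real
  assumes \<chi>: "\<not> near_break s q' \<Longrightarrow> mix q = mix q'" and t: "\<bar>t - t'\<bar> \<le> e" "\<bar>t'\<bar> \<le> m"
  shows "\<bar>mix q * t / \<gamma> - mix q' * t' / \<gamma>\<bar> \<le> (e + m * (if near_break s q' then 1 else 0)) / \<gamma>"
proof -
  have "mix q * t - mix q' * t' = mix q * (t - t') + (mix q - mix q') * t'" by (simp add: algebra_simps)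
  then have "\<bar>mix q * t - mix q' * t'\<bar> \<le> \<bar>mix q * (t - t')\<bar> + \<bar>(mix q - mix q') * t'\<bar>" by linarith
  also have "\<dots> \<le> e + m * (if near_break s q' then 1 else 0)"
  proof (rule add_mono)
    have "\<bar>mix q * (t - t')\<bar> = mix q * \<bar>t - t'\<bar>" using chi_bounds by (simp add: abs_mult)
    then show "\<bar>mix q * (t - t')\<bar> \<le> e" using mix_le_1(1)[of "\<bar>t - t'\<bar>" q] t by simp
    have "\<bar>mix q - mix q'\<bar> \<le> 1" using chi_bounds[of q] chi_bounds[of q'] by linarith
    then have "\<bar>mix q - mix q'\<bar> * \<bar>t'\<bar> \<le> 1 * m" using t by (intro mult_mono) auto
    then show "\<bar>(mix q - mix q') * t'\<bar> \<le> m * (if near_break s q' then 1 else 0)"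
      using \<chi> by (auto simp: abs_mult)
  qed
  finally show ?thesis
    using \<gamma>_pos by (simp add: diff_divide_distrib[symmetric] abs_divide divide_right_mono)
qed

text \<open>Away from the break points the characteristic function does not change under a small
  perturbation, so the coefficients are Lipschitz there; near the break points they are bounded.\<close>

lemma coefficient_difference:
  fixes a b a' b' m \<epsilon> :: real
  assumes bnd: "\<bar>a'\<bar> \<le> m" "\<bar>b'\<bar> \<le> m" "\<bar>a - a'\<bar> \<le> \<epsilon>" "\<bar>b - b'\<bar> \<le> \<epsilon>" "\<epsilon> \<le> 1"
    and s: "(2 * m + 1) * \<epsilon> \<le> s"
  defines "C \<equiv> ((real d + 1) * (2 * m + 1) + m\<^sup>2) / \<gamma>" and "q \<equiv> - a * b" and "q' \<equiv> - a' * b'"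
  shows "\<bar>(H q + mix q * q / \<gamma>) - (H q' + mix q' * q' / \<gamma>)\<bar> \<le> C * ((if near_break s q' then 1 else 0) + \<epsilon>)"
    and "\<bar>mix q * a\<^sup>2 / \<gamma> - mix q' * a'\<^sup>2 / \<gamma>\<bar> \<le> C * ((if near_break s q' then 1 else 0) + \<epsilon>)"
    and "\<bar>mix q * b\<^sup>2 / \<gamma> - mix q' * b'\<^sup>2 / \<gamma>\<bar> \<le> C * ((if near_break s q' then 1 else 0) + \<epsilon>)"
proof -
  define k where "k = (if near_break s q' then 1 else (0::real))"
  have k0: "0 \<le> k" by (simp add: k_def)
  have e0: "0 \<le> \<epsilon>" "0 \<le> m" using bnd by linarith+
  have qq: "\<bar>q - q'\<bar> \<le> (2 * m + 1) * \<epsilon>"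
    using product_difference[OF bnd] by (simp add: q_def q'_def abs_minus_commute)
  have \<chi>: "mix q = mix q'" if "\<not> near_break s q'"
    using that qq s by (intro chi_eq_chi) (force simp: near_break_def)
  have q'm: "\<bar>q'\<bar> \<le> m\<^sup>2" unfolding q'_def by (rule product_bound[OF bnd(1,2)])
  have a: "\<bar>a\<^sup>2 - a'\<^sup>2\<bar> \<le> (2 * m + 1) * \<epsilon>"
    using product_difference[OF bnd(1,1,3,3,5)] by (simp add: power2_eq_square)
  have b: "\<bar>b\<^sup>2 - b'\<^sup>2\<bar> \<le> (2 * m + 1) * \<epsilon>"
    using product_difference[OF bnd(2,2,4,4,5)] by (simp add: power2_eq_square)
  have am: "\<bar>a'\<^sup>2\<bar> \<le> m\<^sup>2" and bm: "\<bar>b'\<^sup>2\<bar> \<le> m\<^sup>2" using square_bound bnd by simp_all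
  have C: "((2 * m + 1) * \<epsilon> + m\<^sup>2 * k) / \<gamma> \<le> C * (k + \<epsilon>)"
    and C': "real d / \<gamma> * ((2 * m + 1) * \<epsilon>) + ((2 * m + 1) * \<epsilon> + m\<^sup>2 * k) / \<gamma> \<le> C * (k + \<epsilon>)"
  proof -
    have "0 \<le> real d * (2 * m + 1) * \<epsilon>" "0 \<le> real d * (2 * m + 1) * k" "0 \<le> (2 * m + 1) * k" "0 \<le> m\<^sup>2 * \<epsilon>"
      using e0 k0 by auto
    then have "(2 * m + 1) * \<epsilon> + m\<^sup>2 * k \<le> ((real d + 1) * (2 * m + 1) + m\<^sup>2) * (k + \<epsilon>)"
      "real d * ((2 * m + 1) * \<epsilon>) + ((2 * m + 1) * \<epsilon> + m\<^sup>2 * k) \<le> ((real d + 1) * (2 * m + 1) + m\<^sup>2) * (k + \<epsilon>)"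
      by (simp_all add: algebra_simps)
    from this[THEN divide_right_mono, of \<gamma>]
    show "((2 * m + 1) * \<epsilon> + m\<^sup>2 * k) / \<gamma> \<le> C * (k + \<epsilon>)"
      "real d / \<gamma> * ((2 * m + 1) * \<epsilon>) + ((2 * m + 1) * \<epsilon> + m\<^sup>2 * k) / \<gamma> \<le> C * (k + \<epsilon>)"
      using \<gamma>_pos by (simp_all add: C_def flip: add_divide_distrib)
  qed
  have "\<bar>H q - H q'\<bar> \<le> real d / \<gamma> * \<bar>q - q'\<bar>" by (rule H_lipschitz)
  also have "\<dots> \<le> real d / \<gamma> * ((2 * m + 1) * \<epsilon>)"
    using qq \<gamma>_pos by (intro mult_left_mono) auto
  finally have HH: "\<bar>H q - H q'\<bar> \<le> real d / \<gamma> * ((2 * m + 1) * \<epsilon>)" .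
  show "\<bar>(H q + mix q * q / \<gamma>) - (H q' + mix q' * q' / \<gamma>)\<bar> \<le> C * ((if near_break s q' then 1 else 0) + \<epsilon>)"
    using HH mix_term_difference[where s = s, OF \<chi> qq q'm] C' unfolding k_def[symmetric] by linarith
  show "\<bar>mix q * a\<^sup>2 / \<gamma> - mix q' * a'\<^sup>2 / \<gamma>\<bar> \<le> C * ((if near_break s q' then 1 else 0) + \<epsilon>)"
    using mix_term_difference[where s = s, OF \<chi> a am] C unfolding k_def[symmetric] by linarith
  show "\<bar>mix q * b\<^sup>2 / \<gamma> - mix q' * b'\<^sup>2 / \<gamma>\<bar> \<le> C * ((if near_break s q' then 1 else 0) + \<epsilon>)"
    using mix_term_difference[where s = s, OF \<chi> b bm] C unfolding k_def[symmetric] by linarith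
qed

text \<open>Here \<open>\<epsilon>\<close> bounds the perturbation of \<open>y\<close> and \<open>w\<close> in the supremum norm; the product \<open>y w\<close> then moves
  by at most \<open>(2 m + 1) \<epsilon>\<close>, so the remainder of \<open>H\<close> can be non-zero on \<open>A\<close> only, and the
  characteristic function can change on \<open>A\<close> and at the break points only.\<close>

lemma near_break_set:
  assumes q: "q \<in> borel_measurable M" and m: "m \<ge> 0" and \<eta>: "\<eta> > 0"
  obtains s \<epsilon> A where "0 < \<epsilon>" "\<epsilon> \<le> 1" "(2 * m + 1) * \<epsilon> \<le> s" "A \<in> sets M"
    "A = {x \<in> space M. \<exists>p\<in>breakpoints. 0 < \<bar>q x - p\<bar> \<and> \<bar>q x - p\<bar> \<le> s}"
    "sqrt (measure M A) + \<epsilon> * sqrt (measure M (space M)) \<le> \<eta>"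
proof -
  interpret fm: finite_measure M by (rule finite_measure_M)
  have "(\<eta> / 2)\<^sup>2 > 0" using \<eta> by simp
  from fm.punctured_nbhd_small[OF q finite_breakpoints this] obtain s where s: "s > 0"
    and sA: "measure M {x \<in> space M. \<exists>p\<in>breakpoints. 0 < \<bar>q x - p\<bar> \<and> \<bar>q x - p\<bar> \<le> s} < (\<eta> / 2)\<^sup>2" by blast
  define A where "A = {x \<in> space M. \<exists>p\<in>breakpoints. 0 < \<bar>q x - p\<bar> \<and> \<bar>q x - p\<bar> \<le> s}"
  have "sqrt (measure M A) \<le> sqrt ((\<eta> / 2)\<^sup>2)" using sA by (intro real_sqrt_le_mono) (simp add: A_def)
  then have A\<eta>: "sqrt (measure M A) \<le> \<eta> / 2" using \<eta> by simp
  obtain k1 where k1: "k1 > 0" "(2 * m + 1) * k1 \<le> s" using scale_below[of "2 * m + 1" s] m s by auto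
  obtain k2 where k2: "k2 > 0" "sqrt (measure M (space M)) * k2 \<le> \<eta> / 2"
    using scale_below[of "sqrt (measure M (space M))" "\<eta> / 2"] \<eta> by auto
  define \<epsilon> where "\<epsilon> = min 1 (min k1 k2)"
  have "(2 * m + 1) * \<epsilon> \<le> (2 * m + 1) * k1" using m by (intro mult_left_mono) (auto simp: \<epsilon>_def)
  moreover have "\<epsilon> * sqrt (measure M (space M)) \<le> k2 * sqrt (measure M (space M))"
    by (intro mult_right_mono) (auto simp: \<epsilon>_def)
  ultimately show thesis
    using A\<eta> k1 k2 sets_punctured_nbhd[OF q finite_breakpoints, of s]
    by (intro that[of \<epsilon> s A]) (auto simp: A_def \<epsilon>_def mult.commute)
qed

text \<open>If the break points are attained on a null set only, the linearised operator depends continuously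
  on the point, and its invertibility extends from the solution to a neighbourhood.\<close>

lemma uniformly_solvable_spectral:
  assumes y': "y' \<in> HN" and w': "w' \<in> HN"
    and spec: "-1 \<notin> L2_spectrum (lebesgue_on (omega_mixed D \<alpha> d u \<gamma> y' w')) (K_op D \<nu> S \<alpha> d u \<gamma> y' w')"
    and null: "omega_boundary D \<alpha> d u \<gamma> y' w' \<in> null_sets lebesgue"
  shows "uniformly_solvable_near y' w'"
proof -
  interpret fm: finite_measure M by (rule finite_measure_M)
  obtain CE where ce: "embedding_constant CE" by (rule embedding_constant_exists)
  then have CE: "CE \<ge> 0" "\<And>v. v \<in> H2 D \<Longrightarrow> AE x in M. \<bar>v x\<bar> \<le> CE * H2_norm D v"
    by (auto simp: embedding_constant_def)
  obtain K where K: "K > 0" and ap: "a_priori (pot y' w') (weight y' w') (damp y' w') K"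
    and solv: "solvable (pot y' w') (weight y' w') (damp y' w')"
    using spectral_solvable[OF y' w' spec] by blast
  obtain m where m0: "m \<ge> 0" and y'm: "AE x in M. \<bar>y' x\<bar> \<le> m" and w'm: "AE x in M. \<bar>w' x\<bar> \<le> m"
    by (rule HN_bounded[OF y' w'])
  note [measurable] = HN_measurable[OF y'] HN_measurable[OF w']
  define q' where "q' x = - y' x * w' x" for x
  have q'_m [measurable]: "q' \<in> borel_measurable M" unfolding q'_def[abs_def] by measurable
  define C where "C = ((real d + 1) * (2 * m + 1) + m\<^sup>2) / \<gamma>"
  have C0: "C \<ge> 0" using m0 \<gamma>_pos by (simp add: C_def)
  define \<delta> where "\<delta> = 1 / (4 * K)"
  have \<delta>: "\<delta> > 0" using K by (simp add: \<delta>_def)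
  have "CE * C \<ge> 0" using CE C0 by simp
  from scale_below[OF this \<delta>] obtain \<eta> where \<eta>: "\<eta> > 0" "CE * C * \<eta> \<le> \<delta>" by metis
  obtain s \<epsilon> A where \<epsilon>: "0 < \<epsilon>" "\<epsilon> \<le> 1" and \<epsilon>s: "(2 * m + 1) * \<epsilon> \<le> s" and Am: "A \<in> sets M"
    and A_def: "A = {x \<in> space M. \<exists>p\<in>breakpoints. 0 < \<bar>q' x - p\<bar> \<and> \<bar>q' x - p\<bar> \<le> s}"
    and A\<eta>: "sqrt (measure M A) + \<epsilon> * sqrt (measure M (space M)) \<le> \<eta>"
    by (rule near_break_set[OF q'_m m0 \<eta>(1)])
  have null': "AE x in M. q' x \<notin> breakpoints"
  proof -
    have "AE x in lebesgue. x \<notin> omega_boundary D \<alpha> d u \<gamma> y' w'" using null by (rule AE_not_in)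
    then have "AE x in lebesgue. x \<in> D \<longrightarrow> q' x \<notin> breakpoints"
      by eventually_elim (simp add: omega_boundary_eq q'_def)
    then show ?thesis by (simp add: AE_restrict_space_iff)
  qed
  obtain \<rho> where \<rho>: "\<rho> > 0" "CE * \<rho> \<le> \<epsilon>" by (rule scale_below[OF CE(1) \<epsilon>(1)])
  have K2: "2 * K > 0" using K by simp
  show ?thesis
    unfolding uniformly_solvable_near_def
  proof (rule exI[of _ "2 * K"], rule conjI[OF K2], rule exI[of _ \<rho>], rule conjI[OF \<rho>(1)], intro ballI impI conjI)
    fix y w assume y: "y \<in> HN" and w: "w \<in> HN"
      and cy: "H2_norm D (\<lambda>x. y x - y' x) < \<rho>" and cw: "H2_norm D (\<lambda>x. w x - w' x) < \<rho>"
    note dy = AE_close[OF ce y y' less_imp_le[OF cy] \<rho>(2)] and dw = AE_close[OF ce w w' less_imp_le[OF cw] \<rho>(2)]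
    have ind: "AE x in M. (if near_break s (q' x) then 1 else 0) \<le> (indicator A x :: real)"
      using null' AE_space by eventually_elim (auto simp: near_break_def A_def indicator_def)
    have bound: "AE x in M. \<bar>k x\<bar> \<le> C * (indicator A x + \<epsilon>)"
      if "AE x in M. \<bar>k x\<bar> \<le> C * ((if near_break s (q' x) then 1 else 0) + \<epsilon>)" for k
      using that ind
    proof eventually_elim
      case (elim x)
      have "C * ((if near_break s (q' x) then 1 else 0) + \<epsilon>) \<le> C * (indicator A x + \<epsilon>)"
        using elim(2) C0 by (intro mult_left_mono) auto
      then show ?case using elim(1) by linarith
    qed
    have est: "L2_norm M (\<lambda>x. k x * v x) \<le> \<delta> * H2_norm D v"
      if km: "k \<in> borel_measurable M" and kb: "AE x in M. \<bar>k x\<bar> \<le> C * ((if near_break s (q' x) then 1 else 0) + \<epsilon>)"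
        and v: "v \<in> HN" for k v
    proof -
      note * = L2_norm_indicator_bound[OF finite_measure_M km Am bound[OF kb] C0 less_imp_le[OF \<epsilon>(1)]]
      have kn: "L2_norm M k \<le> C * \<eta>" using *(2) mult_left_mono[OF A\<eta> C0] by linarith
      have "L2_norm M (\<lambda>x. v x * k x) \<le> CE * H2_norm D v * L2_norm M k"
        using CE(1) by (intro L2_norm_mult_bounded[OF *(1) HN_measurable[OF v] CE(2)[OF HN_H2[OF v]]]) simp
      also have "\<dots> \<le> CE * H2_norm D v * (C * \<eta>)"
        using kn CE(1) by (intro mult_left_mono) auto
      also have "\<dots> = CE * C * \<eta> * H2_norm D v" by simp
      also have "\<dots> \<le> \<delta> * H2_norm D v" by (rule mult_right_mono[OF \<eta>(2)]) simp
      finally show ?thesis by (simp add: mult.commute)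
    qed
    note coef = coefficient_difference[OF _ _ _ _ \<epsilon>(2) \<epsilon>s, folded C_def]
    note bc = coefficients_bounded[OF y' w'] coefficients_bounded[OF y w]
    have pd: "AE x in M. \<bar>pot y w x - pot y' w' x\<bar> \<le> C * ((if near_break s (q' x) then 1 else 0) + \<epsilon>)"
      using y'm w'm dy dw by eventually_elim (auto simp only: pot_def q'_def intro!: coef(1))
    have hd: "AE x in M. \<bar>weight y w x - weight y' w' x\<bar> \<le> C * ((if near_break s (q' x) then 1 else 0) + \<epsilon>)"
      using y'm w'm dy dw
    proof eventually_elim
      case (elim x)
      have "\<bar>weight y w x - weight y' w' x\<bar> = \<bar>mix (- y x * w x) * (w x)\<^sup>2 / \<gamma> - mix (- y' x * w' x) * (w' x)\<^sup>2 / \<gamma>\<bar>"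
        by (simp add: h_weight_def abs_minus_commute)
      then show ?case using coef(3)[OF elim] by (simp only: q'_def)
    qed
    have cd: "AE x in M. \<bar>damp y w x - damp y' w' x\<bar> \<le> C * ((if near_break s (q' x) then 1 else 0) + \<epsilon>)"
      using y'm w'm dy dw by eventually_elim (auto simp only: damp_def q'_def intro!: coef(2))
    have K4: "4 * K * \<delta> \<le> 1" using K by (simp add: \<delta>_def)
    note pert = small_perturbation[OF bc ap solv K less_imp_le[OF \<delta>] K4
        est[OF borel_measurable_diff[OF bc(4)[THEN bounded_coeff_measurable] bc(1)[THEN bounded_coeff_measurable]] pd]
        est[OF borel_measurable_diff[OF bc(5)[THEN bounded_coeff_measurable] bc(2)[THEN bounded_coeff_measurable]] hd]
        est[OF borel_measurable_diff[OF bc(6)[THEN bounded_coeff_measurable] bc(3)[THEN bounded_coeff_measurable]] cd]]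
    show "a_priori (pot y w) (weight y w) (damp y w) (2 * K)" by (rule pert(1))
    show "solvable (pot y w) (weight y w) (damp y w)" by (rule pert(2))
  qed
qed

section \<open>Convergence of the semismooth Newton method\<close>

lemma newton_update_iff:
  "newton_update D \<nu> S \<alpha> d u \<gamma> f z y w \<delta>y \<delta>w \<longleftrightarrow> \<delta>y \<in> HN \<and> \<delta>w \<in> HN \<and>
     (AE x in M. sys1 (pot y w) (weight y w) \<delta>y \<delta>w x = - residual1 D \<alpha> d u \<gamma> z y w x) \<and>
     (AE x in M. sys2 (pot y w) (damp y w) \<delta>y \<delta>w x = - residual2 D \<alpha> d u \<gamma> f y w x)"
  unfolding newton_update_def ae_eq_def B_op_eq sys1_def sys2_def damp_def h_weight_def
  by simp

text \<open>The linearisation error of the first equation at the point \<open>(a, b)\<close>, seen from \<open>(a', b')\<close>; the one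
  of the second equation arises by exchanging the roles of \<open>a\<close> and \<open>b\<close>.\<close>

definition defect :: "real \<Rightarrow> real \<Rightarrow> real \<Rightarrow> real \<Rightarrow> real" where
  "defect a b a' b' = - mix (- a * b) * b\<^sup>2 / \<gamma> * (a - a')
     + (H (- a * b) + mix (- a * b) * (- a * b) / \<gamma>) * (b - b') - H (- a * b) * b + H (- a' * b') * b'"

text \<open>Both slope terms combine because \<open>b (a - a') + a (b - b') = - (q - q') + (a - a') (b - b')\<close>: what
  remains is the remainder of \<open>H\<close> and two products of differences.\<close>

lemma defect_eq:
  fixes a b a' b' :: real
  defines "q \<equiv> - a * b" and "q' \<equiv> - a' * b'"
  shows "defect a b a' b' = - (b' * remainder q q') + mix q / \<gamma> * (b - b') * (q - q')
    - mix q / \<gamma> * b * ((a - a') * (b - b'))"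
  using \<gamma>_pos unfolding defect_def remainder_def q_def q'_def
  by (simp add: field_simps power2_eq_square)

lemma defect_bound:
  fixes a b a' b' m \<epsilon> :: real
  assumes bnd: "\<bar>a'\<bar> \<le> m" "\<bar>b'\<bar> \<le> m" "\<bar>a - a'\<bar> \<le> \<epsilon>" "\<bar>b - b'\<bar> \<le> \<epsilon>" "\<epsilon> \<le> 1"
    and s: "(2 * m + 1) * \<epsilon> \<le> s"
  defines "C \<equiv> (2 * real d * m * (2 * m + 1) + (2 * m + 1) + (m + 1)) / \<gamma>"
  shows "\<bar>defect a b a' b'\<bar> \<le> C * \<epsilon> * ((if \<exists>p\<in>breakpoints. 0 < \<bar>- a' * b' - p\<bar> \<and> \<bar>- a' * b' - p\<bar> \<le> s then 1 else 0) + \<epsilon>)"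
proof -
  define q where "q = - a * b"
  define q' where "q' = - a' * b'"
  define k where "k = (if \<exists>p\<in>breakpoints. 0 < \<bar>q' - p\<bar> \<and> \<bar>q' - p\<bar> \<le> s then 1 else (0::real))"
  have k0: "0 \<le> k" by (simp add: k_def)
  have e0: "0 \<le> \<epsilon>" "0 \<le> m" using bnd by linarith+
  have qq: "\<bar>q - q'\<bar> \<le> (2 * m + 1) * \<epsilon>"
    using product_difference[OF bnd] by (simp add: q_def q'_def abs_minus_commute)
  have rem: "\<bar>remainder q q'\<bar> \<le> 2 * real d / \<gamma> * ((2 * m + 1) * \<epsilon>) * k"
  proof (cases "k = 0")
    case True
    then have k: "\<not> (\<exists>p\<in>breakpoints. 0 < \<bar>q' - p\<bar> \<and> \<bar>q' - p\<bar> \<le> s)" by (simp add: k_def split: if_splits)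
    have "remainder q q' = 0"
      using k qq s by (intro remainder_eq_0) force
    then show ?thesis using True by simp
  next
    case False
    then have "k = 1" by (simp add: k_def split: if_splits)
    moreover have "2 * real d / \<gamma> * \<bar>q - q'\<bar> \<le> 2 * real d / \<gamma> * ((2 * m + 1) * \<epsilon>)"
      using qq \<gamma>_pos by (intro mult_left_mono) auto
    ultimately show ?thesis using remainder_le[of q q'] by simp
  qed
  have \<chi>: "\<bar>mix q / \<gamma>\<bar> \<le> 1 / \<gamma>" using chi_bounds[of q] \<gamma>_pos by (simp add: divide_right_mono)
  have bm: "\<bar>b\<bar> \<le> m + 1" using bnd by linarith
  have "\<bar>b' * remainder q q'\<bar> \<le> m * (2 * real d / \<gamma> * ((2 * m + 1) * \<epsilon>) * k)"
    unfolding abs_mult using bnd rem e0 by (intro mult_mono) auto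
  moreover have "\<bar>mix q / \<gamma> * (b - b') * (q - q')\<bar> \<le> 1 / \<gamma> * \<epsilon> * ((2 * m + 1) * \<epsilon>)"
    unfolding abs_mult using bnd \<chi> qq \<gamma>_pos e0 by (intro mult_mono) auto
  moreover have "\<bar>mix q / \<gamma> * b * ((a - a') * (b - b'))\<bar> \<le> 1 / \<gamma> * (m + 1) * (\<epsilon> * \<epsilon>)"
    unfolding abs_mult using bnd \<chi> bm \<gamma>_pos e0 by (intro mult_mono) auto
  ultimately have "\<bar>defect a b a' b'\<bar> \<le> m * (2 * real d / \<gamma> * ((2 * m + 1) * \<epsilon>) * k)
      + 1 / \<gamma> * \<epsilon> * ((2 * m + 1) * \<epsilon>) + 1 / \<gamma> * (m + 1) * (\<epsilon> * \<epsilon>)"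
    unfolding defect_eq[of a b a' b', folded q_def q'_def] by linarith
  also have "\<dots> = \<epsilon> * (2 * real d * m * (2 * m + 1) * k + ((2 * m + 1) + (m + 1)) * \<epsilon>) / \<gamma>"
    using \<gamma>_pos by (simp add: field_simps)
  also have "\<dots> \<le> \<epsilon> * ((2 * real d * m * (2 * m + 1) + (2 * m + 1) + (m + 1)) * (k + \<epsilon>)) / \<gamma>"
  proof (intro divide_right_mono mult_left_mono)
    have "0 \<le> 2 * real d * m * (2 * m + 1) * \<epsilon>" "0 \<le> ((2 * m + 1) + (m + 1)) * k" using e0 k0 by auto
    then show "2 * real d * m * (2 * m + 1) * k + ((2 * m + 1) + (m + 1)) * \<epsilon>
        \<le> (2 * real d * m * (2 * m + 1) + (2 * m + 1) + (m + 1)) * (k + \<epsilon>)"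
      by (simp add: algebra_simps)
  qed (use e0 \<gamma>_pos in auto)
  also have "\<dots> = C * \<epsilon> * (k + \<epsilon>)" by (simp add: C_def)
  finally show ?thesis by (simp add: k_def q'_def)
qed

definition optimality_system :: "('a \<Rightarrow> real) \<Rightarrow> ('a \<Rightarrow> real) \<Rightarrow> ('a \<Rightarrow> real) \<Rightarrow> ('a \<Rightarrow> real) \<Rightarrow> bool" where
  "optimality_system f z y w \<longleftrightarrow> y \<in> HN \<and> w \<in> HN \<and>
     (AE x in M. residual1 D \<alpha> d u \<gamma> z y w x = 0) \<and> (AE x in M. residual2 D \<alpha> d u \<gamma> f y w x = 0)"

text \<open>The Newton step is exact for the linearisation, so the new error solves the linearised system
  with the linearisation error as right-hand side.\<close>

lemma newton_error_equation:
  assumes opt: "optimality_system f z y' w'" and y: "y \<in> HN" and w: "w \<in> HN"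
    and upd: "newton_update D \<nu> S \<alpha> d u \<gamma> f z y w \<delta>y \<delta>w"
  defines "ey \<equiv> \<lambda>x. y x + \<delta>y x - y' x" and "ew \<equiv> \<lambda>x. w x + \<delta>w x - w' x"
  shows "ey \<in> HN" "ew \<in> HN"
    and "AE x in M. sys1 (pot y w) (weight y w) ey ew x = defect (y x) (w x) (y' x) (w' x)"
    and "AE x in M. sys2 (pot y w) (damp y w) ey ew x = defect (w x) (y x) (w' x) (y' x)"
proof -
  have y': "y' \<in> HN" and w': "w' \<in> HN" using opt by (auto simp: optimality_system_def)
  have \<delta>: "\<delta>y \<in> HN" "\<delta>w \<in> HN" using upd by (auto simp: newton_update_iff)
  have dy: "(\<lambda>x. y x - y' x) \<in> HN" and dw: "(\<lambda>x. w x - w' x) \<in> HN" by (intro HN_diff y y' w w')+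
  have ey: "ey = (\<lambda>x. (y x - y' x) + 1 * \<delta>y x)" and ew: "ew = (\<lambda>x. (w x - w' x) + 1 * \<delta>w x)"
    by (auto simp: ey_def ew_def)
  show "ey \<in> HN" "ew \<in> HN" unfolding ey ew by (intro HN_lincomb dy dw \<delta>)+
  have Ly: "AE x in M. Lop b (\<lambda>x. y x - y' x) x = Lop b y x - Lop b y' x"
    and Lw: "AE x in M. Lop b (\<lambda>x. w x - w' x) x = Lop b w x - Lop b w' x" for b
    by (intro Lop_diff HN_H2 y y' w w')+
  have r1: "AE x in M. residual1 D \<alpha> d u \<gamma> z y' w' x = 0" and r2: "AE x in M. residual2 D \<alpha> d u \<gamma> f y' w' x = 0"
    using opt by (auto simp: optimality_system_def)
  have u1: "AE x in M. sys1 (pot y w) (weight y w) \<delta>y \<delta>w x = - residual1 D \<alpha> d u \<gamma> z y w x"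
    and u2: "AE x in M. sys2 (pot y w) (damp y w) \<delta>y \<delta>w x = - residual2 D \<alpha> d u \<gamma> f y w x"
    using upd by (auto simp: newton_update_iff)
  show "AE x in M. sys1 (pot y w) (weight y w) ey ew x = defect (y x) (w x) (y' x) (w' x)"
    using sys1_lincomb[OF dy dw \<delta>, of "pot y w" "weight y w" 1, folded ey ew] Lw[of "pot y w"] u1 r1
  proof eventually_elim
    case (elim x)
    have "sys1 (pot y w) (weight y w) ey ew x = weight y w x * (y x - y' x) + (Lop (pot y w) w x - Lop (pot y w) w' x)
        - residual1 D \<alpha> d u \<gamma> z y w x + residual1 D \<alpha> d u \<gamma> z y' w' x"
      using elim by (simp add: sys1_def)
    also have "\<dots> = defect (y x) (w x) (y' x) (w' x)"
      by (simp add: Lop_def residual1_def h_weight_def pot_def defect_def algebra_simps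
          diff_divide_distrib add_divide_distrib)
    finally show ?case .
  qed
  have comm: "- w x * y x = - y x * w x" "- w' x * y' x = - y' x * w' x" for x by simp_all
  show "AE x in M. sys2 (pot y w) (damp y w) ey ew x = defect (w x) (y x) (w' x) (y' x)"
    using sys2_lincomb[OF dy dw \<delta>, of "pot y w" "damp y w" 1, folded ey ew] Ly[of "pot y w"] u2 r2
  proof eventually_elim
    case (elim x)
    have "sys2 (pot y w) (damp y w) ey ew x = (Lop (pot y w) y x - Lop (pot y w) y' x) - damp y w x * (w x - w' x)
        - residual2 D \<alpha> d u \<gamma> f y w x + residual2 D \<alpha> d u \<gamma> f y' w' x"
      using elim by (simp add: sys2_def)
    also have "\<dots> = defect (w x) (y x) (w' x) (y' x)"
      unfolding defect_def comm
      by (simp add: Lop_def residual2_def damp_def pot_def algebra_simps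
          diff_divide_distrib add_divide_distrib)
    finally show ?case .
  qed
qed

lemma H2_pair_dist_ge:
  "H2_norm D (\<lambda>x. fst p x - fst q x) \<le> H2_pair_dist D p q"
  "H2_norm D (\<lambda>x. snd p x - snd q x) \<le> H2_pair_dist D p q"
  unfolding H2_pair_dist_def by (rule real_le_rsqrt, simp)+

lemma H2_pair_dist_le:
  "H2_pair_dist D p q \<le> H2_norm D (\<lambda>x. fst p x - fst q x) + H2_norm D (\<lambda>x. snd p x - snd q x)"
  unfolding H2_pair_dist_def by (rule sqrt_sum_squares_le_sum) simp_all

text \<open>The linearisation error is of order \<open>\<epsilon>\<close> where the unperturbed argument is close to, but
  different from, a break point, and of order \<open>\<epsilon>\<^sup>2\<close> elsewhere.  The former set shrinks to the empty
  set as \<open>\<epsilon> \<rightarrow> 0\<close>, which makes the error \<open>o(\<epsilon>)\<close> in \<open>L\<^sup>2\<close>.\<close>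

lemma newton_superlinear_step:
  assumes opt: "optimality_system f z y' w'" and near: "uniformly_solvable_near y' w'" and \<eta>: "\<eta> > 0"
  shows "\<exists>\<rho>>0. \<forall>y\<in>HN. \<forall>w\<in>HN. H2_pair_dist D (y, w) (y', w') < \<rho> \<longrightarrow>
    (\<forall>\<delta>y \<delta>w. newton_update D \<nu> S \<alpha> d u \<gamma> f z y w \<delta>y \<delta>w \<longrightarrow>
      H2_pair_dist D (\<lambda>x. y x + \<delta>y x, \<lambda>x. w x + \<delta>w x) (y', w') \<le> \<eta> * H2_pair_dist D (y, w) (y', w'))"
proof -
  interpret fm: finite_measure M by (rule finite_measure_M)
  have y': "y' \<in> HN" and w': "w' \<in> HN" using opt by (auto simp: optimality_system_def)
  obtain CE where ce: "embedding_constant CE" by (rule embedding_constant_exists)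
  then have CE: "CE \<ge> 0" "\<And>v. v \<in> H2 D \<Longrightarrow> AE x in M. \<bar>v x\<bar> \<le> CE * H2_norm D v"
    by (auto simp: embedding_constant_def)
  obtain K \<rho>1 where K: "K > 0" and \<rho>1: "\<rho>1 > 0" and ap: "\<And>y w. y \<in> HN \<Longrightarrow> w \<in> HN \<Longrightarrow>
     H2_norm D (\<lambda>x. y x - y' x) < \<rho>1 \<Longrightarrow> H2_norm D (\<lambda>x. w x - w' x) < \<rho>1 \<Longrightarrow>
       a_priori (pot y w) (weight y w) (damp y w) K"
    using near unfolding uniformly_solvable_near_def by blast
  obtain m where m0: "m \<ge> 0" and y'm: "AE x in M. \<bar>y' x\<bar> \<le> m" and w'm: "AE x in M. \<bar>w' x\<bar> \<le> m"
    by (rule HN_bounded[OF y' w'])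
  note [measurable] = HN_measurable[OF y'] HN_measurable[OF w']
  define q' where "q' x = - y' x * w' x" for x
  have q'_m [measurable]: "q' \<in> borel_measurable M" unfolding q'_def[abs_def] by measurable
  define C where "C = (2 * real d * m * (2 * m + 1) + (2 * m + 1) + (m + 1)) / \<gamma>"
  have C0: "C \<ge> 0" using m0 \<gamma>_pos by (simp add: C_def)
  have "2 * K * (C * CE) \<ge> 0" using K C0 CE by simp
  from scale_below[OF this \<eta>] obtain k where k: "k > 0" "2 * K * (C * CE) * k \<le> \<eta>" by metis
  obtain s \<epsilon>0 A where \<epsilon>0: "0 < \<epsilon>0" "\<epsilon>0 \<le> 1" and \<epsilon>s: "(2 * m + 1) * \<epsilon>0 \<le> s" and Am: "A \<in> sets M"
    and A_def: "A = {x \<in> space M. \<exists>p\<in>breakpoints. 0 < \<bar>q' x - p\<bar> \<and> \<bar>q' x - p\<bar> \<le> s}"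
    and Ak: "sqrt (measure M A) + \<epsilon>0 * sqrt (measure M (space M)) \<le> k"
    by (rule near_break_set[OF q'_m m0 k(1)])
  obtain \<rho>2 where \<rho>2: "\<rho>2 > 0" "CE * \<rho>2 \<le> \<epsilon>0" by (rule scale_below[OF CE(1) \<epsilon>0(1)])
  define \<rho> where "\<rho> = min \<rho>1 \<rho>2"
  have \<rho>: "\<rho> > 0" using \<rho>1 \<rho>2 by (simp add: \<rho>_def)
  show ?thesis
  proof (intro exI[of _ \<rho>] conjI ballI impI allI \<rho>)
    fix y w \<delta>y \<delta>w
    assume y: "y \<in> HN" and w: "w \<in> HN" and close: "H2_pair_dist D (y, w) (y', w') < \<rho>"
      and upd: "newton_update D \<nu> S \<alpha> d u \<gamma> f z y w \<delta>y \<delta>w"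
    define e where "e = H2_pair_dist D (y, w) (y', w')"
    have ey: "H2_norm D (\<lambda>x. y x - y' x) \<le> e" and ew: "H2_norm D (\<lambda>x. w x - w' x) \<le> e"
      using H2_pair_dist_ge[where p = "(y, w)" and q = "(y', w')"] by (simp_all add: e_def)
    have e0: "e \<ge> 0" using ey H2_norm_nonneg[of "\<lambda>x. y x - y' x"] by linarith
    define \<epsilon> where "\<epsilon> = CE * e"
    have \<epsilon>_nonneg: "\<epsilon> \<ge> 0" using CE e0 by (simp add: \<epsilon>_def)
    have "\<epsilon> \<le> CE * \<rho>2"
      unfolding \<epsilon>_def using close CE(1) by (intro mult_left_mono) (auto simp: e_def \<rho>_def)
    then have \<epsilon>le: "\<epsilon> \<le> \<epsilon>0" using \<rho>2(2) by linarith
    have \<epsilon>1: "\<epsilon> \<le> 1" using \<epsilon>le \<epsilon>0 by simp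
    have \<epsilon>s': "(2 * m + 1) * \<epsilon> \<le> s"
      using mult_left_mono[OF \<epsilon>le, of "2 * m + 1"] \<epsilon>s m0 by linarith
    note ym = HN_measurable[OF y] and wm = HN_measurable[OF w]
    note [measurable] = ym wm
    have dy: "AE x in M. \<bar>y x - y' x\<bar> \<le> \<epsilon>" by (rule AE_close[OF ce y y' ey]) (simp add: \<epsilon>_def)
    have dw: "AE x in M. \<bar>w x - w' x\<bar> \<le> \<epsilon>" by (rule AE_close[OF ce w w' ew]) (simp add: \<epsilon>_def)
    have C\<epsilon>: "C * \<epsilon> \<ge> 0" using C0 \<epsilon>_nonneg by simp
    have "\<epsilon> * sqrt (measure M (space M)) \<le> \<epsilon>0 * sqrt (measure M (space M))"
      by (rule mult_right_mono[OF \<epsilon>le]) simp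
    then have "sqrt (measure M A) + \<epsilon> * sqrt (measure M (space M)) \<le> k" using Ak by linarith
    note small = mult_left_mono[OF this C\<epsilon>]
    have meas: "(\<lambda>x. defect (y x) (w x) (y' x) (w' x)) \<in> borel_measurable M"
      "(\<lambda>x. defect (w x) (y x) (w' x) (y' x)) \<in> borel_measurable M"
      unfolding defect_def by measurable
    have ind: "(if \<exists>p\<in>breakpoints. 0 < \<bar>t - p\<bar> \<and> \<bar>t - p\<bar> \<le> s then 1 else 0) = (indicator A x :: real)"
      if "t = q' x" "x \<in> space M" for t x
      using that by (simp add: A_def indicator_def)
    have b1: "AE x in M. \<bar>defect (y x) (w x) (y' x) (w' x)\<bar> \<le> C * \<epsilon> * (indicator A x + \<epsilon>)"
      using y'm w'm dy dw AE_space
    proof eventually_elim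
      case (elim x)
      have "- y' x * w' x = q' x" by (simp add: q'_def)
      from ind[OF this elim(5)] show ?case
        using defect_bound[OF elim(1-4) \<epsilon>1 \<epsilon>s', folded C_def] by (simp only:)
    qed
    have b2: "AE x in M. \<bar>defect (w x) (y x) (w' x) (y' x)\<bar> \<le> C * \<epsilon> * (indicator A x + \<epsilon>)"
      using y'm w'm dy dw AE_space
    proof eventually_elim
      case (elim x)
      have "- w' x * y' x = q' x" by (simp add: q'_def)
      from ind[OF this elim(5)] show ?case
        using defect_bound[OF elim(2,1,4,3) \<epsilon>1 \<epsilon>s', folded C_def] by (simp only:)
    qed
    note d1 = L2_norm_indicator_bound[OF finite_measure_M meas(1) Am b1 C\<epsilon> \<epsilon>_nonneg]
    note d2 = L2_norm_indicator_bound[OF finite_measure_M meas(2) Am b2 C\<epsilon> \<epsilon>_nonneg]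
    note err = newton_error_equation[OF opt y w upd]
    let ?ey = "\<lambda>x. y x + \<delta>y x - y' x" and ?ew = "\<lambda>x. w x + \<delta>w x - w' x"
    note bc = coefficients_bounded[OF y w]
    have "H2_norm D ?ey + H2_norm D ?ew \<le> K * (L2_norm M (sys1 (pot y w) (weight y w) ?ey ?ew) + L2_norm M (sys2 (pot y w) (damp y w) ?ey ?ew))"
    proof -
      have "e < \<rho>1" using close by (simp add: e_def \<rho>_def)
      then have "a_priori (pot y w) (weight y w) (damp y w) K" using ey ew by (intro ap y w) auto
      then show ?thesis using err(1,2) by (simp add: a_priori_def)
    qed
    also have "L2_norm M (sys1 (pot y w) (weight y w) ?ey ?ew) = L2_norm M (\<lambda>x. defect (y x) (w x) (y' x) (w' x))"
      by (rule L2_norm_cong_AE[OF L2_measurable[OF sys1_L2[OF bc(1,2) err(1,2)]] meas(1) err(3)])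
    also have "L2_norm M (sys2 (pot y w) (damp y w) ?ey ?ew) = L2_norm M (\<lambda>x. defect (w x) (y x) (w' x) (y' x))"
      by (rule L2_norm_cong_AE[OF L2_measurable[OF sys2_L2[OF bc(1,3) err(1,2)]] meas(2) err(4)])
    also have "K * (L2_norm M (\<lambda>x. defect (y x) (w x) (y' x) (w' x)) + L2_norm M (\<lambda>x. defect (w x) (y x) (w' x) (y' x)))
        \<le> K * (C * \<epsilon> * k + C * \<epsilon> * k)"
      using d1(2) d2(2) small K by (intro mult_left_mono add_mono) linarith+
    also have "\<dots> = 2 * K * (C * CE) * k * e" by (simp add: \<epsilon>_def)
    also have "\<dots> \<le> \<eta> * e" by (rule mult_right_mono[OF k(2) e0])
    finally have "H2_norm D ?ey + H2_norm D ?ew \<le> \<eta> * e" .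
    then show "H2_pair_dist D (\<lambda>x. y x + \<delta>y x, \<lambda>x. w x + \<delta>w x) (y', w') \<le> \<eta> * H2_pair_dist D (y, w) (y', w')"
      using H2_pair_dist_le[where p = "(\<lambda>x. y x + \<delta>y x, \<lambda>x. w x + \<delta>w x)" and q = "(y', w')"]
      unfolding e_def by simp
  qed
qed

lemma newton_uniquely_solvable_near:
  assumes f: "f \<in> L2 M" and z: "z \<in> L2 M" and near: "uniformly_solvable_near y' w'"
  shows "\<exists>\<rho>>0. \<forall>y\<in>HN. \<forall>w\<in>HN. H2_pair_dist D (y, w) (y', w') < \<rho> \<longrightarrow>
    newton_uniquely_solvable D \<nu> S \<alpha> d u \<gamma> f z y w"
proof -
  obtain K \<rho> where K: "K > 0" and \<rho>: "\<rho> > 0" and ap: "\<And>y w. y \<in> HN \<Longrightarrow> w \<in> HN \<Longrightarrow>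
     H2_norm D (\<lambda>x. y x - y' x) < \<rho> \<Longrightarrow> H2_norm D (\<lambda>x. w x - w' x) < \<rho> \<Longrightarrow>
       a_priori (pot y w) (weight y w) (damp y w) K \<and> solvable (pot y w) (weight y w) (damp y w)"
    using near unfolding uniformly_solvable_near_def by blast
  show ?thesis
  proof (intro exI[of _ \<rho>] conjI ballI impI \<rho>)
    fix y w assume y: "y \<in> HN" and w: "w \<in> HN" and close: "H2_pair_dist D (y, w) (y', w') < \<rho>"
    note ym = HN_measurable[OF y] and wm = HN_measurable[OF w]
    note [measurable] = ym wm
    have "H2_norm D (\<lambda>x. y x - y' x) < \<rho>" "H2_norm D (\<lambda>x. w x - w' x) < \<rho>"
      using H2_pair_dist_ge[where p = "(y, w)" and q = "(y', w')"] close by simp_all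
    from ap[OF y w this] have ap: "a_priori (pot y w) (weight y w) (damp y w) K"
      and solv: "solvable (pot y w) (weight y w) (damp y w)" by auto
    have Hb: "bounded_coeff (\<lambda>x. H (- y x * w x))"
    proof (rule bounded_coeffI[of _ "u d"])
      show "AE x in M. \<bar>H (- y x * w x)\<bar> \<le> u d"
      proof (rule AE_I2)
        fix x show "\<bar>H (- y x * w x)\<bar> \<le> u d"
          using H_lower[of "- y x * w x"] H_upper[of "- y x * w x"] \<mu>_pos by linarith
      qed
    qed measurable
    have res1: "(\<lambda>x. - residual1 D \<alpha> d u \<gamma> z y w x) \<in> L2 M"
      unfolding residual1_def
      by (rule L2_minus[OF L2_diff[OF L2_add[OF L2_add[OF L2_minus[OF laplacian_L2[OF HN_H2[OF w]]]
        bounded_coeff_mult_L2[OF Hb HN_L2[OF w]]] HN_L2[OF y]] z]])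
    have res2: "(\<lambda>x. - residual2 D \<alpha> d u \<gamma> f y w x) \<in> L2 M"
      unfolding residual2_def
      by (rule L2_minus[OF L2_diff[OF L2_add[OF L2_minus[OF laplacian_L2[OF HN_H2[OF y]]]
        bounded_coeff_mult_L2[OF Hb HN_L2[OF y]]] f]])
    obtain \<delta>y \<delta>w where \<delta>: "newton_update D \<nu> S \<alpha> d u \<gamma> f z y w \<delta>y \<delta>w"
      using solv[unfolded solvable_def, rule_format, OF res1 res2] unfolding newton_update_iff by blast
    have "AE x in M. py x = \<delta>y x" "AE x in M. pw x = \<delta>w x"
      if p: "newton_update D \<nu> S \<alpha> d u \<gamma> f z y w py pw" for py pw
    proof -
      have HNs: "py \<in> HN" "pw \<in> HN" "\<delta>y \<in> HN" "\<delta>w \<in> HN" using p \<delta> by (auto simp: newton_update_iff)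
      define ey where "ey x = py x + (-1) * \<delta>y x" for x
      define ew where "ew x = pw x + (-1) * \<delta>w x" for x
      have e: "ey \<in> HN" "ew \<in> HN" unfolding ey_def[abs_def] ew_def[abs_def] by (intro HN_lincomb HNs)+
      have up: "AE x in M. sys1 (pot y w) (weight y w) py pw x = - residual1 D \<alpha> d u \<gamma> z y w x"
        "AE x in M. sys2 (pot y w) (damp y w) py pw x = - residual2 D \<alpha> d u \<gamma> f y w x"
        "AE x in M. sys1 (pot y w) (weight y w) \<delta>y \<delta>w x = - residual1 D \<alpha> d u \<gamma> z y w x"
        "AE x in M. sys2 (pot y w) (damp y w) \<delta>y \<delta>w x = - residual2 D \<alpha> d u \<gamma> f y w x"
        using p \<delta> by (auto simp: newton_update_iff)
      note bc = coefficients_bounded[OF y w]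
      have "AE x in M. sys1 (pot y w) (weight y w) ey ew x = 0"
        using sys1_lincomb[OF HNs, of "pot y w" "weight y w" "-1", folded ey_def[abs_def] ew_def[abs_def]] up(1,3)
        by eventually_elim simp
      then have z1: "L2_norm M (sys1 (pot y w) (weight y w) ey ew) = 0"
        using L2_norm_eq_0_iff[OF sys1_L2[OF bc(1,2) e]] by simp
      have "AE x in M. sys2 (pot y w) (damp y w) ey ew x = 0"
        using sys2_lincomb[OF HNs, of "pot y w" "damp y w" "-1", folded ey_def[abs_def] ew_def[abs_def]] up(2,4)
        by eventually_elim simp
      then have z2: "L2_norm M (sys2 (pot y w) (damp y w) ey ew) = 0"
        using L2_norm_eq_0_iff[OF sys2_L2[OF bc(1,3) e]] by simp
      have "H2_norm D ey + H2_norm D ew \<le> 0" using ap e z1 z2 unfolding a_priori_def by fastforce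
      then have "H2_norm D ey = 0" "H2_norm D ew = 0"
        using H2_norm_nonneg[of ey] H2_norm_nonneg[of ew] by linarith+
      from H2_norm_eq_0_AE[OF HN_H2[OF e(1)] this(1)] H2_norm_eq_0_AE[OF HN_H2[OF e(2)] this(2)]
      show "AE x in M. py x = \<delta>y x" "AE x in M. pw x = \<delta>w x"
        by (auto simp: ey_def ew_def elim!: eventually_mono)
    qed
    then show "newton_uniquely_solvable D \<nu> S \<alpha> d u \<gamma> f z y w"
      unfolding newton_uniquely_solvable_def ae_eq_def using \<delta> by blast
  qed
qed

end

lemma superlinearI:
  assumes nonneg: "\<And>k. 0 \<le> e k" and half: "\<And>k. e (Suc k) \<le> e k / 2"
    and small: "\<And>\<eta>. \<eta> > 0 \<Longrightarrow> \<exists>\<rho>>0. \<forall>k. e k < \<rho> \<longrightarrow> e (Suc k) \<le> \<eta> * e k"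
  shows "superlinear e"
proof -
  have "e k \<le> e 0 * (1/2) ^ k" for k
  proof (induction k)
    case (Suc k)
    then show ?case using half[of k] by simp
  qed simp
  moreover have "(\<lambda>k. e 0 * (1/2) ^ k) \<longlonglongrightarrow> 0"
    by (intro tendsto_mult_right_zero LIMSEQ_power_zero) simp
  ultimately have lim: "e \<longlonglongrightarrow> 0"
    by (intro Lim_null_comparison[of e "\<lambda>k. e 0 * (1/2) ^ k"]) (simp_all add: nonneg)
  moreover have "(\<lambda>k. e (Suc k)) \<in> o(e)"
  proof (rule landau_o.smallI)
    fix c :: real assume "c > 0"
    then obtain \<rho> where \<rho>: "\<rho> > 0" "\<And>k. e k < \<rho> \<Longrightarrow> e (Suc k) \<le> c * e k" using small by blast
    have "\<forall>\<^sub>F k in sequentially. e k < \<rho>" using lim \<rho>(1) by (rule order_tendstoD)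
    then show "\<forall>\<^sub>F k in sequentially. norm (e (Suc k)) \<le> c * norm (e k)"
      by eventually_elim (simp add: nonneg \<rho>)
  qed
  ultimately show ?thesis by (simp add: superlinear_def)
qed

context newton_setting
begin

text \<open>The step estimate with factor \<open>1/2\<close> keeps the iterates in the ball where the Newton equation is
  uniquely solvable; with arbitrary factors it gives the rate.\<close>

lemma newton_local_convergence:
  assumes f: "f \<in> L2 M" and z: "z \<in> L2 M" and opt: "optimality_system f z y' w'"
    and near: "uniformly_solvable_near y' w'"
  shows "\<exists>\<epsilon>>0. \<forall>y0\<in>HN. \<forall>w0\<in>HN. H2_pair_dist D (y0, w0) (y', w') < \<epsilon> \<longrightarrow>
      (\<exists>Y W. newton_iterates D \<nu> S \<alpha> d u \<gamma> f z y0 w0 Y W) \<and>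
      (\<forall>Y W. newton_iterates D \<nu> S \<alpha> d u \<gamma> f z y0 w0 Y W \<longrightarrow>
         (\<forall>k. newton_uniquely_solvable D \<nu> S \<alpha> d u \<gamma> f z (Y k) (W k)) \<and>
         superlinear (\<lambda>k. H2_pair_dist D (Y k, W k) (y', w')))"
proof -
  let ?upd = "newton_update D \<nu> S \<alpha> d u \<gamma> f z"
  let ?dist = "\<lambda>y w. H2_pair_dist D (y, w) (y', w')"
  obtain \<rho>1 where \<rho>1: "\<rho>1 > 0" and uniq: "\<And>y w. y \<in> HN \<Longrightarrow> w \<in> HN \<Longrightarrow> ?dist y w < \<rho>1 \<Longrightarrow>
      newton_uniquely_solvable D \<nu> S \<alpha> d u \<gamma> f z y w"
    using newton_uniquely_solvable_near[OF f z near] by blast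
  have "(1/2::real) > 0" by simp
  from newton_superlinear_step[OF opt near this] obtain \<rho>2 where \<rho>2: "\<rho>2 > 0"
    and half: "\<And>y w \<delta>y \<delta>w. y \<in> HN \<Longrightarrow> w \<in> HN \<Longrightarrow> ?dist y w < \<rho>2 \<Longrightarrow> ?upd y w \<delta>y \<delta>w \<Longrightarrow>
      ?dist (\<lambda>x. y x + \<delta>y x) (\<lambda>x. w x + \<delta>w x) \<le> 1/2 * ?dist y w" by blast
  have dist0: "0 \<le> ?dist y w" for y w by (simp add: H2_pair_dist_def)
  define \<epsilon> where "\<epsilon> = min \<rho>1 \<rho>2"
  have ball: "(\<lambda>x. y x + \<delta>y x) \<in> HN" "(\<lambda>x. w x + \<delta>w x) \<in> HN"
    "?dist (\<lambda>x. y x + \<delta>y x) (\<lambda>x. w x + \<delta>w x) \<le> ?dist y w / 2"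
    "?dist (\<lambda>x. y x + \<delta>y x) (\<lambda>x. w x + \<delta>w x) < \<epsilon>"
    if y: "y \<in> HN" and w: "w \<in> HN" and close: "?dist y w < \<epsilon>" and upd: "?upd y w \<delta>y \<delta>w" for y w \<delta>y \<delta>w
  proof -
    show "(\<lambda>x. y x + \<delta>y x) \<in> HN" "(\<lambda>x. w x + \<delta>w x) \<in> HN"
      using upd by (auto simp: newton_update_iff intro!: HN_add y w)
    show "?dist (\<lambda>x. y x + \<delta>y x) (\<lambda>x. w x + \<delta>w x) \<le> ?dist y w / 2"
      using half[OF y w _ upd] close by (simp add: \<epsilon>_def)
    then show "?dist (\<lambda>x. y x + \<delta>y x) (\<lambda>x. w x + \<delta>w x) < \<epsilon>"
      using close dist0[of y w] by linarith
  qed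
  show ?thesis
  proof (intro exI[of _ \<epsilon>] conjI ballI impI allI)
    show "\<epsilon> > 0" using \<rho>1 \<rho>2 by (simp add: \<epsilon>_def)
    fix y0 w0 assume y0: "y0 \<in> HN" and w0: "w0 \<in> HN" and close0: "?dist y0 w0 < \<epsilon>"
    show "\<exists>Y W. newton_iterates D \<nu> S \<alpha> d u \<gamma> f z y0 w0 Y W"
    proof -
      define st where "st p = (SOME q. \<exists>\<delta>y \<delta>w. ?upd (fst p) (snd p) \<delta>y \<delta>w \<and>
          q = (\<lambda>x. fst p x + \<delta>y x, \<lambda>x. snd p x + \<delta>w x))" for p
      have st: "\<exists>\<delta>y \<delta>w. ?upd (fst p) (snd p) \<delta>y \<delta>w \<and> st p = (\<lambda>x. fst p x + \<delta>y x, \<lambda>x. snd p x + \<delta>w x)"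
        if "fst p \<in> HN" "snd p \<in> HN" "?dist (fst p) (snd p) < \<epsilon>" for p
      proof -
        have "newton_uniquely_solvable D \<nu> S \<alpha> d u \<gamma> f z (fst p) (snd p)"
          using that by (intro uniq) (auto simp: \<epsilon>_def)
        then have "\<exists>q \<delta>y \<delta>w. ?upd (fst p) (snd p) \<delta>y \<delta>w \<and> q = (\<lambda>x. fst p x + \<delta>y x, \<lambda>x. snd p x + \<delta>w x)"
          unfolding newton_uniquely_solvable_def by blast
        from someI_ex[OF this] show ?thesis unfolding st_def .
      qed
      define P where "P k = (st ^^ k) (y0, w0)" for k
      have P0: "P 0 = (y0, w0)" and PS: "P (Suc k) = st (P k)" for k by (simp_all add: P_def)
      have inv: "fst (P k) \<in> HN \<and> snd (P k) \<in> HN \<and> ?dist (fst (P k)) (snd (P k)) < \<epsilon>" for k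
      proof (induction k)
        case 0
        then show ?case using y0 w0 close0 by (simp add: P0)
      next
        case (Suc k)
        then obtain \<delta>y \<delta>w where "?upd (fst (P k)) (snd (P k)) \<delta>y \<delta>w"
          "st (P k) = (\<lambda>x. fst (P k) x + \<delta>y x, \<lambda>x. snd (P k) x + \<delta>w x)" using st by blast
        then show ?case unfolding PS using Suc ball[of "fst (P k)" "snd (P k)" \<delta>y \<delta>w] by simp
      qed
      have "newton_iterates D \<nu> S \<alpha> d u \<gamma> f z y0 w0 (\<lambda>k. fst (P k)) (\<lambda>k. snd (P k))"
        unfolding newton_iterates_def
      proof (intro conjI allI)
        fix k
        obtain \<delta>y \<delta>w where "?upd (fst (P k)) (snd (P k)) \<delta>y \<delta>w"
          "st (P k) = (\<lambda>x. fst (P k) x + \<delta>y x, \<lambda>x. snd (P k) x + \<delta>w x)" using st inv by blast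
        then show "\<exists>\<delta>y \<delta>w. ?upd (fst (P k)) (snd (P k)) \<delta>y \<delta>w \<and>
            fst (P (Suc k)) = (\<lambda>x. fst (P k) x + \<delta>y x) \<and> snd (P (Suc k)) = (\<lambda>x. snd (P k) x + \<delta>w x)"
          unfolding PS by auto
      qed (simp_all add: P0)
      then show ?thesis by blast
    qed
    fix Y W assume it: "newton_iterates D \<nu> S \<alpha> d u \<gamma> f z y0 w0 Y W"
    have step: "\<exists>\<delta>y \<delta>w. ?upd (Y k) (W k) \<delta>y \<delta>w \<and> Y (Suc k) = (\<lambda>x. Y k x + \<delta>y x) \<and> W (Suc k) = (\<lambda>x. W k x + \<delta>w x)" for k
      using it by (simp add: newton_iterates_def)
    have inv: "Y k \<in> HN \<and> W k \<in> HN \<and> ?dist (Y k) (W k) < \<epsilon>" for k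
    proof (induction k)
      case 0
      then show ?case using it y0 w0 close0 by (simp add: newton_iterates_def)
    next
      case (Suc k)
      obtain \<delta>y \<delta>w where "?upd (Y k) (W k) \<delta>y \<delta>w" "Y (Suc k) = (\<lambda>x. Y k x + \<delta>y x)" "W (Suc k) = (\<lambda>x. W k x + \<delta>w x)"
        using step by blast
      then show ?case using Suc ball[of "Y k" "W k" \<delta>y \<delta>w] by simp
    qed
    show "newton_uniquely_solvable D \<nu> S \<alpha> d u \<gamma> f z (Y k) (W k)" for k
      using inv[of k] by (intro uniq) (auto simp: \<epsilon>_def)
    show "superlinear (\<lambda>k. ?dist (Y k) (W k))"
    proof (rule superlinearI)
      show "?dist (Y (Suc k)) (W (Suc k)) \<le> ?dist (Y k) (W k) / 2" for k
      proof -
        obtain \<delta>y \<delta>w where "?upd (Y k) (W k) \<delta>y \<delta>w" "Y (Suc k) = (\<lambda>x. Y k x + \<delta>y x)" "W (Suc k) = (\<lambda>x. W k x + \<delta>w x)"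
          using step by blast
        then show ?thesis using inv[of k] ball(3)[of "Y k" "W k" \<delta>y \<delta>w] by simp
      qed
      fix \<eta> :: real assume "\<eta> > 0"
      from newton_superlinear_step[OF opt near this] obtain \<rho> where \<rho>: "\<rho> > 0"
        "\<And>y w \<delta>y \<delta>w. y \<in> HN \<Longrightarrow> w \<in> HN \<Longrightarrow> ?dist y w < \<rho> \<Longrightarrow> ?upd y w \<delta>y \<delta>w \<Longrightarrow>
          ?dist (\<lambda>x. y x + \<delta>y x) (\<lambda>x. w x + \<delta>w x) \<le> \<eta> * ?dist y w" by blast
      have "?dist (Y (Suc k)) (W (Suc k)) \<le> \<eta> * ?dist (Y k) (W k)" if "?dist (Y k) (W k) < \<rho>" for k
      proof -
        obtain \<delta>y \<delta>w where "?upd (Y k) (W k) \<delta>y \<delta>w" "Y (Suc k) = (\<lambda>x. Y k x + \<delta>y x)" "W (Suc k) = (\<lambda>x. W k x + \<delta>w x)"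
          using step by blast
        then show ?thesis using inv[of k] \<rho>(2)[of "Y k" "W k" \<delta>y \<delta>w] that by simp
      qed
      then show "\<exists>\<rho>>0. \<forall>k. ?dist (Y k) (W k) < \<rho> \<longrightarrow> ?dist (Y (Suc k)) (W (Suc k)) \<le> \<eta> * ?dist (Y k) (W k)"
        using \<rho>(1) by blast
    qed (rule dist0)
  qed
qed

end

theorem theorem4p5:
  fixes D :: "'a::euclidean_space set" and \<nu> :: "'a \<Rightarrow> 'a" and S :: "'a measure"
    and \<alpha> \<gamma> :: real and d :: nat and u :: "nat \<Rightarrow> real"
    and f z y\<^sub>\<gamma> w\<^sub>\<gamma> :: "'a \<Rightarrow> real"
  assumes "DIM('a) \<le> 3"
    and "open D" and "connected D" and "bounded D" and "D \<noteq> {}"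
    and "outer_unit_normal D \<nu> S"
    and "\<alpha> > 0" and "d \<ge> 2" and "strict_mono_on {1..d} u"
    and "elliptic_regularity D \<nu> S (u 1)"
    and "H2_embeds_continuous D"
    and "f \<in> L2 (lebesgue_on D)" and "z \<in> L2 (lebesgue_on D)"
    and "\<gamma> > 0"
    and "y\<^sub>\<gamma> \<in> H2_Neumann D \<nu> S" and "w\<^sub>\<gamma> \<in> H2_Neumann D \<nu> S"
    and "ae_eq (lebesgue_on D)
           (\<lambda>x. - laplacian D w\<^sub>\<gamma> x + H_reg \<alpha> d u \<gamma> (- y\<^sub>\<gamma> x * w\<^sub>\<gamma> x) * w\<^sub>\<gamma> x + y\<^sub>\<gamma> x) z"
    and "ae_eq (lebesgue_on D)
           (\<lambda>x. - laplacian D y\<^sub>\<gamma> x + H_reg \<alpha> d u \<gamma> (- y\<^sub>\<gamma> x * w\<^sub>\<gamma> x) * y\<^sub>\<gamma> x) f"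
    and "Linf_norm (lebesgue_on D) w\<^sub>\<gamma> < ereal (sqrt \<gamma>) \<or>
         (-1 \<notin> L2_spectrum (lebesgue_on (omega_mixed D \<alpha> d u \<gamma> y\<^sub>\<gamma> w\<^sub>\<gamma>))
                  (K_op D \<nu> S \<alpha> d u \<gamma> y\<^sub>\<gamma> w\<^sub>\<gamma>) \<and>
          omega_boundary D \<alpha> d u \<gamma> y\<^sub>\<gamma> w\<^sub>\<gamma> \<in> null_sets lebesgue)"
  shows "\<exists>\<epsilon>>0. \<forall>y0\<in>H2_Neumann D \<nu> S. \<forall>w0\<in>H2_Neumann D \<nu> S.
    H2_pair_dist D (y0, w0) (y\<^sub>\<gamma>, w\<^sub>\<gamma>) < \<epsilon> \<longrightarrow>
      (\<exists>Y W. newton_iterates D \<nu> S \<alpha> d u \<gamma> f z y0 w0 Y W) \<and>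
      (\<forall>Y W. newton_iterates D \<nu> S \<alpha> d u \<gamma> f z y0 w0 Y W \<longrightarrow>
         (\<forall>k. newton_uniquely_solvable D \<nu> S \<alpha> d u \<gamma> f z (Y k) (W k)) \<and>
         superlinear (\<lambda>k. H2_pair_dist D (Y k, W k) (y\<^sub>\<gamma>, w\<^sub>\<gamma>)))"
proof -
  interpret newton_setting D \<nu> S \<alpha> \<gamma> d u
    by unfold_locales (use assms in auto)
  have "AE x in lebesgue_on D. residual1 D \<alpha> d u \<gamma> z y\<^sub>\<gamma> w\<^sub>\<gamma> x = 0"
    using assms(17) unfolding ae_eq_def by eventually_elim (simp add: residual1_def)
  moreover have "AE x in lebesgue_on D. residual2 D \<alpha> d u \<gamma> f y\<^sub>\<gamma> w\<^sub>\<gamma> x = 0"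
    using assms(18) unfolding ae_eq_def by eventually_elim (simp add: residual2_def)
  ultimately have opt: "optimality_system f z y\<^sub>\<gamma> w\<^sub>\<gamma>"
    using assms(15,16) by (simp add: optimality_system_def)
  have "uniformly_solvable_near y\<^sub>\<gamma> w\<^sub>\<gamma>"
    using assms(19)
  proof (elim disjE conjE)
    assume "Linf_norm (lebesgue_on D) w\<^sub>\<gamma> < ereal (sqrt \<gamma>)"
    then show ?thesis by (rule uniformly_solvable_small_dual[OF assms(15,16)])
  next
    assume "-1 \<notin> L2_spectrum (lebesgue_on (omega_mixed D \<alpha> d u \<gamma> y\<^sub>\<gamma> w\<^sub>\<gamma>)) (K_op D \<nu> S \<alpha> d u \<gamma> y\<^sub>\<gamma> w\<^sub>\<gamma>)"
      "omega_boundary D \<alpha> d u \<gamma> y\<^sub>\<gamma> w\<^sub>\<gamma> \<in> null_sets lebesgue"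
    then show ?thesis by (rule uniformly_solvable_spectral[OF assms(15,16)])
  qed
  from newton_local_convergence[OF assms(12,13) opt this] show ?thesis .
qed

end
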